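(* Let $T_k\in\mathcal{B}(L_2(\mathcal{R}_\Theta))\subset\mathcal{L}(\mathcal{S}_\Theta,\mathcal{S}_\Theta')$. Let $\psi\in\mathcal{S}(\mathbb{R}^n)$ be identically $1$ on $\mathrm{B}_1(0)$ and vanish on $\mathbb{R}^n\setminus\mathrm{B}_2(0)$, and for $0<\delta<\Delta<\infty$ put $\psi_{\Delta,\delta}(x)=\psi(x/\Delta)-\psi(x/\delta)$. Let $T_{\Delta,\delta}^\ell=M_{\psi_{\Delta,\delta}}^\ell(T_k)$ and $T_{\Delta,\delta}^r=M_{\psi_{\Delta,\delta}}^r(T_k)$ be the left and right kernel truncations of $T_k$, and for $\dagger\in\{\ell,r\}$ let $S_k^\dagger\in\mathcal{B}(L_2(\mathcal{R}_\Theta))$ be the weak-$*$ limit in $\mathcal{B}(L_2(\mathcal{R}_\Theta))$, as $\Delta\to\infty$ and $\delta\to0$, of the (uniformly bounded) family $T_{\Delta,\delta}^\dagger$, possibly along a subfamily. Then there exist $z_\ell,z_r\in\mathcal{R}_\Theta$ such that $$(T_k-S_k^\ell)(a)=a\,z_\ell\qquad\text{and}\qquad(T_k-S_k^r)(a)=z_r\,a$$ for all $a\in L_2(\mathcal{R}_\Theta)$.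
   Context: Fix $n\ge1$ and a real antisymmetric $n\times n$ matrix $\Theta$. Consider the universal C*-algebra generated by strongly continuous one-parameter unitary groups $(u_j(s))_{s\in\mathbb{R}}$, $1\le j\le n$, with $u_j(s)u_k(t)=e^{2\pi i\Theta_{jk}st}u_k(t)u_j(s)$. Put $\lambda_\Theta(\xi)=u_1(\xi_1)\cdots u_n(\xi_n)$ and $\lambda_\Theta(f)=\int_{\mathbb{R}^n}f(\xi)\lambda_\Theta(\xi)\,d\xi$. Let $\mathrm{E}_\Theta$ be the norm closure of $\lambda_\Theta(L_1(\mathbb{R}^n))$, $\tau_\Theta$ the normal faithful semifinite trace determined by $\tau_\Theta(\lambda_\Theta(f))=f(0)$ for $f$ smooth and integrable, and $\mathcal{R}_\Theta=\mathrm{E}_\Theta''$ the von Neumann algebra generated in the GNS representation of $\tau_\Theta$; $L_2(\mathcal{R}_\Theta)$ is the associated noncommutative $L_2$-space. $\mathcal{S}_\Theta=\lambda_\Theta(\mathcal{S}(\mathbb{R}^n))$ carries the topology transported from the Schwartz space $\mathcal{S}(\mathbb{R}^n)$ through $\lambda_\Theta$, and $\mathcal{S}_\Theta'$ is its space of continuous linear functionals. Each $T\in\mathcal{L}(\mathcal{S}_\Theta,\mathcal{S}_\Theta')$ has a kernel $k\in(\mathcal{S}_\Theta\otimes_\pi\mathcal{S}_\Theta)'$ and is written $T_k$. For $\psi\in\mathcal{S}(\mathbb{R}^n)$ with Fourier transform $\widehat\psi(\xi)=\int\psi(x)e^{-2\pi i\langle x,\xi\rangle}dx$ and $T\in\mathcal{L}(\mathcal{S}_\Theta,\mathcal{S}_\Theta')$,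 $$M_\psi^\ell(T)(\varphi)=\int_{\mathbb{R}^n}\widehat\psi(\xi)\,\lambda_\Theta(\xi)\,T(\lambda_\Theta(\xi)^*\varphi)\,d\xi,\qquad M_\psi^r(T)(\varphi)=\int_{\mathbb{R}^n}\widehat\psi(\xi)\,T(\varphi\,\lambda_\Theta(\xi)^* )\,\lambda_\Theta(\xi)\,d\xi$$ for $\varphi\in\mathcal{S}_\Theta$. (In terms of kernels, these correspond to multiplying $k$ on the left or right, in $\mathcal{R}_\Theta\bar\otimes\mathcal{R}_\Theta^{\mathrm{op}}$, by $\pi_\Theta(\psi)=\int\widehat\psi(\xi)\lambda_\Theta(\xi)\otimes\lambda_\Theta(\xi)^*d\xi$.) One has $\|M_\psi^\dagger(T)\|_{\mathcal{B}(L_2(\mathcal{R}_\Theta))}\le\|\widehat\psi\|_{1}\|T\|_{\mathcal{B}(L_2(\mathcal{R}_\Theta))}$, so the truncations are uniformly bounded on $L_2(\mathcal{R}_\Theta)$ and have weak-$*$ convergent subfamilies. *)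

theory Defs
  imports "HOL-Analysis.Analysis"
begin

section \<open>Complex Hilbert spaces and von Neumann algebras\<close>

text \<open>The complex inner product is linear in its second argument; the norm, the topology and the
  real inner product are those of the underlying real Hilbert space.\<close>

class complex_hilbert = real_inner + banach +
  fixes scaleC :: "complex \<Rightarrow> 'a \<Rightarrow> 'a" (infixr "*\<^sub>C" 75)
    and cinner :: "'a \<Rightarrow> 'a \<Rightarrow> complex"
  assumes scaleC_add_right: "c *\<^sub>C (x + y) = c *\<^sub>C x + c *\<^sub>C y"
    and scaleC_add_left: "(c + d) *\<^sub>C x = c *\<^sub>C x + d *\<^sub>C x"
    and scaleC_scaleC: "c *\<^sub>C (d *\<^sub>C x) = (c * d) *\<^sub>C x"
    and scaleR_scaleC: "r *\<^sub>R x = complex_of_real r *\<^sub>C x"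
    and cinner_commute: "cinner x y = cnj (cinner y x)"
    and cinner_add_right: "cinner x (y + z) = cinner x y + cinner x z"
    and cinner_scaleC_right: "cinner x (c *\<^sub>C y) = c * cinner x y"
    and Re_cinner: "Re (cinner x y) = inner x y"

text \<open>\<^term>\<open>bops\<close> is the algebra of all bounded complex-linear operators. The type of bounded
  real-linear operators supplies composition and the operator norm.\<close>

type_synonym 'h op = "'h \<Rightarrow>\<^sub>L 'h"

definition bops :: "'h::complex_hilbert op set" where
  "bops = {A :: 'h op. \<forall>c x. A (c *\<^sub>C x) = c *\<^sub>C A x}"

definition adj :: "'h::complex_hilbert op \<Rightarrow> 'h op" where
  "adj A = (THE B :: 'h op. \<forall>x y. cinner (A x) y = cinner x (B y))"

definition unitary :: "'h::complex_hilbert op \<Rightarrow> bool" where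
  "unitary A \<longleftrightarrow> A \<in> bops \<and> adj A o\<^sub>L A = id_blinfun \<and> A o\<^sub>L adj A = id_blinfun"

definition commutant :: "'h::complex_hilbert op set \<Rightarrow> 'h op set" where
  "commutant X = {A \<in> bops. \<forall>B\<in>X. A o\<^sub>L B = B o\<^sub>L A}"

definition positive_op :: "'h::complex_hilbert op \<Rightarrow> bool" where
  "positive_op A \<longleftrightarrow> A \<in> bops \<and> (\<forall>x. Im (cinner x (A x)) = 0 \<and> Re (cinner x (A x)) \<ge> 0)"

definition op_le :: "'h::complex_hilbert op \<Rightarrow> 'h op \<Rightarrow> bool" where
  "op_le A B \<longleftrightarrow> positive_op (B - A)"

definition pos_part :: "'h::complex_hilbert op set \<Rightarrow> 'h op set" where
  "pos_part M = {x \<in> M. positive_op x}"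

text \<open>Convergence in the weak-* topology of the operator algebra, i.e. against all trace class
  operators; these induce the functionals $A \mapsto \sum_n \langle h_n, A k_n\rangle$ with
  $\sum_n \|h_n\|^2$ and $\sum_n \|k_n\|^2$ finite.\<close>

definition weak_star_limit ::
  "('i \<Rightarrow> 'h::complex_hilbert op) \<Rightarrow> 'h op \<Rightarrow> 'i filter \<Rightarrow> bool" where
  "weak_star_limit A S F \<longleftrightarrow>
     (\<forall>h k :: nat \<Rightarrow> 'h.
        summable (\<lambda>n. (norm (h n))\<^sup>2) \<longrightarrow> summable (\<lambda>n. (norm (k n))\<^sup>2) \<longrightarrow>
        ((\<lambda>i. \<Sum>n. cinner (h n) (A i (k n))) \<longlongrightarrow> (\<Sum>n. cinner (h n) (S (k n)))) F)"


subsection \<open>Traces and the noncommutative $L_2$-space\<close>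

text \<open>A trace on a von Neumann algebra \<open>M\<close> is a function on the positive elements of \<open>M\<close>; the
  values of \<open>\<tau>\<close> elsewhere are irrelevant.\<close>

definition trace_on :: "'h::complex_hilbert op set \<Rightarrow> ('h op \<Rightarrow> ennreal) \<Rightarrow> bool" where
  "trace_on M \<tau> \<longleftrightarrow>
     (\<forall>x\<in>pos_part M. \<forall>y\<in>pos_part M. \<tau> (x + y) = \<tau> x + \<tau> y) \<and>
     (\<forall>x\<in>pos_part M. \<forall>r\<ge>0. \<tau> (r *\<^sub>R x) = ennreal r * \<tau> x) \<and>
     (\<forall>x\<in>M. \<tau> (adj x o\<^sub>L x) = \<tau> (x o\<^sub>L adj x))"

definition faithful_trace :: "'h::complex_hilbert op set \<Rightarrow> ('h op \<Rightarrow> ennreal) \<Rightarrow> bool" where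
  "faithful_trace M \<tau> \<longleftrightarrow> (\<forall>x\<in>pos_part M. \<tau> x = 0 \<longrightarrow> x = 0)"

definition semifinite_trace :: "'h::complex_hilbert op set \<Rightarrow> ('h op \<Rightarrow> ennreal) \<Rightarrow> bool" where
  "semifinite_trace M \<tau> \<longleftrightarrow>
     (\<forall>x\<in>pos_part M. x \<noteq> 0 \<longrightarrow> (\<exists>y\<in>pos_part M. y \<noteq> 0 \<and> op_le y x \<and> \<tau> y < \<infinity>))"

definition normal_trace :: "'h::complex_hilbert op set \<Rightarrow> ('h op \<Rightarrow> ennreal) \<Rightarrow> bool" where
  "normal_trace M \<tau> \<longleftrightarrow>
     (\<forall>D x. D \<subseteq> pos_part M \<and> D \<noteq> {} \<and> (\<forall>a\<in>D. \<forall>b\<in>D. \<exists>c\<in>D. op_le a c \<and> op_le b c) \<and>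
        x \<in> pos_part M \<and> (\<forall>a\<in>D. op_le a x) \<and>
        (\<forall>y\<in>pos_part M. (\<forall>a\<in>D. op_le a y) \<longrightarrow> op_le x y)
        \<longrightarrow> \<tau> x = (SUP a\<in>D. \<tau> a))"

definition nsq :: "'h::complex_hilbert op set \<Rightarrow> ('h op \<Rightarrow> ennreal) \<Rightarrow> 'h op set" where
  "nsq M \<tau> = {x \<in> M. \<tau> (adj x o\<^sub>L x) < \<infinity>}"

text \<open>\<open>standard_L2 M \<tau> \<Lambda>\<close>: the Hilbert space on which \<open>M\<close> acts is $L_2(M,\tau)$. That is, it is the
  completion, through the embedding \<open>\<Lambda>\<close>, of $\{x \in M : \tau(x^*x) < \infty\}$ for the norm
  $\|x\|_2 = \tau(x^*x)^{1/2}$, and \<open>M\<close> acts by left multiplication (the GNS representation).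
  Complex homogeneity of \<open>\<Lambda>\<close> is the case of scalar \<open>x\<close> in the second clause.\<close>

definition standard_L2 ::
  "'h::complex_hilbert op set \<Rightarrow> ('h op \<Rightarrow> ennreal) \<Rightarrow> ('h op \<Rightarrow> 'h) \<Rightarrow> bool" where
  "standard_L2 M \<tau> \<Lambda> \<longleftrightarrow>
     (\<forall>x\<in>nsq M \<tau>. \<forall>y\<in>nsq M \<tau>. \<Lambda> (x + y) = \<Lambda> x + \<Lambda> y) \<and>
     (\<forall>x\<in>M. \<forall>y\<in>nsq M \<tau>. \<Lambda> (x o\<^sub>L y) = x (\<Lambda> y)) \<and>
     (\<forall>x\<in>nsq M \<tau>. ennreal ((norm (\<Lambda> x))\<^sup>2) = \<tau> (adj x o\<^sub>L x)) \<and>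
     closure (\<Lambda> ` nsq M \<tau>) = UNIV"

text \<open>\<open>right_mult M \<tau> \<Lambda> z a\<close> is the product \<open>a z\<close> of \<open>a\<close> in $L_2(M,\tau)$ and \<open>z\<close> in \<open>M\<close>: the
  continuous extension of $x \mapsto xz$. The product \<open>z a\<close> is just \<open>z\<close> applied to \<open>a\<close>.\<close>

definition right_mult ::
  "'h::complex_hilbert op set \<Rightarrow> ('h op \<Rightarrow> ennreal) \<Rightarrow> ('h op \<Rightarrow> 'h) \<Rightarrow> 'h op \<Rightarrow> 'h op" where
  "right_mult M \<tau> \<Lambda> z = (THE R :: 'h op. \<forall>x\<in>nsq M \<tau>. R (\<Lambda> x) = \<Lambda> (x o\<^sub>L z))"


section \<open>Smooth functions, Schwartz functions, Fourier transform\<close>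

fun iter_partial :: "'n list \<Rightarrow> (real^'n \<Rightarrow> complex) \<Rightarrow> real^'n::finite \<Rightarrow> complex" where
  "iter_partial [] f = f"
| "iter_partial (i # is) f = (\<lambda>x. frechet_derivative (iter_partial is f) (at x) (axis i 1))"

definition smooth :: "(real^'n::finite \<Rightarrow> complex) \<Rightarrow> bool" where
  "smooth f \<longleftrightarrow> (\<forall>is x. iter_partial is f differentiable (at x))"

definition schwartz :: "(real^'n::finite \<Rightarrow> complex) \<Rightarrow> bool" where
  "schwartz f \<longleftrightarrow> smooth f \<and> (\<forall>is k. \<exists>C. \<forall>x. norm x ^ k * norm (iter_partial is f x) \<le> C)"

definition fourier :: "(real^'n::finite \<Rightarrow> complex) \<Rightarrow> real^'n \<Rightarrow> complex" where
  "fourier \<psi> \<xi> = (LINT x|lborel. \<psi> x * cis (- 2 * pi * (x \<bullet> \<xi>)))"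


section \<open>Quantum Euclidean spaces\<close>

text \<open>Coordinates are indexed by a finite linearly ordered type, since the order of the factors in
  $u_1(\xi_1) \cdots u_n(\xi_n)$ matters.\<close>

definition weyl_system ::
  "real^('n::{finite,linorder})^('n::{finite,linorder}) \<Rightarrow> ('n \<Rightarrow> real \<Rightarrow> 'h::complex_hilbert op) \<Rightarrow> bool" where
  "weyl_system \<Theta> u \<longleftrightarrow>
     (\<forall>j s. unitary (u j s)) \<and>
     (\<forall>j s t. u j (s + t) = u j s o\<^sub>L u j t) \<and>
     (\<forall>j h. continuous_on UNIV (\<lambda>s. u j s h)) \<and>
     (\<forall>j k s t h. u j s (u k t h) = cis (2 * pi * \<Theta> $ j $ k * s * t) *\<^sub>C u k t (u j s h))"

definition weyl_op ::
  "('n \<Rightarrow> real \<Rightarrow> 'h::complex_hilbert op) \<Rightarrow> real^'n::{finite,linorder} \<Rightarrow> 'h op" where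
  "weyl_op u \<xi> = foldr (\<lambda>j A. u j (\<xi> $ j) o\<^sub>L A) (sorted_list_of_set UNIV) id_blinfun"

text \<open>The operator-valued integral $\int f(\xi) \lambda_\Theta(\xi)\,d\xi$ in the weak sense.\<close>

definition weyl_int ::
  "('n \<Rightarrow> real \<Rightarrow> 'h::complex_hilbert op) \<Rightarrow> (real^'n::{finite,linorder} \<Rightarrow> complex) \<Rightarrow> 'h op" where
  "weyl_int u f = (THE A :: 'h op. A \<in> bops \<and>
     (\<forall>h k. cinner h (A k) = (LINT \<xi>|lborel. f \<xi> * cinner h (weyl_op u \<xi> k))))"

definition E_alg :: "('n::{finite,linorder} \<Rightarrow> real \<Rightarrow> 'h::complex_hilbert op) \<Rightarrow> 'h op set" where
  "E_alg u = closure (weyl_int u ` {f. integrable lborel f})"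

definition R_alg :: "('n::{finite,linorder} \<Rightarrow> real \<Rightarrow> 'h::complex_hilbert op) \<Rightarrow> 'h op set" where
  "R_alg u = commutant (commutant (E_alg u))"

definition S_alg :: "('n::{finite,linorder} \<Rightarrow> real \<Rightarrow> 'h::complex_hilbert op) \<Rightarrow> 'h op set" where
  "S_alg u = weyl_int u ` {f. schwartz f}"

text \<open>By its universal property, a (nondegenerate) representation of the universal C*-algebra is the
  same thing as a system of unitary groups satisfying the Weyl relations. \<open>quantum_euclidean \<Theta> u \<tau> \<Lambda>\<close>
  says that \<open>u\<close> is the GNS representation of $\tau_\Theta$: the algebra $\mathrm{E}_\Theta''$ it
  generates carries a normal faithful semifinite trace with
  $\tau_\Theta(\lambda_\Theta(f)) = f(0)$, and the Hilbert space is the $L_2$-space of that trace.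
  Traces being defined on positive elements, the formula is stated for positive
  $\lambda_\Theta(f)$, where \<open>f 0\<close> is real and nonnegative. This determines \<open>\<tau>\<close>, as it covers
  all $\lambda_\Theta(f)^*\lambda_\Theta(f)$ with \<open>f\<close> Schwartz.\<close>

definition quantum_euclidean ::
  "real^('n::{finite,linorder})^('n::{finite,linorder}) \<Rightarrow> ('n \<Rightarrow> real \<Rightarrow> 'h::complex_hilbert op) \<Rightarrow>
   ('h op \<Rightarrow> ennreal) \<Rightarrow> ('h op \<Rightarrow> 'h) \<Rightarrow> bool" where
  "quantum_euclidean \<Theta> u \<tau> \<Lambda> \<longleftrightarrow>
     weyl_system \<Theta> u \<and>
     trace_on (R_alg u) \<tau> \<and> normal_trace (R_alg u) \<tau> \<and>
     faithful_trace (R_alg u) \<tau> \<and> semifinite_trace (R_alg u) \<tau> \<and>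
     (\<forall>f. smooth f \<and> integrable lborel f \<and> positive_op (weyl_int u f) \<longrightarrow>
        \<tau> (weyl_int u f) = ennreal (Re (f 0))) \<and>
     standard_L2 (R_alg u) \<tau> \<Lambda>"


subsection \<open>Kernel truncations\<close>

text \<open>An element of the dual of \<^term>\<open>S_alg u\<close> is a functional \<open>'h op \<Rightarrow> complex\<close>, of which only the
  values on \<^term>\<open>S_alg u\<close> matter, and \<open>\<Lambda>\<close> embeds \<^term>\<open>S_alg u\<close> into $L_2$. An element \<open>a\<close> of $L_2$ is
  the functional $x \mapsto \tau(ax) = \langle x^*, a\rangle$. For a functional \<open>w\<close> the products
  $\lambda_\Theta(\xi) w$ and $w \lambda_\Theta(\xi)$ are accordingly
  $x \mapsto w(x \lambda_\Theta(\xi))$ and $x \mapsto w(\lambda_\Theta(\xi) x)$, and integrals of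
  functionals are evaluated pointwise.\<close>

definition L2_functional :: "('h::complex_hilbert op \<Rightarrow> 'h) \<Rightarrow> 'h \<Rightarrow> 'h op \<Rightarrow> complex" where
  "L2_functional \<Lambda> a x = cinner (\<Lambda> (adj x)) a"

definition embed_op ::
  "('h::complex_hilbert op \<Rightarrow> 'h) \<Rightarrow> 'h op \<Rightarrow> ('h op \<Rightarrow> 'h op \<Rightarrow> complex)" where
  "embed_op \<Lambda> T = (\<lambda>\<phi>. L2_functional \<Lambda> (T (\<Lambda> \<phi>)))"

definition mult_left ::
  "('n \<Rightarrow> real \<Rightarrow> 'h::complex_hilbert op) \<Rightarrow> (real^'n::{finite,linorder} \<Rightarrow> complex) \<Rightarrow>
   ('h op \<Rightarrow> 'h op \<Rightarrow> complex) \<Rightarrow> ('h op \<Rightarrow> 'h op \<Rightarrow> complex)" where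
  "mult_left u \<psi> T = (\<lambda>\<phi> x.
     LINT \<xi>|lborel. fourier \<psi> \<xi> * T (adj (weyl_op u \<xi>) o\<^sub>L \<phi>) (x o\<^sub>L weyl_op u \<xi>))"

definition mult_right ::
  "('n \<Rightarrow> real \<Rightarrow> 'h::complex_hilbert op) \<Rightarrow> (real^'n::{finite,linorder} \<Rightarrow> complex) \<Rightarrow>
   ('h op \<Rightarrow> 'h op \<Rightarrow> complex) \<Rightarrow> ('h op \<Rightarrow> 'h op \<Rightarrow> complex)" where
  "mult_right u \<psi> T = (\<lambda>\<phi> x.
     LINT \<xi>|lborel. fourier \<psi> \<xi> * T (\<phi> o\<^sub>L adj (weyl_op u \<xi>)) (weyl_op u \<xi> o\<^sub>L x))"

text \<open>The bounded operator on $L_2$ that a map from \<^term>\<open>S_alg u\<close> to its dual extends to.\<close>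

definition L2_op ::
  "('n::{finite,linorder} \<Rightarrow> real \<Rightarrow> 'h::complex_hilbert op) \<Rightarrow> ('h op \<Rightarrow> 'h) \<Rightarrow>
   ('h op \<Rightarrow> 'h op \<Rightarrow> complex) \<Rightarrow> 'h op" where
  "L2_op u \<Lambda> D = (THE A :: 'h op. A \<in> bops \<and> (\<forall>\<phi>\<in>S_alg u. \<forall>x\<in>S_alg u. D \<phi> x = embed_op \<Lambda> A \<phi> x))"

definition cutoff :: "(real^'n \<Rightarrow> complex) \<Rightarrow> real \<Rightarrow> real \<Rightarrow> real^'n::finite \<Rightarrow> complex" where
  "cutoff \<psi> \<Delta> \<delta> = (\<lambda>x. \<psi> (x /\<^sub>R \<Delta>) - \<psi> (x /\<^sub>R \<delta>))"

definition trunc_left ::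
  "('n \<Rightarrow> real \<Rightarrow> 'h::complex_hilbert op) \<Rightarrow> ('h op \<Rightarrow> 'h) \<Rightarrow>
   (real^'n::{finite,linorder} \<Rightarrow> complex) \<Rightarrow> 'h op \<Rightarrow> real \<Rightarrow> real \<Rightarrow> 'h op" where
  "trunc_left u \<Lambda> \<psi> T \<Delta> \<delta> = L2_op u \<Lambda> (mult_left u (cutoff \<psi> \<Delta> \<delta>) (embed_op \<Lambda> T))"

definition trunc_right ::
  "('n \<Rightarrow> real \<Rightarrow> 'h::complex_hilbert op) \<Rightarrow> ('h op \<Rightarrow> 'h) \<Rightarrow>
   (real^'n::{finite,linorder} \<Rightarrow> complex) \<Rightarrow> 'h op \<Rightarrow> real \<Rightarrow> real \<Rightarrow> 'h op" where
  "trunc_right u \<Lambda> \<psi> T \<Delta> \<delta> = L2_op u \<Lambda> (mult_right u (cutoff \<psi> \<Delta> \<delta>) (embed_op \<Lambda> T))"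

text \<open>A filter of pairs \<open>(\<Delta>, \<delta>)\<close> along which $\Delta \to \infty$ and $\delta \to 0^+$. Subfamilies
  (subnets) of the full family correspond to such filters.\<close>

definition truncation_filter :: "(real \<times> real) filter \<Rightarrow> bool" where
  "truncation_filter F \<longleftrightarrow> F \<noteq> bot \<and> F \<le> at_top \<times>\<^sub>F at_right 0"

end

theory Submission
  imports Defs "HOL-Probability.Probability"
begin

text \<open>On $L_2(\mathcal{R}_\Theta)$ both truncations are averages
  $\int \widehat{\psi_{\Delta,\delta}}(\xi)\, V(\xi)^* T V(\xi)\, d\xi$ over a projective unitary
  representation \<^term>\<open>V\<close> of $\mathbb{R}^n$: for the left truncation $V(\xi)$ multiplies by
  $\lambda_\Theta(\xi)^*$ from the left, for the right truncation from the right. The Fourier transform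
  of \<^term>\<open>cutoff \<psi> \<Delta> \<delta>\<close> is the difference of the dilates of $\widehat\psi$ with parameters
  $\Delta$ and $\delta$. The first is an approximate identity of total mass $\int\widehat\psi = \psi(0) = 1$,
  so its average of \<^term>\<open>T\<close> tends to \<^term>\<open>T\<close> as $\Delta \to \infty$. Hence \<^term>\<open>T - S\<close> is the limit
  of the averages with the second, and these spread over ever larger regions as $\delta \to 0$. A
  translation changes such an average by an amount that tends to zero, so \<^term>\<open>T - S\<close> commutes with
  every $V(\eta)$ (\<open>truncation_limit_invariant\<close>).

  An operator commuting with all $\lambda_\Theta(\eta)$ acting from the left lies in the commutant
  $\mathcal{R}_\Theta'$, and by the commutation theorem for traces it is right multiplication by an element of
  $\mathcal{R}_\Theta$ (\<open>commutant_right_mult\<close>). The conjugation \<open>J\<close>, which extends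
  $\Lambda x \mapsto \Lambda x^*$, interchanges the two actions and reduces the right truncation to the
  same theorem.

  The commutation theorem is proved with left and right bounded vectors. If $A \in \mathcal{R}_\Theta'$
  and \<^term>\<open>B\<close> commutes with all right multiplications, then $A\Lambda x$ is right bounded,
  $B\Lambda y$ is left bounded, and both orders of multiplying these two vectors agree. This
  says $AB\,\Lambda(yx) = BA\,\Lambda(yx)$, and the products $yx$ are dense (\<open>commutation\<close>).

  Two analytic facts make the objects well defined. First, $\lambda_\Theta(f)$ is square integrable for
  Schwartz \<^term>\<open>f\<close>: the symbol of $\lambda_\Theta(f)^*\lambda_\Theta(f)$ is a twisted convolution of Schwartz
  functions, hence Schwartz, and the trace formula applies to it (\<open>weyl_int_nsq\<close>). Secondly,
  the vectors $\Lambda(\lambda_\Theta(f))$ are dense, so that a truncation has at most one bounded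
  extension to $L_2$. Indeed the projection onto their orthogonal complement commutes with the
  Weyl operators and with \<open>J\<close>, so it belongs to $\mathcal{R}_\Theta$; as it annihilates every
  $\Lambda(\lambda_\Theta(f))$, it vanishes (\<open>schwartz_dense\<close>).\<close>

section \<open>Complex Hilbert spaces\<close>

lemma cinner_add_left: "cinner (x + y) z = cinner x z + cinner (y::'h::complex_hilbert) z"
  by (metis cinner_commute cinner_add_right complex_cnj_add)

lemma cinner_scaleC_left: "cinner (c *\<^sub>C x) (y::'h::complex_hilbert) = cnj c * cinner x y"
  by (metis cinner_commute cinner_scaleC_right complex_cnj_mult)

lemma cinner_self: "cinner x (x::'h::complex_hilbert) = of_real ((norm x)\<^sup>2)"
proof -
  have "Im (cinner x x) = 0"
    by (metis cinner_commute cnj.simps(2) equal_neg_zero)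
  then show ?thesis
    by (simp add: complex_eq_iff Re_cinner power2_norm_eq_inner)
qed

lemma norm_scaleC [simp]: "norm (c *\<^sub>C (x::'h::complex_hilbert)) = cmod c * norm x"
proof -
  have "cinner (c *\<^sub>C x) (c *\<^sub>C x) = (cnj c * c) * cinner x x"
    by (simp add: cinner_scaleC_left cinner_scaleC_right)
  also have "cnj c * c = of_real ((cmod c)\<^sup>2)"
    using complex_norm_square[of c] by (simp add: mult.commute)
  finally have "complex_of_real ((norm (c *\<^sub>C x))\<^sup>2) = of_real ((cmod c * norm x)\<^sup>2)"
    unfolding cinner_self by (simp add: power_mult_distrib)
  then show ?thesis
    by (metis of_real_eq_iff norm_ge_zero mult_nonneg_nonneg power2_eq_iff_nonneg)
qed

lemma scaleC_one [simp]: "1 *\<^sub>C (x::'h::complex_hilbert) = x"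
  using scaleR_scaleC[of 1 x] by simp

lemma scaleC_zero_left [simp]: "0 *\<^sub>C (x::'h::complex_hilbert) = 0"
  using scaleR_scaleC[of 0 x] by simp

text \<open>The Cauchy--Schwarz inequality follows from the real one after rotating one argument so that
  the complex inner product becomes nonnegative.\<close>

lemma norm_cinner_le: "norm (cinner x y) \<le> norm x * norm (y::'h::complex_hilbert)"
proof (cases "cinner x y = 0")
  case False
  define c where "c = cnj (sgn (cinner x y))"
  have "cmod c = 1"
    using False by (simp add: c_def norm_sgn)
  have "c * cinner x y = of_real (cmod (cinner x y))"
    using False complex_norm_square[of "cinner x y"]
    by (simp add: c_def sgn_eq field_simps power2_eq_square)
  then have "cmod (cinner x y) = Re (cinner x (c *\<^sub>C y))"
    by (simp add: cinner_scaleC_right)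
  also have "\<dots> = inner x (c *\<^sub>C y)"
    by (rule Re_cinner)
  also have "\<dots> \<le> norm x * norm (c *\<^sub>C y)"
    by (rule norm_cauchy_schwarz)
  finally show ?thesis
    using \<open>cmod c = 1\<close> by simp
qed simp

interpretation cinner: bounded_bilinear "cinner :: 'h::complex_hilbert \<Rightarrow> 'h \<Rightarrow> complex"
proof
  fix r :: real and a b :: 'h
  show "cinner (r *\<^sub>R a) b = r *\<^sub>R cinner a b" "cinner a (r *\<^sub>R b) = r *\<^sub>R cinner a b"
    by (simp_all add: scaleR_scaleC cinner_scaleC_left cinner_scaleC_right scaleR_conv_of_real)
  show "\<exists>K. \<forall>a b::'h. norm (cinner a b) \<le> norm a * norm b * K"
    using norm_cinner_le by (auto intro!: exI[of _ 1])
qed (simp_all add: cinner_add_left cinner_add_right)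

interpretation scaleC: bounded_bilinear "scaleC :: complex \<Rightarrow> 'h::complex_hilbert \<Rightarrow> 'h"
proof
  fix r :: real and a :: complex and b :: 'h
  show "(r *\<^sub>R a) *\<^sub>C b = r *\<^sub>R (a *\<^sub>C b)" "a *\<^sub>C (r *\<^sub>R b) = r *\<^sub>R (a *\<^sub>C b)"
    by (simp_all add: scaleR_scaleC scaleC_scaleC scaleR_conv_of_real mult.commute)
  show "\<exists>K. \<forall>a (b::'h). norm (a *\<^sub>C b) \<le> norm a * norm b * K"
    by (auto intro!: exI[of _ 1])
qed (simp_all add: scaleC_add_left scaleC_add_right)

lemmas [simp] = cinner.zero_left cinner.zero_right scaleC.zero_right

lemma cinner_ext:
  assumes "\<And>h. cinner h x = cinner h (y::'h::complex_hilbert)"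
  shows "x = y"
proof -
  have "cinner (x - y) (x - y) = 0"
    using assms by (simp add: cinner.diff_right)
  then show ?thesis by (simp add: cinner_self)
qed

lemma bopsD: "A \<in> bops \<Longrightarrow> A (c *\<^sub>C x) = c *\<^sub>C A x"
  by (simp add: bops_def)

lemma op_ext_cinner:
  fixes A B :: "'h::complex_hilbert op"
  assumes "\<And>h k. cinner h (A k) = cinner h (B k)"
  shows "A = B"
  by (rule blinfun_eqI, rule cinner_ext, rule assms)

subsection \<open>Minimisation over a closed subspace\<close>

text \<open>The quadratic functional $x \mapsto \frac12\|x\|^2 - f(x)$ is bounded below, and the
  parallelogram law makes every minimising sequence Cauchy. Its minimiser over a closed subspace
  represents \<^term>\<open>f\<close> there. This gives both the Riesz representation theorem (the whole space) and
  orthogonal projections (\<^term>\<open>f\<close> an inner product).\<close>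

lemma riesz_closed_subspace:
  fixes f :: "'a::{real_inner,banach} \<Rightarrow> real"
  assumes f: "bounded_linear f" and K: "closed K" "subspace K"
  obtains a where "a \<in> K" "\<And>x. x \<in> K \<Longrightarrow> f x = inner a x"
proof -
  interpret f: bounded_linear f by (rule f)
  define g where "g x = inner x x / 2 - f x" for x
  obtain B where B: "\<And>x. norm (f x) \<le> norm x * B"
    using f.bounded by blast
  have lower: "- (B\<^sup>2) / 2 \<le> g x" for x
  proof -
    have "f x \<le> norm x * B" using B[of x] by simp
    moreover have "0 \<le> (norm x - B)\<^sup>2" by simp
    ultimately show ?thesis
      by (simp add: g_def power2_norm_eq_inner[symmetric] power2_diff field_simps)
  qed
  have mid: "inner (x - y) (x - y) / 4 = g x + g y - 2 * g ((1/2) *\<^sub>R (x + y))" for x y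
    by (simp add: g_def f.add f.scaleR inner_diff inner_add inner_commute field_simps)
  define m where "m = Inf (g ` K)"
  have bdd: "bdd_below (g ` K)"
    using lower by (intro bdd_belowI) auto
  have "0 \<in> K" using K(2) by (rule subspace_0)
  have m_le: "m \<le> g x" if "x \<in> K" for x
    unfolding m_def using bdd that by (simp add: cInf_lower)
  have "\<exists>x\<in>K. g x < m + 1 / real (Suc n)" for n
  proof -
    have "Inf (g ` K) < m + 1 / real (Suc n)" by (simp add: m_def)
    then show ?thesis
      using bdd \<open>0 \<in> K\<close> cInf_lessD[of "g ` K"] by blast
  qed
  then obtain X where X: "\<And>n. X n \<in> K" "\<And>n. g (X n) < m + 1 / real (Suc n)"
    by metis
  have half: "(1/2) *\<^sub>R (x + y) \<in> K" if "x \<in> K" "y \<in> K" for x y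
    using K(2) that by (intro subspace_scale subspace_add)
  have close: "(norm (X i - X j))\<^sup>2 \<le> 4 * (1 / real (Suc i) + 1 / real (Suc j))" for i j
    using mid[of "X i" "X j"] X(2)[of i] X(2)[of j] m_le[OF half[OF X(1)[of i] X(1)[of j]]]
    by (simp add: power2_norm_eq_inner)
  have "Cauchy X"
  proof (rule CauchyI)
    fix e :: real assume "e > 0"
    obtain N where N: "8 / e\<^sup>2 < real N" using reals_Archimedean2 by blast
    have "norm (X i - X j) < e" if "i \<ge> N" "j \<ge> N" for i j
    proof -
      have small: "1 / real (Suc i) < e\<^sup>2 / 8" if "i \<ge> N" for i
      proof -
        have "8 / e\<^sup>2 < real (Suc i)" using N that by linarith
        then show ?thesis using \<open>e > 0\<close> by (simp add: field_simps)
      qed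
      have "(norm (X i - X j))\<^sup>2 < e\<^sup>2"
        using close[of i j] small[OF that(1)] small[OF that(2)] by simp
      then show ?thesis using \<open>e > 0\<close> by (simp add: power2_less_imp_less)
    qed
    then show "\<exists>M. \<forall>i\<ge>M. \<forall>j\<ge>M. norm (X i - X j) < e" by blast
  qed
  then obtain a where lim: "X \<longlonglongrightarrow> a"
    using Cauchy_convergent convergent_def by blast
  have aK: "a \<in> K"
    using K(1) X(1) lim closed_sequentially by blast
  have "g a \<le> m"
  proof (rule LIMSEQ_le)
    show "(\<lambda>n. g (X n)) \<longlonglongrightarrow> g a"
      unfolding g_def by (intro tendsto_intros lim f.tendsto) simp
    show "(\<lambda>n. m + 1 / real (Suc n)) \<longlonglongrightarrow> m"
      using LIMSEQ_inverse_real_of_nat_add[of m] by (simp add: inverse_eq_divide)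
    show "\<exists>N. \<forall>n\<ge>N. g (X n) \<le> m + 1 / real (Suc n)"
      using X(2) less_imp_le by blast
  qed
  have "f x = inner a x" if "x \<in> K" for x
  proof (rule ccontr)
    assume ne: "f x \<noteq> inner a x"
    define d where "d = inner a x - f x"
    have "d \<noteq> 0" using ne by (simp add: d_def)
    have step: "0 \<le> t * d + t\<^sup>2 * inner x x / 2" for t
    proof -
      have "a + t *\<^sub>R x \<in> K" using K(2) aK that by (intro subspace_add subspace_scale)
      then have "g a \<le> g (a + t *\<^sub>R x)" using m_le \<open>g a \<le> m\<close> by force
      then show ?thesis
        by (simp add: g_def d_def f.add f.scaleR inner_add inner_commute power2_eq_square field_simps)
    qed
    \<comment> \<open>The parabola is negative at \<open>t = -d/q\<close>; the summand 1 keeps the denominator positive.\<close>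
    define q where "q = inner x x + 1"
    have q: "q > 0" "inner x x \<le> q" by (simp_all add: q_def add_nonneg_pos)
    have "0 \<le> (-d/q) * d + (-d/q)\<^sup>2 * inner x x / 2" by (rule step)
    also have "\<dots> \<le> (-d/q) * d + (-d/q)\<^sup>2 * q / 2"
      using q by (intro add_left_mono divide_right_mono mult_left_mono) auto
    also have "\<dots> = - (d\<^sup>2 / (2 * q))"
      using q by (simp add: power2_eq_square field_simps)
    finally show False using q \<open>d \<noteq> 0\<close> by (simp add: field_simps)
  qed
  then show thesis using aK that by blast
qed

text \<open>The Riesz theorem represents the real part of the form in its first argument; the imaginary part
  follows because the form is antilinear there. Adjoints and all weak operator integrals are
  obtained from this lemma.\<close>

lemma form_operator_exists:
  fixes B :: "'h::complex_hilbert \<Rightarrow> 'h \<Rightarrow> complex"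
  assumes add1: "\<And>h h' k. B (h + h') k = B h k + B h' k"
    and scale1: "\<And>c h k. B (c *\<^sub>C h) k = cnj c * B h k"
    and add2: "\<And>h k k'. B h (k + k') = B h k + B h k'"
    and scale2: "\<And>c h k. B h (c *\<^sub>C k) = c * B h k"
    and bound: "\<And>h k. norm (B h k) \<le> C * norm h * norm k"
  obtains A :: "'h op" where "A \<in> bops" "\<And>h k. cinner h (A k) = B h k"
proof -
  have "\<exists>a. \<forall>h. B h k = cinner h a" for k
  proof -
    have "bounded_linear (\<lambda>h. Re (B h k))"
    proof (rule bounded_linear_intro[where K = "C * norm k"])
      fix r :: real and x :: 'h
      show "Re (B (r *\<^sub>R x) k) = r *\<^sub>R Re (B x k)" by (simp add: scaleR_scaleC scale1)
      show "norm (Re (B x k)) \<le> norm x * (C * norm k)"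
        using bound[of x k] abs_Re_le_cmod[of "B x k"] by (simp add: mult_ac)
    qed (simp add: add1)
    then obtain a where a: "\<And>h. Re (B h k) = inner a h"
      using riesz_closed_subspace[of _ UNIV] by (metis closed_UNIV subspace_UNIV UNIV_I)
    have re: "Re (B h k) = Re (cinner h a)" for h
      by (simp add: a Re_cinner inner_commute)
    have "Im (B h k) = Re (B (\<i> *\<^sub>C h) k)" "Im (cinner h a) = Re (cinner (\<i> *\<^sub>C h) a)" for h
      by (simp_all add: scale1 cinner_scaleC_left)
    then show ?thesis using re by (metis complex_eqI)
  qed
  then obtain A where A: "\<And>h k. B h k = cinner h (A k)" by metis
  have addA: "A (x + y) = A x + A y" for x y
    by (rule cinner_ext) (simp add: A[symmetric] add2 cinner_add_right)
  have scaleA: "A (c *\<^sub>C x) = c *\<^sub>C A x" for c x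
    by (rule cinner_ext) (simp add: A[symmetric] scale2 cinner_scaleC_right)
  have "bounded_linear A"
  proof (rule bounded_linear_intro[where K = C])
    fix r x
    show "A (r *\<^sub>R x) = r *\<^sub>R A x" by (simp add: scaleR_scaleC scaleA)
    have "(norm (A x))\<^sup>2 \<le> C * norm (A x) * norm x"
      using bound[of "A x" x] by (simp add: A cinner_self norm_power)
    then show "norm (A x) \<le> norm x * C"
    proof (cases "norm (A x) = 0")
      case False
      then show ?thesis
        using \<open>(norm (A x))\<^sup>2 \<le> _\<close>
        by (simp add: power2_eq_square mult_ac)
    next
      case True
      show ?thesis
      proof (cases "x = 0")
        case False
        have "0 \<le> C * norm x * norm x" using bound[of x x] norm_ge_zero order_trans by blast
        then have "0 \<le> C" using False by (simp add: zero_le_mult_iff)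
        then show ?thesis using True by simp
      qed (use True in simp)
    qed
  qed (rule addA)
  then have "blinfun_apply (Blinfun A) = A" by (rule bounded_linear_Blinfun_apply)
  then show thesis
    using that[of "Blinfun A"] scaleA A by (simp add: bops_def)
qed

lemma norm_cinner_op_le:
  fixes A :: "'h::complex_hilbert op"
  shows "norm (cinner h (A k)) \<le> norm A * norm h * norm k"
proof -
  have "norm (cinner h (A k)) \<le> norm h * norm (A k)" by (rule norm_cinner_le)
  also have "\<dots> \<le> norm h * (norm A * norm k)" by (intro mult_left_mono norm_blinfun) simp
  finally show ?thesis by (simp add: mult_ac)
qed

lemma adj_exists_unique:
  fixes A :: "'h::complex_hilbert op"
  assumes A: "A \<in> bops"
  shows "adj A \<in> bops" and "cinner (A x) y = cinner x (adj A y)"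
proof -
  have "norm (cinner (A h) k) \<le> norm A * norm h * norm k" for h k
    using norm_cinner_op_le[of k A h] by (subst cinner_commute) (simp add: mult_ac)
  then obtain B :: "'h op" where B: "B \<in> bops" "\<And>h k. cinner h (B k) = cinner (A h) k"
    using form_operator_exists[of "\<lambda>h k. cinner (A h) k" "norm A"] bopsD[OF A]
    by (auto simp: cinner_add_left cinner_add_right cinner_scaleC_left cinner_scaleC_right
        blinfun.add_right)
  have "adj A = B"
    unfolding adj_def
  proof (rule the_equality)
    show "\<forall>x y. cinner (A x) y = cinner x (B y)" using B by simp
  next
    fix C :: "'h op" assume "\<forall>x y. cinner (A x) y = cinner x (C y)"
    then have "cinner h (C k) = cinner h (B k)" for h k by (simp add: B(2))
    then show "C = B" by (rule op_ext_cinner)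
  qed
  then show "adj A \<in> bops" "cinner (A x) y = cinner x (adj A y)" using B by simp_all
qed

lemmas adj_bops = adj_exists_unique(1)
lemmas cinner_adj_right = adj_exists_unique(2)[symmetric]

lemma cinner_adj_left: "A \<in> bops \<Longrightarrow> cinner (adj A x) y = cinner x (A y)"
  by (metis cinner_commute cinner_adj_right)

lemma adj_eqI:
  fixes A B :: "'h::complex_hilbert op"
  assumes "A \<in> bops" "\<And>h k. cinner (A h) k = cinner h (B k)"
  shows "adj A = B"
  by (rule op_ext_cinner) (simp add: cinner_adj_right assms)

lemma adj_adj: "A \<in> bops \<Longrightarrow> adj (adj A) = A"
  by (rule adj_eqI) (simp_all add: adj_bops cinner_adj_left)

lemma bops_compose: "A \<in> bops \<Longrightarrow> B \<in> bops \<Longrightarrow> A o\<^sub>L B \<in> bops"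
  by (simp add: bops_def)

lemma bops_add: "A \<in> bops \<Longrightarrow> B \<in> bops \<Longrightarrow> A + B \<in> bops"
  by (simp add: bops_def blinfun.add_left scaleC_add_right)

lemma bops_diff: "A \<in> bops \<Longrightarrow> B \<in> bops \<Longrightarrow> A - B \<in> bops"
  by (simp add: bops_def blinfun.diff_left scaleC.diff_right)

lemma bops_scaleR: "A \<in> bops \<Longrightarrow> r *\<^sub>R A \<in> bops"
  by (simp add: bops_def blinfun.scaleR_left scaleR_scaleC scaleC_scaleC mult.commute)

lemma bops_id: "id_blinfun \<in> bops"
  by (simp add: bops_def)

lemma adj_compose: "A \<in> bops \<Longrightarrow> B \<in> bops \<Longrightarrow> adj (A o\<^sub>L B) = adj B o\<^sub>L adj A"
  by (rule adj_eqI) (simp_all add: bops_compose cinner_adj_right)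

lemma adj_add: "A \<in> bops \<Longrightarrow> B \<in> bops \<Longrightarrow> adj (A + B) = adj A + adj B"
  by (rule adj_eqI)
    (simp_all add: bops_add blinfun.add_left cinner_add_left cinner_add_right cinner_adj_right)

lemma adj_diff: "A \<in> bops \<Longrightarrow> B \<in> bops \<Longrightarrow> adj (A - B) = adj A - adj B"
  by (rule adj_eqI)
    (simp_all add: bops_diff blinfun.diff_left cinner.diff_left cinner.diff_right cinner_adj_right)

lemma unitaryD:
  fixes U :: "'h::complex_hilbert op"
  assumes "unitary U"
  shows "U \<in> bops" "adj U (U x) = x" "U (adj U x) = x" "cinner (U x) (U y) = cinner x y"
    "norm (U x) = norm x" "norm (adj U x) = norm x"
proof -
  show U: "U \<in> bops" using assms by (simp add: unitary_def)
  show 1: "adj U (U x) = x" "U (adj U x) = x" for x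
  proof -
    have "(adj U o\<^sub>L U) x = x" "(U o\<^sub>L adj U) x = x"
      using assms by (simp_all add: unitary_def)
    then show "adj U (U x) = x" "U (adj U x) = x" by simp_all
  qed
  show 2: "cinner (U x) (U y) = cinner x y" for x y
    by (simp add: cinner_adj_right[symmetric] adj_exists_unique(2)[OF U] 1)
  have *: "norm (U x) = norm x" for x
    using 2[of x x] unfolding cinner_self
    by (metis of_real_eq_iff norm_ge_zero power2_eq_iff_nonneg)
  then show "norm (U x) = norm x" .
  show "norm (adj U x) = norm x" by (metis * 1(2))
qed

lemma unitaryI:
  fixes U V :: "'h::complex_hilbert op"
  assumes "U \<in> bops" "V \<in> bops" "\<And>x. V (U x) = x" "\<And>x. U (V x) = x" "\<And>x y. cinner (U x) (U y) = cinner x y"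
  shows "unitary U" and "adj U = V"
proof -
  show *: "adj U = V"
  proof (rule adj_eqI[OF assms(1)])
    fix h k
    show "cinner (U h) k = cinner h (V k)"
      using assms(5)[of h "V k"] by (simp add: assms(4))
  qed
  show "unitary U"
    unfolding unitary_def * using assms by (auto intro!: blinfun_eqI)
qed

text \<open>The minimiser belonging to the functional \<open>inner x\<close> is the projection of \<^term>\<open>x\<close>. Applying the
  real orthogonality relation also to the multiples $\mathrm{i}k$ makes it complex.\<close>

lemma orthogonal_projection_exists:
  fixes K :: "'h::complex_hilbert set"
  assumes K: "closed K" "\<And>x y. x \<in> K \<Longrightarrow> y \<in> K \<Longrightarrow> x + y \<in> K" "\<And>c x. x \<in> K \<Longrightarrow> c *\<^sub>C x \<in> K" "K \<noteq> {}"
  obtains P :: "'h op" where "P \<in> bops" "\<And>x. P x \<in> K" "\<And>x. x \<in> K \<Longrightarrow> P x = x"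
    "\<And>x k. k \<in> K \<Longrightarrow> cinner k (x - P x) = 0"
proof -
  have 0: "0 \<in> K" using K(3)[of _ 0] K(4) by auto
  have sub: "subspace K"
    using K(2,3) 0 by (simp add: subspace_def scaleR_scaleC)
  have "\<exists>a\<in>K. \<forall>k\<in>K. cinner k (x - a) = 0" for x
  proof -
    obtain a where a: "a \<in> K" "\<And>k. k \<in> K \<Longrightarrow> inner x k = inner a k"
      using riesz_closed_subspace[OF bounded_linear_inner_right K(1) sub, of x] by metis
    have re: "Re (cinner k (x - a)) = 0" if "k \<in> K" for k
      using a(2)[OF that] by (simp add: Re_cinner inner_diff_right inner_commute)
    have "Im (cinner k (x - a)) = Re (cinner (\<i> *\<^sub>C k) (x - a))" for k
      by (simp add: cinner_scaleC_left)
    then have "cinner k (x - a) = 0" if "k \<in> K" for k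
      using re[OF that] re[OF K(3)[OF that]] by (simp add: complex_eq_iff)
    with a(1) show ?thesis by blast
  qed
  then obtain p where p: "\<And>x. p x \<in> K" "\<And>x k. k \<in> K \<Longrightarrow> cinner k (x - p x) = 0" by metis
  have uniq: "p x = a" if "a \<in> K" "\<And>k. k \<in> K \<Longrightarrow> cinner k (x - a) = 0" for x a
  proof -
    have d: "p x - a \<in> K" using subspace_diff[OF sub p(1) that(1)] .
    have "cinner (p x - a) ((x - a) - (x - p x)) =
        cinner (p x - a) (x - a) - cinner (p x - a) (x - p x)"
      by (rule cinner.diff_right)
    also have "\<dots> = 0" unfolding that(2)[OF d] p(2)[OF d] by simp
    finally have "cinner (p x - a) (p x - a) = 0" by simp
    then show ?thesis by (simp add: cinner_self)
  qed
  have add: "p (x + y) = p x + p y" for x y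
  proof (rule uniq)
    show "p x + p y \<in> K" using K(2) p(1) by blast
    fix k assume k: "k \<in> K"
    have "cinner k ((x - p x) + (y - p y)) = cinner k (x - p x) + cinner k (y - p y)"
      by (rule cinner_add_right)
    also have "\<dots> = 0" unfolding p(2)[OF k] by simp
    finally show "cinner k (x + y - (p x + p y)) = 0" by (simp add: algebra_simps)
  qed
  have scale: "p (c *\<^sub>C x) = c *\<^sub>C p x" for c x
  proof (rule uniq)
    show "c *\<^sub>C p x \<in> K" using K(3) p(1) by blast
    fix k assume "k \<in> K"
    then show "cinner k (c *\<^sub>C x - c *\<^sub>C p x) = 0"
      using p(2)[of k x] by (simp add: scaleC.diff_right[symmetric] cinner_scaleC_right)
  qed
  have "norm (p x) \<le> norm x" for x
  proof -
    have "cinner (p x) x = cinner (p x) (p x)"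
      using p(2)[OF p(1), of x x] by (simp add: cinner.diff_right)
    then have "(norm (p x))\<^sup>2 \<le> norm (p x) * norm x"
      using norm_cinner_le[of "p x" x] by (simp add: cinner_self norm_power)
    then show ?thesis by (cases "p x = 0") (simp_all add: power2_eq_square)
  qed
  then have "bounded_linear p"
    using add scale by (intro bounded_linear_intro[where K = 1]) (simp_all add: scaleR_scaleC)
  then have "blinfun_apply (Blinfun p) = p" by (rule bounded_linear_Blinfun_apply)
  moreover have "p x = x" if "x \<in> K" for x
    using that by (rule uniq) simp
  ultimately show thesis
    using that[of "Blinfun p"] p scale by (simp add: bops_def)
qed

subsection \<open>Commutants\<close>

lemma commutantI:
  fixes A :: "'h::complex_hilbert op" and X :: "'h op set"
  shows "A \<in> bops \<Longrightarrow> (\<And>(B::'h op) h. B \<in> X \<Longrightarrow> A (B h) = B (A h)) \<Longrightarrow> A \<in> commutant X"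
  by (auto simp: commutant_def intro!: blinfun_eqI)

lemma commutantD:
  fixes A B :: "'h::complex_hilbert op" and X :: "'h op set"
  shows "A \<in> commutant X \<Longrightarrow> B \<in> X \<Longrightarrow> A (B h) = B (A h)"
proof -
  assume "A \<in> commutant X" "B \<in> X"
  then have "(A o\<^sub>L B) h = (B o\<^sub>L A) h" by (simp add: commutant_def)
  then show ?thesis by simp
qed

lemma commutant_bops: "A \<in> commutant X \<Longrightarrow> A \<in> bops"
  by (simp add: commutant_def)

lemma commutant_antimono: "X \<subseteq> Y \<Longrightarrow> commutant Y \<subseteq> commutant X"
  by (auto simp: commutant_def)

lemma subset_double_commutant: "X \<subseteq> bops \<Longrightarrow> X \<subseteq> commutant (commutant X)"
  by (auto simp: commutant_def)

lemma commutant_triple: "X \<subseteq> bops \<Longrightarrow> commutant (commutant (commutant X)) = commutant X"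
  by (intro equalityI commutant_antimono subset_double_commutant) (auto simp: commutant_bops)

lemma commutant_adj:
  fixes A :: "'h::complex_hilbert op" and X :: "'h op set"
  assumes X: "\<And>B::'h op. B \<in> X \<Longrightarrow> B \<in> bops \<and> adj B \<in> X" and A: "A \<in> commutant X"
  shows "adj A \<in> commutant X"
proof (rule commutantI)
  have Ab: "A \<in> bops" using A by (rule commutant_bops)
  then show "adj A \<in> bops" by (rule adj_bops)
  fix B h assume B: "B \<in> X"
  then have "A o\<^sub>L adj B = adj B o\<^sub>L A"
    using A X[OF B] by (simp add: commutant_def)
  then have "adj (A o\<^sub>L adj B) = adj (adj B o\<^sub>L A)" by simp
  then have "B o\<^sub>L adj A = adj A o\<^sub>L B"
    using X[OF B] Ab by (simp add: adj_compose adj_bops adj_adj)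
  then have "(B o\<^sub>L adj A) h = (adj A o\<^sub>L B) h" by simp
  then show "adj A (B h) = B (adj A h)" by simp
qed

lemma commutant_algebra:
  assumes "A \<in> commutant X" "B \<in> commutant X"
  shows "A o\<^sub>L B \<in> commutant X" "A + B \<in> commutant X" "A - B \<in> commutant X"
proof -
  have "A \<in> bops" "B \<in> bops" using assms by (simp_all add: commutant_bops)
  then show "A o\<^sub>L B \<in> commutant X" "A + B \<in> commutant X" "A - B \<in> commutant X"
    using assms[THEN commutantD]
    by (auto intro!: commutantI bops_compose bops_add bops_diff
        simp: blinfun.add_left blinfun.diff_left blinfun.add_right blinfun.diff_right)
qed

lemma commutant_scaleR: "A \<in> commutant X \<Longrightarrow> r *\<^sub>R A \<in> commutant X"
  using commutantD[of A X]
  by (auto intro!: commutantI bops_scaleR simp: commutant_bops blinfun.scaleR_left blinfun.scaleR_right)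

lemma scalar_operator_exists:
  obtains A :: "'h::complex_hilbert op" where "A \<in> bops" "\<And>k. A k = c *\<^sub>C k"
proof -
  have "bounded_linear (\<lambda>k::'h. c *\<^sub>C k)" by (rule scaleC.bounded_linear_right)
  from bounded_linear_Blinfun_apply[OF this] show thesis
    using that[of "Blinfun (\<lambda>k. c *\<^sub>C k)"] by (simp add: bops_def scaleC_scaleC mult.commute)
qed

section \<open>Integration over Euclidean space\<close>

lemma integral_translate:
  fixes f :: "'a::euclidean_space \<Rightarrow> complex"
  assumes [measurable]: "f \<in> borel_measurable borel"
  shows "(LINT x|lborel. f (a + x)) = (LINT x|lborel. f x)"
proof -
  have "(LINT x|lborel. f x) = (LINT x|distr lborel borel ((+) a). f x)"
    by (simp add: lborel_distr_plus)
  also have "\<dots> = (LINT x|lborel. f (a + x))"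
    by (subst integral_distr) auto
  finally show ?thesis ..
qed

lemma integrable_translate:
  fixes f :: "'a::euclidean_space \<Rightarrow> 'b::{banach,second_countable_topology}"
  assumes "integrable lborel f"
  shows "integrable lborel (\<lambda>x. f (a + x))"
proof -
  have [measurable]: "f \<in> borel_measurable borel"
    using borel_measurable_integrable[OF assms] by simp
  have "integrable (distr lborel borel ((+) a)) f"
    using assms by (simp add: lborel_distr_plus)
  then show ?thesis
    by (subst (asm) integrable_distr_eq) auto
qed

lemma integral_dilate:
  fixes f :: "'a::euclidean_space \<Rightarrow> complex"
  assumes [measurable]: "f \<in> borel_measurable borel" and c: "c > 0"
  shows "(LINT x|lborel. of_real (c ^ DIM('a)) * f (c *\<^sub>R x)) = (LINT x|lborel. f x)"
proof -
  have "(LINT x|lborel. f x) =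
      (LINT x|density (distr lborel borel (\<lambda>x::'a. 0 + c *\<^sub>R x)) (\<lambda>_. ennreal (\<bar>c\<bar> ^ DIM('a))). f x)"
    using c by (subst lborel_affine[where c = c and t = 0]) simp_all
  also have "\<dots> = (LINT x|lborel. (c ^ DIM('a)) *\<^sub>R f (c *\<^sub>R x))"
    using c by (subst integral_density) (simp_all add: integral_distr)
  finally show ?thesis by (simp add: scaleR_conv_of_real)
qed

lemma integrable_dilate:
  fixes f :: "'a::euclidean_space \<Rightarrow> 'b::{banach,second_countable_topology}"
  assumes f: "integrable lborel f" and c: "c > 0"
  shows "integrable lborel (\<lambda>x. f (c *\<^sub>R x))"
proof -
  have [measurable]: "f \<in> borel_measurable borel"
    using borel_measurable_integrable[OF f] by simp
  have "integrable (density (distr lborel borel (\<lambda>x::'a. 0 + c *\<^sub>R x)) (\<lambda>_. ennreal (\<bar>c\<bar> ^ DIM('a)))) f"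
    using f c by (subst lborel_affine[where c = c and t = 0, symmetric]) simp_all
  then have "integrable lborel (\<lambda>x. (c ^ DIM('a)) *\<^sub>R f (c *\<^sub>R x))"
    using c by (subst (asm) integrable_density) (simp_all add: integrable_distr_eq)
  then have "integrable lborel (\<lambda>x. inverse (c ^ DIM('a)) *\<^sub>R ((c ^ DIM('a)) *\<^sub>R f (c *\<^sub>R x)))"
    by (rule integrable_scaleR_right)
  then show ?thesis using c by simp
qed

lemma lborel_prod_Basis:
  fixes f :: "'a::euclidean_space \<Rightarrow> real \<Rightarrow> 'b::{real_normed_field,banach,second_countable_topology}"
  assumes "\<And>b. b \<in> Basis \<Longrightarrow> integrable lborel (f b)"
  shows "integrable lborel (\<lambda>x::'a. \<Prod>b\<in>Basis. f b (x \<bullet> b))"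
    and "(LINT x|lborel. (\<Prod>b\<in>Basis. f b (x \<bullet> b))) = (\<Prod>b\<in>Basis. (LINT t|lborel. f b t))"
proof -
  interpret product_sigma_finite "\<lambda>_::'a. lborel :: real measure" by standard
  have [measurable]: "f b \<in> borel_measurable borel" if "b \<in> Basis" for b
    using borel_measurable_integrable[OF assms[OF that]] by simp
  have m: "(\<lambda>g. \<Sum>b\<in>Basis. g b *\<^sub>R b) \<in> Pi\<^sub>M Basis (\<lambda>_::'a. lborel) \<rightarrow>\<^sub>M (borel :: 'a measure)"
    by measurable
  have p: "(\<lambda>x::'a. \<Prod>b\<in>Basis. f b (x \<bullet> b)) \<in> borel_measurable borel"
    by measurable
  have eq: "(\<Prod>b\<in>Basis. f b ((\<Sum>b\<in>Basis. g b *\<^sub>R b) \<bullet> b)) = (\<Prod>b\<in>Basis. f b (g b))" for g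
    by (intro prod.cong) simp_all
  show "integrable lborel (\<lambda>x::'a. \<Prod>b\<in>Basis. f b (x \<bullet> b))"
    by (subst lborel_eq, subst integrable_distr_eq[OF m p], subst eq)
      (intro product_integrable_prod assms; simp)
  show "(LINT x|lborel. (\<Prod>b\<in>Basis. f b (x \<bullet> b))) = (\<Prod>b\<in>Basis. (LINT t|lborel. f b t))"
    by (subst lborel_eq, subst integral_distr[OF m p], subst eq)
      (intro product_integral_prod assms; simp)
qed

text \<open>Decay is measured against this weight. It is bounded below by 1, it is submultiplicative in the
  sense of Peetre's inequality, and the Fourier transform turns it into a differential operator.\<close>

definition weight :: "'a::real_normed_vector \<Rightarrow> real" where
  "weight x = 1 + (norm x)\<^sup>2"

lemma weight_pos: "0 < weight x"
  by (simp add: weight_def add_pos_nonneg)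

lemma norm_le_weight: "norm x \<le> weight x"
proof -
  have "0 \<le> (norm x - 1)\<^sup>2" by simp
  then have "2 * norm x \<le> 1 + (norm x)\<^sup>2" by (simp add: power2_diff)
  then show ?thesis unfolding weight_def using norm_ge_zero[of x] by linarith
qed

lemma weight_peetre: "weight x \<le> 2 * weight (x + y) * weight y"
proof -
  have "norm x \<le> norm (x + y) + norm y"
    using norm_triangle_ineq4[of "x + y" y] by simp
  then have "(norm x)\<^sup>2 \<le> (norm (x + y) + norm y)\<^sup>2"
    by (simp add: power_mono)
  also have "\<dots> \<le> 2 * (norm (x + y))\<^sup>2 + 2 * (norm y)\<^sup>2"
    using sum_squares_ge_zero[of "norm (x + y) - norm y" 0]
    by (simp add: power2_eq_square algebra_simps)
  finally show ?thesis
    unfolding weight_def using mult_nonneg_nonneg[of "(norm y)\<^sup>2" "(norm (x + y))\<^sup>2"]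
    by (simp add: algebra_simps del: zero_le_mult_iff mult_nonneg_nonneg)
qed

lemma weight_peetre_power: "weight x ^ N \<le> 2 ^ N * weight (x + y) ^ N * weight y ^ N"
  using power_mono[OF weight_peetre[of x y] less_imp_le[OF weight_pos], of N]
  by (simp add: power_mult_distrib)

lemma continuous_weight [continuous_intros]: "continuous_on S (weight :: 'a::real_normed_vector \<Rightarrow> real)"
  unfolding weight_def by (intro continuous_intros)

text \<open>The weight to the power of the dimension dominates $\prod_b (1 + x_b^2)$, which reduces the
  claim to dimension one.\<close>

lemma integrable_inverse_weight:
  "integrable lborel (\<lambda>x::'a::euclidean_space. inverse (weight x ^ DIM('a)))"
proof (rule Bochner_Integration.integrable_bound)
  have "integrable lborel (\<lambda>t::real. inverse (1 + t\<^sup>2))"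
    using integrable_inverse_1_plus_square by (simp add: set_integrable_def)
  then show "integrable lborel (\<lambda>x::'a. \<Prod>b\<in>Basis. inverse (1 + (x \<bullet> b)\<^sup>2))"
    by (intro lborel_prod_Basis)
  show "AE x::'a in lborel. norm (inverse (weight x ^ DIM('a))) \<le> norm (\<Prod>b\<in>Basis. inverse (1 + (x \<bullet> b)\<^sup>2))"
  proof (rule AE_I2)
    fix x :: 'a
    have "(\<Prod>b::'a\<in>Basis. 1 + (x \<bullet> b)\<^sup>2) \<le> (\<Prod>b::'a\<in>Basis. weight x)"
    proof (intro prod_mono conjI)
      fix b :: 'a assume "b \<in> Basis"
      then have "(x \<bullet> b)\<^sup>2 \<le> (norm x)\<^sup>2"
        using Basis_le_norm[of b x] by (simp add: abs_le_square_iff[symmetric])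
      then show "1 + (x \<bullet> b)\<^sup>2 \<le> weight x" by (simp add: weight_def)
    qed simp
    also have "\<dots> = weight x ^ DIM('a)" by simp
    finally have "inverse (weight x ^ DIM('a)) \<le> inverse (\<Prod>b::'a\<in>Basis. 1 + (x \<bullet> b)\<^sup>2)"
      by (intro le_imp_inverse_le prod_pos) (auto simp: add_pos_nonneg)
    moreover have "(\<Prod>b::'a\<in>Basis. inverse (1 + (x \<bullet> b)\<^sup>2)) = inverse (\<Prod>b::'a\<in>Basis. 1 + (x \<bullet> b)\<^sup>2)"
      using prod_inversef[of "\<lambda>b. 1 + (x \<bullet> b)\<^sup>2" Basis] by (simp add: o_def)
    moreover have "0 \<le> inverse (weight x ^ DIM('a))"
      using weight_pos[of x] by simp
    ultimately show "norm (inverse (weight x ^ DIM('a))) \<le> norm (\<Prod>b\<in>Basis. inverse (1 + (x \<bullet> b)\<^sup>2))"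
      by (metis abs_ge_self abs_of_nonneg order_trans real_norm_def)
  qed
  have "weight x \<noteq> 0" for x :: 'a using weight_pos[of x] by simp
  then show "(\<lambda>x::'a. inverse (weight x ^ DIM('a))) \<in> borel_measurable lborel"
    using borel_measurable_continuous_onI[of "\<lambda>x::'a. inverse (weight x ^ DIM('a))"]
    by (simp add: continuous_intros)
qed

subsection \<open>Differentiation under the integral sign\<close>

text \<open>The difference quotients converge pointwise and are dominated by the Lipschitz constants. Only
  increments of norm at most 1 are constrained, so that \<^term>\<open>W\<close> may involve a supremum over a unit
  ball.\<close>

lemma has_derivative_integral:
  fixes G :: "'b::euclidean_space \<Rightarrow> 'a::real_normed_vector \<Rightarrow> complex"
  assumes meas: "\<And>y. (\<lambda>\<eta>. G \<eta> y) \<in> borel_measurable M"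
    and int: "integrable M (\<lambda>\<eta>. G \<eta> x)"
    and der: "\<And>\<eta>. (G \<eta> has_derivative G' \<eta>) (at x)"
    and lip: "\<And>\<eta> h. norm h \<le> 1 \<Longrightarrow> norm (G \<eta> (x + h) - G \<eta> x) \<le> W \<eta> * norm h"
    and W: "integrable M W"
  shows "((\<lambda>y. LINT \<eta>|M. G \<eta> y) has_derivative (\<lambda>v. LINT \<eta>|M. G' \<eta> v)) (at x)"
    and "integrable M (\<lambda>\<eta>. G' \<eta> v)"
proof -
  note [measurable] = meas
  have lin: "bounded_linear (G' \<eta>)" for \<eta> using der by (rule has_derivative_bounded_linear)
  note G'simps = linear_simps(1,2,5)[OF lin]
  have quot: "(\<lambda>n. (G \<eta> (x + X n) - G \<eta> x - G' \<eta> (X n)) /\<^sub>R norm (X n)) \<longlonglongrightarrow> 0"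
    if "\<And>n. X n \<noteq> 0" "X \<longlonglongrightarrow> 0" for X \<eta>
  proof -
    have "((\<lambda>h. norm (G \<eta> (x + h) - G \<eta> x - G' \<eta> h) / norm h) \<longlongrightarrow> 0) (at 0)"
      using der[of \<eta>] by (simp add: has_derivative_at)
    then have "((\<lambda>h. norm (G \<eta> (x + h) - G \<eta> x - G' \<eta> h) / norm h) \<circ> X) \<longlonglongrightarrow> 0"
      using that unfolding tendsto_at_iff_sequentially by auto
    then show ?thesis
      by - (rule tendsto_norm_zero_cancel, simp add: o_def divide_inverse mult.commute)
  qed
  have scaled: "(\<lambda>n. (G \<eta> (x + v /\<^sub>R real (Suc n)) - G \<eta> x) * of_nat (Suc n)) \<longlonglongrightarrow> G' \<eta> v"
    if "v \<noteq> 0" for v \<eta>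
  proof -
    have "(\<lambda>n. norm v *\<^sub>R ((G \<eta> (x + v /\<^sub>R real (Suc n)) - G \<eta> x - G' \<eta> (v /\<^sub>R real (Suc n))) /\<^sub>R
        norm (v /\<^sub>R real (Suc n)))) \<longlonglongrightarrow> norm v *\<^sub>R 0"
      using that tendsto_scaleR[OF LIMSEQ_inverse_real_of_nat tendsto_const[of v]]
      by (intro tendsto_scaleR tendsto_const quot) simp_all
    also have "(\<lambda>n. norm v *\<^sub>R ((G \<eta> (x + v /\<^sub>R real (Suc n)) - G \<eta> x - G' \<eta> (v /\<^sub>R real (Suc n))) /\<^sub>R
        norm (v /\<^sub>R real (Suc n)))) = (\<lambda>n. (G \<eta> (x + v /\<^sub>R real (Suc n)) - G \<eta> x) * of_nat (Suc n) - G' \<eta> v)"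
      using that
      by (intro ext) (simp add: G'simps scaleR_conv_of_real field_simps del: of_nat_Suc)
    finally show ?thesis
      by (simp add: LIM_zero_iff del: of_nat_Suc)
  qed
  have G'0: "G' \<eta> 0 = 0" for \<eta> using lin by (rule linear_simps(3))
  have measG' [measurable]: "(\<lambda>\<eta>. G' \<eta> v) \<in> borel_measurable M" for v
  proof (cases "v = 0")
    case False
    from scaled[OF this] show ?thesis
      by (rule borel_measurable_LIMSEQ_metric[rotated]) measurable
  qed (simp add: G'0)
  have bnd: "norm (G' \<eta> v) \<le> W \<eta> * norm v" for \<eta> v
  proof (cases "v = 0")
    case False
    have "\<forall>\<^sub>F n in sequentially. norm v / real (Suc n) \<le> 1"
    proof -
      obtain N where "norm v \<le> real N" using real_arch_simple by blast
      then show ?thesis by (intro eventually_sequentiallyI[of N]) (simp add: field_simps)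
    qed
    then have "\<forall>\<^sub>F n in sequentially. norm ((G \<eta> (x + v /\<^sub>R real (Suc n)) - G \<eta> x) * of_nat (Suc n)) \<le> W \<eta> * norm v"
    proof eventually_elim
      case (elim n)
      have "norm (G \<eta> (x + v /\<^sub>R real (Suc n)) - G \<eta> x) \<le> W \<eta> * norm (v /\<^sub>R real (Suc n))"
        using elim by (intro lip) (simp add: divide_inverse mult.commute)
      then have "norm (G \<eta> (x + v /\<^sub>R real (Suc n)) - G \<eta> x) * real (Suc n) \<le>
          W \<eta> * norm (v /\<^sub>R real (Suc n)) * real (Suc n)"
        by (rule mult_right_mono) simp
      also have "\<dots> = W \<eta> * norm v"
        by (simp add: field_simps del: of_nat_Suc)
      finally have "norm (G \<eta> (x + v /\<^sub>R real (Suc n)) - G \<eta> x) * real (Suc n) \<le> W \<eta> * norm v" .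
      then show ?case by (simp add: norm_mult del: of_nat_Suc)
    qed
    then show ?thesis
      by (rule tendsto_upperbound[OF tendsto_norm[OF scaled[OF False]]]) simp
  qed (simp add: G'0)
  show intG': "integrable M (\<lambda>\<eta>. G' \<eta> v)" for v
  proof (rule Bochner_Integration.integrable_bound)
    show "integrable M (\<lambda>\<eta>. W \<eta> * norm v)" using W by simp
    show "AE \<eta> in M. norm (G' \<eta> v) \<le> norm (W \<eta> * norm v)"
      using bnd[of _ v] order_trans[OF _ abs_ge_self] by (intro AE_I2) auto
  qed measurable
  have intG: "integrable M (\<lambda>\<eta>. G \<eta> (x + h))" if "norm h \<le> 1" for h
  proof -
    have "integrable M (\<lambda>\<eta>. G \<eta> (x + h) - G \<eta> x)"
    proof (rule Bochner_Integration.integrable_bound)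
      show "integrable M (\<lambda>\<eta>. W \<eta> * norm h)" using W by simp
      show "AE \<eta> in M. norm (G \<eta> (x + h) - G \<eta> x) \<le> norm (W \<eta> * norm h)"
        using lip[OF that] order_trans[OF _ abs_ge_self] by (intro AE_I2) auto
    qed measurable
    from Bochner_Integration.integrable_add[OF this int] show ?thesis by simp
  qed
  let ?D = "\<lambda>v. LINT \<eta>|M. G' \<eta> v"
  let ?F = "\<lambda>y. LINT \<eta>|M. G \<eta> y"
  have "bounded_linear ?D"
  proof (rule bounded_linear_intro[where K = "LINT \<eta>|M. W \<eta>"])
    fix u v :: 'a and r :: real
    show "?D (u + v) = ?D u + ?D v"
      using intG' by (simp add: G'simps)
    show "?D (r *\<^sub>R u) = r *\<^sub>R ?D u"
      by (simp add: G'simps)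
    have "norm (?D v) \<le> (LINT \<eta>|M. W \<eta> * norm v)"
      using W intG' bnd by (intro Bochner_Integration.integral_norm_bound_integral) auto
    then show "norm (?D v) \<le> norm v * (LINT \<eta>|M. W \<eta>)" by (simp add: mult.commute)
  qed
  moreover have "((\<lambda>h. norm (?F (x + h) - ?F x - ?D h) / norm h) \<longlongrightarrow> 0) (at 0)"
    unfolding tendsto_at_iff_sequentially
  proof (intro allI impI)
    fix X :: "nat \<Rightarrow> 'a" assume "\<forall>i. X i \<in> UNIV - {0}" and X: "X \<longlonglongrightarrow> 0"
    then have ne: "X n \<noteq> 0" for n by simp
    \<comment> \<open>Dropping finitely many terms puts all increments into the unit ball.\<close>
    have "\<forall>\<^sub>F n in sequentially. norm (X n) < 1"
      using X by (simp add: tendsto_iff dist_norm)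
    then obtain N where N: "\<And>n. n \<ge> N \<Longrightarrow> norm (X n) \<le> 1"
      unfolding eventually_sequentially by (meson less_imp_le)
    define Y where "Y n = X (n + N)" for n
    have Y: "Y n \<noteq> 0" "norm (Y n) \<le> 1" for n using ne N by (simp_all add: Y_def)
    have Ylim: "Y \<longlonglongrightarrow> 0" unfolding Y_def using X by (rule LIMSEQ_ignore_initial_segment)
    have "(\<lambda>n. LINT \<eta>|M. (G \<eta> (x + Y n) - G \<eta> x - G' \<eta> (Y n)) /\<^sub>R norm (Y n)) \<longlonglongrightarrow> (LINT \<eta>|M. 0)"
    proof (rule integral_dominated_convergence[where w = "\<lambda>\<eta>. 2 * W \<eta>"])
      show "AE \<eta> in M. (\<lambda>n. (G \<eta> (x + Y n) - G \<eta> x - G' \<eta> (Y n)) /\<^sub>R norm (Y n)) \<longlonglongrightarrow> 0"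
        using Y Ylim by (intro AE_I2 quot)
      fix n
      show "AE \<eta> in M. norm ((G \<eta> (x + Y n) - G \<eta> x - G' \<eta> (Y n)) /\<^sub>R norm (Y n)) \<le> 2 * W \<eta>"
      proof (rule AE_I2)
        fix \<eta>
        have "norm (G \<eta> (x + Y n) - G \<eta> x - G' \<eta> (Y n)) \<le> W \<eta> * norm (Y n) + W \<eta> * norm (Y n)"
          by (rule order_trans[OF norm_triangle_ineq4 add_mono[OF lip[OF Y(2)] bnd]])
        then show "norm ((G \<eta> (x + Y n) - G \<eta> x - G' \<eta> (Y n)) /\<^sub>R norm (Y n)) \<le> 2 * W \<eta>"
          using Y(1)[of n] by (simp only: norm_scaleR) (simp add: field_simps)
      qed
    qed (use W in simp_all)
    then have "(\<lambda>n. norm (LINT \<eta>|M. (G \<eta> (x + Y n) - G \<eta> x - G' \<eta> (Y n)) /\<^sub>R norm (Y n))) \<longlonglongrightarrow> 0"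
      by - (rule tendsto_norm_zero, simp only: Bochner_Integration.integral_zero)
    moreover have "norm (LINT \<eta>|M. (G \<eta> (x + Y n) - G \<eta> x - G' \<eta> (Y n)) /\<^sub>R norm (Y n)) =
        norm (?F (x + Y n) - ?F x - ?D (Y n)) / norm (Y n)" for n
      using intG[OF Y(2)] int intG' by (simp add: divide_inverse mult.commute)
    ultimately have "(\<lambda>n. norm (?F (x + Y n) - ?F x - ?D (Y n)) / norm (Y n)) \<longlonglongrightarrow> 0"
      by simp
    then show "((\<lambda>h. norm (?F (x + h) - ?F x - ?D h) / norm h) \<circ> X) \<longlonglongrightarrow> 0"
      unfolding Y_def o_def
      by (rule LIMSEQ_offset[where f = "\<lambda>n. norm (?F (x + X n) - ?F x - ?D (X n)) / norm (X n)"])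
  qed
  ultimately show "(?F has_derivative ?D) (at x)"
    by (simp add: has_derivative_at)
qed

section \<open>Schwartz functions\<close>

definition partial :: "'n \<Rightarrow> (real^'n::finite \<Rightarrow> complex) \<Rightarrow> real^'n \<Rightarrow> complex" where
  "partial i f = (\<lambda>x. frechet_derivative f (at x) (axis i 1))"

definition rapid :: "('a::real_normed_vector \<Rightarrow> complex) \<Rightarrow> bool" where
  "rapid f \<longleftrightarrow> (\<forall>N. \<exists>C. \<forall>x. weight x ^ N * norm (f x) \<le> C)"

lemma rapid_iff: "rapid f \<longleftrightarrow> (\<forall>k. \<exists>C. \<forall>x. norm x ^ k * norm (f x) \<le> C)"
proof
  assume f: "rapid f"
  show "\<forall>k. \<exists>C. \<forall>x. norm x ^ k * norm (f x) \<le> C"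
  proof
    fix k
    obtain C where C: "\<And>x. weight x ^ k * norm (f x) \<le> C" using f rapid_def by metis
    have "norm x ^ k * norm (f x) \<le> weight x ^ k * norm (f x)" for x
      by (intro mult_right_mono power_mono norm_le_weight) auto
    then show "\<exists>C. \<forall>x. norm x ^ k * norm (f x) \<le> C" using C order_trans by blast
  qed
next
  assume f: "\<forall>k. \<exists>C. \<forall>x. norm x ^ k * norm (f x) \<le> C"
  show "rapid f"
    unfolding rapid_def
  proof
    fix N
    obtain C where C: "\<And>x. norm x ^ 0 * norm (f x) \<le> C" using f by blast
    obtain D where D: "\<And>x. norm x ^ (2 * N) * norm (f x) \<le> D" using f by blast
    have "weight x ^ N * norm (f x) \<le> 2 ^ N * (C + D)" for x
    proof -
      have "weight x ^ N \<le> (2 * max 1 ((norm x)\<^sup>2)) ^ N"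
        by (intro power_mono) (auto simp: weight_def)
      also have "\<dots> = 2 ^ N * (max 1 ((norm x)\<^sup>2)) ^ N" by (rule power_mult_distrib)
      also have "(max 1 ((norm x)\<^sup>2)) ^ N \<le> 1 + norm x ^ (2 * N)"
        by (cases "1 \<le> (norm x)\<^sup>2") (simp_all add: max_def power_mult)
      finally have "weight x ^ N * norm (f x) \<le> (2 ^ N * (1 + norm x ^ (2 * N))) * norm (f x)"
        by (intro mult_right_mono) auto
      also have "\<dots> = 2 ^ N * (norm x ^ 0 * norm (f x) + norm x ^ (2 * N) * norm (f x))"
        by (simp add: algebra_simps)
      also have "\<dots> \<le> 2 ^ N * (C + D)" by (intro mult_left_mono add_mono C D) simp
      finally show ?thesis .
    qed
    then show "\<exists>C. \<forall>x. weight x ^ N * norm (f x) \<le> C" by blast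
  qed
qed

lemma rapidE:
  fixes f :: "'a::real_normed_vector \<Rightarrow> complex"
  assumes "rapid f"
  obtains C where "C \<ge> 0" "\<And>x. norm (f x) \<le> C * inverse (weight x ^ N)"
proof -
  obtain C where C: "\<And>x. weight x ^ N * norm (f x) \<le> C" using assms rapid_def by metis
  have "0 \<le> weight (0::'a) ^ N * norm (f 0)" using weight_pos[of "0::'a"] by simp
  then have "0 \<le> C" using C order_trans by blast
  moreover have "norm (f x) \<le> C * inverse (weight x ^ N)" for x
    using C[of x] weight_pos[of x] by (simp add: field_simps)
  ultimately show thesis using that by blast
qed

lemma rapid_bounded:
  assumes "rapid f"
  obtains C where "C \<ge> 0" "\<And>x. norm (f x) \<le> C"
  by (rule rapidE[OF assms, of 0]) (use that in auto)

lemma rapid_mono: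
  assumes "rapid f" "\<And>x. norm (g x) \<le> c * norm (f x)"
  shows "rapid g"
  unfolding rapid_def
proof
  fix N
  obtain C where C: "\<And>x. weight x ^ N * norm (f x) \<le> C" using assms(1) rapid_def by metis
  have "weight x ^ N * norm (g x) \<le> \<bar>c\<bar> * C" for x
  proof -
    have "norm (g x) \<le> \<bar>c\<bar> * norm (f x)"
      using assms(2)[of x] by (rule order_trans) (intro mult_right_mono, auto)
    then have "weight x ^ N * norm (g x) \<le> weight x ^ N * (\<bar>c\<bar> * norm (f x))"
      using weight_pos[of x] by (intro mult_left_mono) auto
    also have "\<dots> = \<bar>c\<bar> * (weight x ^ N * norm (f x))" by simp
    also have "\<dots> \<le> \<bar>c\<bar> * C" using C by (intro mult_left_mono) auto
    finally show ?thesis .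
  qed
  then show "\<exists>C. \<forall>x. weight x ^ N * norm (g x) \<le> C" by blast
qed

lemma rapid_add:
  assumes "rapid f" "rapid g"
  shows "rapid (\<lambda>x. f x + g x)"
  unfolding rapid_def
proof
  fix N
  obtain C where C: "\<And>x. weight x ^ N * norm (f x) \<le> C" using assms(1) rapid_def by metis
  obtain D where D: "\<And>x. weight x ^ N * norm (g x) \<le> D" using assms(2) rapid_def by metis
  have "weight x ^ N * norm (f x + g x) \<le> C + D" for x
  proof -
    have "weight x ^ N * norm (f x + g x) \<le> weight x ^ N * (norm (f x) + norm (g x))"
      using weight_pos[of x] by (intro mult_left_mono norm_triangle_ineq) auto
    also have "\<dots> \<le> C + D" using C[of x] D[of x] by (simp add: distrib_left)
    finally show ?thesis .
  qed
  then show "\<exists>C. \<forall>x. weight x ^ N * norm (f x + g x) \<le> C" by blast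
qed

lemma integrable_rapid:
  fixes f :: "'a::euclidean_space \<Rightarrow> complex"
  assumes "rapid f" and [measurable]: "f \<in> borel_measurable borel"
  shows "integrable lborel (\<lambda>x. weight x ^ N * norm (f x))" and "integrable lborel f"
proof -
  have [measurable]: "(\<lambda>x::'a. weight x) \<in> borel_measurable borel"
    by (intro borel_measurable_continuous_onI continuous_weight)
  have *: "integrable lborel (\<lambda>x. weight x ^ N * norm (f x))" for N
  proof -
    obtain C where "C \<ge> 0" and C: "\<And>x. norm (f x) \<le> C * inverse (weight x ^ (N + DIM('a)))"
      using rapidE[OF assms(1), of "N + DIM('a)"] by metis
    show ?thesis
    proof (rule Bochner_Integration.integrable_bound)
      show "integrable lborel (\<lambda>x::'a. C * inverse (weight x ^ DIM('a)))"
        using integrable_inverse_weight[where 'a = 'a] by simp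
      show "AE x in lborel. norm (weight x ^ N * norm (f x)) \<le> norm (C * inverse (weight x ^ DIM('a)))"
      proof (rule AE_I2)
        fix x
        have "weight x ^ N * norm (f x) \<le> weight x ^ N * (C * inverse (weight x ^ (N + DIM('a))))"
          using C weight_pos[of x] by (intro mult_left_mono) auto
        also have "\<dots> = C * inverse (weight x ^ DIM('a))"
          using weight_pos[of x] by (simp add: power_add field_simps)
        finally show "norm (weight x ^ N * norm (f x)) \<le> norm (C * inverse (weight x ^ DIM('a)))"
          using weight_pos[of x] \<open>C \<ge> 0\<close> by (simp add: abs_mult)
      qed
    qed measurable
  qed
  show "integrable lborel (\<lambda>x. weight x ^ N * norm (f x))" by (rule *)
  show "integrable lborel f"
    using *[of 0] by (intro integrable_norm_cancel[of lborel f]) simp_all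
qed

text \<open>To see that a function is Schwartz it is enough to place it in a class of rapidly decreasing
  differentiable functions that is stable under partial derivatives. The closure properties
  below rest on suitable classes of this kind.\<close>

lemma schwartz_coinduct:
  assumes "f \<in> C"
    and "\<And>f x. f \<in> C \<Longrightarrow> f differentiable (at x)"
    and "\<And>f. f \<in> C \<Longrightarrow> rapid f"
    and "\<And>f i. f \<in> C \<Longrightarrow> partial i f \<in> C"
  shows "schwartz f"
proof -
  have "iter_partial is f \<in> C" for "is"
    by (induction "is") (use assms(1,4) in \<open>auto simp: partial_def\<close>)
  then show ?thesis
    using assms(2,3) by (simp add: schwartz_def smooth_def rapid_iff)
qed

lemma partial_eqI:
  assumes "\<And>x. (f has_derivative f' x) (at x)"
  shows "partial i f = (\<lambda>x. f' x (axis i 1))"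
  unfolding partial_def using frechet_derivative_at[OF assms] by metis

lemma schwartz_differentiable: "schwartz f \<Longrightarrow> f differentiable (at x)"
  unfolding schwartz_def smooth_def by (metis iter_partial.simps(1))

lemma schwartz_rapid: "schwartz f \<Longrightarrow> rapid f"
  unfolding schwartz_def rapid_iff by (metis iter_partial.simps(1))

lemma schwartz_partial:
  assumes "schwartz f"
  shows "schwartz (partial i f)"
proof -
  have "iter_partial is (partial i f) = iter_partial (is @ [i]) f" for "is"
    by (induction "is") (simp_all add: partial_def)
  then show ?thesis using assms by (simp add: schwartz_def smooth_def)
qed

lemma axis_expansion: "(\<Sum>i\<in>UNIV. v $ i *\<^sub>R axis i 1) = (v :: real^'n::finite)"
  using basis_expansion[of v] by (simp add: scalar_mult_eq_scaleR)

lemma sum_axis: "(\<Sum>j\<in>UNIV. of_real (axis i 1 $ j) * f j) = (f i :: complex)"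
proof -
  have "(\<Sum>j\<in>UNIV. of_real (axis i 1 $ j) * f j) = (\<Sum>j\<in>UNIV. if j = i then f i else 0)"
    by (intro sum.cong) (auto simp: axis_def)
  then show ?thesis by simp
qed

lemma partial_add:
  assumes "\<And>x. f differentiable (at x)" "\<And>x. g differentiable (at x)"
  shows "partial i (\<lambda>x. f x + g x) = (\<lambda>x. partial i f x + partial i g x)"
proof -
  have "((\<lambda>x. f x + g x) has_derivative (\<lambda>v. frechet_derivative f (at x) v + frechet_derivative g (at x) v)) (at x)" for x
    using assms by (intro derivative_intros) (simp_all add: frechet_derivative_works[symmetric])
  then show ?thesis by (subst partial_eqI) (simp_all add: partial_def)
qed

lemma has_derivative_partial:
  fixes f :: "real^'n::finite \<Rightarrow> complex"
  assumes "f differentiable (at x)"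
  shows "(f has_derivative (\<lambda>v. \<Sum>i\<in>UNIV. of_real (v $ i) * partial i f x)) (at x)"
proof -
  have d: "(f has_derivative frechet_derivative f (at x)) (at x)"
    using assms by (simp add: frechet_derivative_works)
  then interpret bounded_linear "frechet_derivative f (at x)"
    by (rule has_derivative_bounded_linear)
  have "frechet_derivative f (at x) v = (\<Sum>i\<in>UNIV. of_real (v $ i) * partial i f x)" for v
  proof -
    have "frechet_derivative f (at x) (\<Sum>i\<in>UNIV. v $ i *\<^sub>R axis i 1) =
        (\<Sum>i\<in>UNIV. of_real (v $ i) * partial i f x)"
      unfolding sum scaleR partial_def by (intro sum.cong refl) (simp add: scaleR_conv_of_real)
    then show ?thesis unfolding axis_expansion .
  qed
  then show ?thesis using d by (metis (no_types, lifting) ext)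
qed

lemmas schwartz_has_derivative = has_derivative_partial[OF schwartz_differentiable]

lemma schwartz_continuous: "schwartz f \<Longrightarrow> continuous_on S f"
  by (simp add: continuous_at_imp_continuous_on differentiable_imp_continuous_within schwartz_differentiable)

lemma schwartz_measurable: "schwartz f \<Longrightarrow> f \<in> borel_measurable borel"
  by (intro borel_measurable_continuous_onI schwartz_continuous)

lemma schwartz_integrable: "schwartz f \<Longrightarrow> integrable lborel f"
  by (intro integrable_rapid schwartz_rapid schwartz_measurable)

text \<open>By the product rule the closure of the Schwartz functions under linear combinations and
  multiplication by coordinates is stable under partial derivatives, so \<open>schwartz_coinduct\<close> applies
  to it and it adds nothing new.\<close>

inductive_set schwartz_module :: "(real^'n::finite \<Rightarrow> complex) set" where
  base: "schwartz f \<Longrightarrow> f \<in> schwartz_module"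
| add: "f \<in> schwartz_module \<Longrightarrow> g \<in> schwartz_module \<Longrightarrow> (\<lambda>x. f x + g x) \<in> schwartz_module"
| cmult: "f \<in> schwartz_module \<Longrightarrow> (\<lambda>x. c * f x) \<in> schwartz_module"
| coord: "f \<in> schwartz_module \<Longrightarrow> (\<lambda>x. of_real (x $ j) * f x) \<in> schwartz_module"

lemma schwartz_module:
  fixes f :: "real^'n::finite \<Rightarrow> complex"
  assumes "f \<in> schwartz_module"
  shows "schwartz f"
proof (rule schwartz_coinduct[OF assms])
  have *: "(\<forall>x. f differentiable (at x)) \<and> rapid f \<and> (\<forall>i. partial i f \<in> schwartz_module)"
    if "f \<in> schwartz_module" for f :: "real^'n \<Rightarrow> complex"
    using that
  proof induction
    case (base f)
    then show ?case
      by (simp add: schwartz_differentiable schwartz_rapid schwartz_partial schwartz_module.base)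
  next
    case (add f g)
    then show ?case by (simp add: partial_add rapid_add schwartz_module.add)
  next
    case (cmult f c)
    then have "((\<lambda>x. c * f x) has_derivative (\<lambda>v. c * frechet_derivative f (at x) v)) (at x)" for x
      by (intro derivative_intros) (simp_all add: frechet_derivative_works[symmetric])
    then have "partial i (\<lambda>x. c * f x) = (\<lambda>x. c * partial i f x)" for i
      by (subst partial_eqI) (simp_all add: partial_def)
    moreover have "rapid (\<lambda>x. c * f x)"
      using cmult by - (rule rapid_mono[of f _ "cmod c"], simp_all add: norm_mult)
    ultimately show ?case using cmult by (simp add: schwartz_module.cmult)
  next
    case (coord f j)
    then have d: "((\<lambda>x. of_real (x $ j) * f x) has_derivative
        (\<lambda>v. of_real (x $ j) * frechet_derivative f (at x) v + of_real (v $ j) * f x)) (at x)" for x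
    proof -
      have "((\<lambda>x. of_real (x $ j)) has_derivative (\<lambda>v. of_real (v $ j) :: complex)) (at x)"
        by (intro bounded_linear.has_derivative[OF bounded_linear_of_real]
            bounded_linear_imp_has_derivative bounded_linear_vec_nth)
      from has_derivative_mult[OF this, of f] coord show ?thesis
        by (simp add: frechet_derivative_works[symmetric])
    qed
    then have "partial i (\<lambda>x. of_real (x $ j) * f x) =
        (\<lambda>x. of_real (x $ j) * partial i f x + of_real (axis i 1 $ j) * f x)" for i
      by (subst partial_eqI) (simp_all add: partial_def)
    moreover have "(\<lambda>x. of_real (x $ j) * partial i f x + of_real (axis i 1 $ j) * f x) \<in> schwartz_module" for i
      using coord by (intro schwartz_module.add schwartz_module.cmult schwartz_module.coord) auto
    moreover have "rapid (\<lambda>x. of_real (x $ j) * f x)"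
      unfolding rapid_iff
    proof
      fix k
      obtain C where C: "\<And>x. norm x ^ Suc k * norm (f x) \<le> C" using coord rapid_iff by metis
      have "norm x ^ k * norm (of_real (x $ j) * f x) \<le> C" for x
      proof -
        have "norm x ^ k * norm (of_real (x $ j) * f x) \<le> norm x ^ k * (norm x * norm (f x))"
          using component_le_norm_cart[of x j]
          by (intro mult_left_mono) (simp_all add: norm_mult mult_right_mono)
        also have "\<dots> \<le> C" using C[of x] by (simp add: mult_ac)
        finally show ?thesis .
      qed
      then show "\<exists>C. \<forall>x. norm x ^ k * norm (of_real (x $ j) * f x) \<le> C" by blast
    qed
    moreover have "(\<lambda>x. of_real (x $ j) * f x) differentiable (at x)" for x
      using d differentiable_def by blast
    ultimately show ?case by simp
  qed
  fix f :: "real^'n \<Rightarrow> complex" and x i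
  assume "f \<in> schwartz_module"
  then show "f differentiable (at x)" "rapid f" "partial i f \<in> schwartz_module"
    using * by auto
qed

lemma schwartz_add: "schwartz f \<Longrightarrow> schwartz g \<Longrightarrow> schwartz (\<lambda>x. f x + g x)"
  by (rule schwartz_module[OF schwartz_module.add[OF schwartz_module.base schwartz_module.base]])

lemma schwartz_cmult: "schwartz f \<Longrightarrow> schwartz (\<lambda>x. c * f x)"
  by (rule schwartz_module[OF schwartz_module.cmult[OF schwartz_module.base]])

lemma schwartz_coord: "schwartz f \<Longrightarrow> schwartz (\<lambda>x. of_real (x $ j) * f x)"
  by (rule schwartz_module[OF schwartz_module.coord[OF schwartz_module.base]])

lemma schwartz_sum:
  assumes "finite A" "\<And>i. i \<in> A \<Longrightarrow> schwartz (f i)" "schwartz g"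
  shows "schwartz (\<lambda>x. g x + (\<Sum>i\<in>A. f i x))"
  using assms
proof (induction A)
  case (insert i A)
  have "schwartz (\<lambda>x. g x + (\<Sum>i\<in>A. f i x))"
    using insert by auto
  with insert have "schwartz (\<lambda>x. f i x + (g x + (\<Sum>i\<in>A. f i x)))"
    by - (rule schwartz_add, simp_all)
  then show ?case using insert by (simp add: add_ac)
qed simp

lemma schwartz_cnj:
  fixes f :: "real^'n::finite \<Rightarrow> complex"
  assumes "schwartz f"
  shows "schwartz (\<lambda>x. cnj (f x))"
proof (rule schwartz_coinduct[of _ "{\<lambda>x. cnj (f x) | f. schwartz f}"])
  have d: "((\<lambda>x. cnj (f x)) has_derivative (\<lambda>v. cnj (frechet_derivative f (at x) v))) (at x)"
    if "schwartz f" for f :: "real^'n \<Rightarrow> complex" and x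
    using that
    by (intro bounded_linear.has_derivative[OF bounded_linear_cnj])
      (simp add: frechet_derivative_works[symmetric] schwartz_differentiable)
  fix h :: "real^'n \<Rightarrow> complex" and x i
  assume "h \<in> {\<lambda>x. cnj (f x) | f. schwartz f}"
  then obtain f where f: "schwartz f" "h = (\<lambda>x. cnj (f x))" by blast
  show "h differentiable (at x)" using d[OF f(1)] f(2) differentiable_def by blast
  show "rapid h" using schwartz_rapid[OF f(1)] by (simp add: f(2) rapid_def)
  have "partial i h = (\<lambda>x. cnj (partial i f x))"
    unfolding f(2) by (subst partial_eqI[OF d[OF f(1)]]) (simp add: partial_def)
  then show "partial i h \<in> {\<lambda>x. cnj (f x) | f. schwartz f}"
    using schwartz_partial[OF f(1)] by blast
qed (use assms in blast)

lemma schwartz_affine: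
  fixes f :: "real^'n::finite \<Rightarrow> complex"
  assumes "schwartz f" "c \<noteq> 0"
  shows "schwartz (\<lambda>x. f (c *\<^sub>R x + d))"
proof (rule schwartz_coinduct[of _ "{\<lambda>x. f (c *\<^sub>R x + d) | f. schwartz f}"])
  have d: "((\<lambda>x. f (c *\<^sub>R x + d)) has_derivative (\<lambda>v. frechet_derivative f (at (c *\<^sub>R x + d)) (c *\<^sub>R v))) (at x)"
    if "schwartz f" for f :: "real^'n \<Rightarrow> complex" and x
  proof -
    have "(f has_derivative frechet_derivative f (at (c *\<^sub>R x + d))) (at (c *\<^sub>R x + d))"
      using that by (simp add: frechet_derivative_works[symmetric] schwartz_differentiable)
    moreover have "((\<lambda>x. c *\<^sub>R x + d) has_derivative (\<lambda>v. c *\<^sub>R v)) (at x)"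
      by (auto intro!: derivative_eq_intros)
    ultimately show ?thesis
      by (rule has_derivative_compose[rotated])
  qed
  fix h :: "real^'n \<Rightarrow> complex" and x i
  assume "h \<in> {\<lambda>x. f (c *\<^sub>R x + d) | f. schwartz f}"
  then obtain f where f: "schwartz f" "h = (\<lambda>x. f (c *\<^sub>R x + d))" by blast
  show "h differentiable (at x)" using d[OF f(1)] f(2) differentiable_def by blast
  have "partial i h = (\<lambda>x. of_real c * partial i f (c *\<^sub>R x + d))"
  proof -
    have "frechet_derivative f (at y) (c *\<^sub>R axis i 1) = of_real c * partial i f y" for y
    proof -
      have "linear (frechet_derivative f (at y))"
        using f(1) by (intro linear_frechet_derivative schwartz_differentiable)
      from linear_scale[OF this, of c "axis i 1"] show ?thesis
        by (simp only: partial_def scaleR_conv_of_real)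
    qed
    then show ?thesis unfolding f(2) by (subst partial_eqI[OF d[OF f(1)]]) simp
  qed
  then show "partial i h \<in> {\<lambda>x. f (c *\<^sub>R x + d) | f. schwartz f}"
    using schwartz_cmult[OF schwartz_partial[OF f(1), of i], of "of_real c"] by auto
  show "rapid h"
    unfolding rapid_def
  proof
    fix N
    obtain C where C: "\<And>x. weight x ^ N * norm (f x) \<le> C"
      using schwartz_rapid[OF f(1)] rapid_def by metis
    define m where "m = 2 * weight d * (1 + inverse (c\<^sup>2))"
    have m: "m \<ge> 0" using weight_pos[of d] by (simp add: m_def)
    have le: "weight x \<le> m * weight (c *\<^sub>R x + d)" for x :: "real^'n"
    proof -
      have "weight x \<le> (1 + inverse (c\<^sup>2)) * weight (c *\<^sub>R x)"
        using assms(2) by (simp add: weight_def power_mult_distrib field_simps)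
      also have "\<dots> \<le> (1 + inverse (c\<^sup>2)) * (2 * weight (c *\<^sub>R x + d) * weight d)"
        by (intro mult_left_mono weight_peetre) simp
      finally show ?thesis by (simp add: m_def algebra_simps)
    qed
    have "weight x ^ N * norm (h x) \<le> m ^ N * C" for x
    proof -
      have "weight x ^ N * norm (h x) \<le> (m * weight (c *\<^sub>R x + d)) ^ N * norm (h x)"
        using le weight_pos[of x] by (intro mult_right_mono power_mono) auto
      also have "\<dots> = m ^ N * (weight (c *\<^sub>R x + d) ^ N * norm (f (c *\<^sub>R x + d)))"
        by (simp add: f(2) power_mult_distrib)
      also have "\<dots> \<le> m ^ N * C" using m C by (intro mult_left_mono) auto
      finally show ?thesis .
    qed
    then show "\<exists>C. \<forall>x. weight x ^ N * norm (h x) \<le> C" by blast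
  qed
qed (use assms in blast)

text \<open>By the mean value theorem the increment is controlled by the partial derivatives on the unit
  ball around \<^term>\<open>x\<close>, where Peetre's inequality keeps the weight comparable to \<^term>\<open>weight x\<close>.\<close>

lemma schwartz_lipschitz_weight:
  fixes f :: "real^'n::finite \<Rightarrow> complex"
  assumes "schwartz f"
  obtains C where "C \<ge> 0" "\<And>x h. norm h \<le> 1 \<Longrightarrow> norm (f (x + h) - f x) \<le> C * inverse (weight x ^ N) * norm h"
proof -
  have "\<exists>C. C \<ge> 0 \<and> (\<forall>x. norm (partial i f x) \<le> C * inverse (weight x ^ N))" for i
    using rapidE[OF schwartz_rapid[OF schwartz_partial[OF assms]]] by metis
  then obtain c where c: "\<And>i. c i \<ge> 0" "\<And>i x. norm (partial i f x) \<le> c i * inverse (weight x ^ N)"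
    by metis
  define C where "C = 4 ^ N * (\<Sum>i\<in>UNIV. c i)"
  have "C \<ge> 0" unfolding C_def using c(1) by (simp add: sum_nonneg)
  moreover have "norm (f (x + h) - f x) \<le> C * inverse (weight x ^ N) * norm h" if "norm h \<le> 1" for x h
  proof -
    let ?D = "\<lambda>y v. \<Sum>i\<in>UNIV. of_real (v $ i) * partial i f y"
    have "norm (f (x + h) - f x) \<le> (C * inverse (weight x ^ N)) * norm ((x + h) - x)"
    proof (rule differentiable_bound[of "cball x 1" f ?D])
      show "convex (cball x 1)" by simp
      show "x + h \<in> cball x 1" "x \<in> cball x 1" using that by (simp_all add: dist_norm)
      fix y assume "y \<in> cball x 1"
      then have y: "norm (y - x) \<le> 1" by (simp add: dist_norm norm_minus_commute)
      show "(f has_derivative ?D y) (at y within cball x 1)"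
        using schwartz_has_derivative[OF assms] by (rule has_derivative_at_withinI)
      have wle: "inverse (weight y ^ N) \<le> 4 ^ N * inverse (weight x ^ N)"
      proof -
        have "weight x ^ N \<le> 2 ^ N * weight (x + (y - x)) ^ N * weight (y - x) ^ N"
          by (rule weight_peetre_power)
        also have "\<dots> \<le> 2 ^ N * weight (x + (y - x)) ^ N * 2 ^ N"
          using y weight_pos[of "y - x"] weight_pos[of y]
          by (intro mult_left_mono power_mono) (auto simp: weight_def power_le_one)
        also have "\<dots> = 4 ^ N * weight y ^ N"
        proof -
          have "(4::real) ^ N = 2 ^ N * 2 ^ N"
            unfolding power_mult_distrib[symmetric] by simp
          then show ?thesis by simp
        qed
        finally show ?thesis
          using weight_pos[of x] weight_pos[of y] by (simp add: field_simps)
      qed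
      show "onorm (?D y) \<le> C * inverse (weight x ^ N)"
      proof (rule onorm_le)
        fix v
        have "norm (?D y v) \<le> (\<Sum>i\<in>UNIV. norm v * (c i * (4 ^ N * inverse (weight x ^ N))))"
        proof (rule sum_norm_le)
          fix i
          have "norm (partial i f y) \<le> c i * (4 ^ N * inverse (weight x ^ N))"
            using c(2)[of i y] mult_left_mono[OF wle c(1)[of i]] by simp
          then show "norm (of_real (v $ i) * partial i f y) \<le> norm v * (c i * (4 ^ N * inverse (weight x ^ N)))"
            using component_le_norm_cart[of v i] by (simp add: norm_mult mult_mono')
        qed
        also have "\<dots> = C * inverse (weight x ^ N) * norm v"
          by (simp add: C_def sum_distrib_left sum_distrib_right mult_ac)
        finally show "norm (?D y v) \<le> C * inverse (weight x ^ N) * norm v" .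
      qed
    qed
    then show ?thesis by simp
  qed
  ultimately show thesis using that by blast
qed

section \<open>The Fourier transform of a Schwartz function\<close>

lemma cis_diff_bound: "cmod (cis a - cis b) \<le> \<bar>a - b\<bar>"
proof -
  have "cmod (cis a - cis b) = cmod (cis b * (cis (a - b) - 1))"
    by (simp add: algebra_simps cis_mult)
  also have "\<dots> = cmod (iexp (a - b) - 1)"
    by (simp add: norm_mult cis_conv_exp)
  also have "\<dots> \<le> \<bar>a - b\<bar>"
    using iexp_approx1[of "a - b" 0] by simp
  finally show ?thesis .
qed

lemma continuous_cis [continuous_intros]:
  "continuous_on S f \<Longrightarrow> continuous_on S (\<lambda>x. cis (f x))"
  unfolding cis_conv_exp by (intro continuous_intros)

lemma has_derivative_cis:
  assumes "(f has_derivative f') (at x)"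
  shows "((\<lambda>x. cis (f x)) has_derivative (\<lambda>v. \<i> * of_real (f' v) * cis (f x))) (at x)"
  unfolding cis_conv_exp
  using has_derivative_compose[OF has_derivative_mult_right[OF
      bounded_linear.has_derivative[OF bounded_linear_of_real assms], of \<i>]
      DERIV_exp[unfolded has_field_derivative_def]]
  by (simp add: mult_ac)

definition fourier_kernel :: "'a::real_inner \<Rightarrow> 'a \<Rightarrow> complex" where
  "fourier_kernel x \<xi> = cis (- 2 * pi * (x \<bullet> \<xi>))"

lemma fourier_alt: "fourier f \<xi> = (LINT x|lborel. f x * fourier_kernel x \<xi>)"
  by (simp add: fourier_def fourier_kernel_def)

lemma norm_fourier_kernel [simp]: "cmod (fourier_kernel x \<xi>) = 1"
  by (simp add: fourier_kernel_def)

lemma fourier_kernel_measurable [measurable]: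
  "(\<lambda>x::'a::euclidean_space. fourier_kernel x \<xi>) \<in> borel_measurable borel"
  unfolding fourier_kernel_def by (intro borel_measurable_continuous_onI continuous_intros)

lemma integrable_mult_bounded:
  fixes f g :: "'a \<Rightarrow> complex"
  assumes "integrable M f" "g \<in> borel_measurable M" "\<And>x. norm (g x) \<le> C"
  shows "integrable M (\<lambda>x. f x * g x)"
proof (rule Bochner_Integration.integrable_bound)
  show "integrable M (\<lambda>x. C * norm (f x))" using assms(1) by simp
  show "(\<lambda>x. f x * g x) \<in> borel_measurable M" using assms by simp
  show "AE x in M. norm (f x * g x) \<le> norm (C * norm (f x))"
  proof (rule AE_I2)
    fix x
    have "norm (f x * g x) \<le> norm (f x) * C"
      unfolding norm_mult by (intro mult_left_mono assms) simp
    also have "\<dots> \<le> norm (C * norm (f x))" by (simp add: abs_mult mult.commute mult_right_mono)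
    finally show "norm (f x * g x) \<le> norm (C * norm (f x))" .
  qed
qed

lemma fourier_integrable:
  "integrable lborel f \<Longrightarrow> integrable lborel (\<lambda>x. f x * fourier_kernel x \<xi>)"
  by (rule integrable_mult_bounded[of _ _ _ 1]) simp_all

text \<open>Translating \<^term>\<open>f\<close> along a coordinate axis multiplies its Fourier transform by a character.
  Differentiating both sides at \<open>t = 0\<close> replaces an integration by parts.\<close>

lemma fourier_partial:
  fixes f :: "real^'n::finite \<Rightarrow> complex"
  assumes f: "schwartz f"
  shows "fourier (partial i f) \<xi> = 2 * pi * \<i> * (\<xi> $ i) * fourier f \<xi>"
proof -
  define e :: "real^'n" where "e = axis i 1"
  let ?G = "\<lambda>x t::real. f (x + t *\<^sub>R e) * fourier_kernel x \<xi>"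
  obtain C where C: "C \<ge> 0" "\<And>x h. norm h \<le> 1 \<Longrightarrow>
      norm (f (x + h) - f x) \<le> C * inverse (weight x ^ DIM(real^'n)) * norm h"
    using schwartz_lipschitz_weight[OF f] by metis
  have [measurable]: "f \<in> borel_measurable borel" by (rule schwartz_measurable[OF f])
  have [simp]: "norm e = 1" by (simp add: e_def norm_axis_1)
  have "((\<lambda>t. LINT x|lborel. ?G x t) has_derivative
      (\<lambda>t. LINT x|lborel. of_real t * partial i f x * fourier_kernel x \<xi>)) (at 0)"
  proof (rule has_derivative_integral[where W = "\<lambda>x. C * inverse (weight x ^ DIM(real^'n))"])
    show "(\<lambda>x. ?G x t) \<in> borel_measurable lborel" for t by measurable
    show "integrable lborel (\<lambda>x. ?G x 0)"
      using fourier_integrable[OF schwartz_integrable[OF f]] by simp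
    show "integrable lborel (\<lambda>x::real^'n. C * inverse (weight x ^ DIM(real^'n)))"
      using integrable_inverse_weight[where 'a = "real^'n"] by simp
    fix x
    show "norm (?G x (0 + t) - ?G x 0) \<le> C * inverse (weight x ^ DIM(real^'n)) * norm t"
      if "norm t \<le> 1" for t
    proof -
      have "?G x (0 + t) - ?G x 0 = (f (x + t *\<^sub>R e) - f x) * fourier_kernel x \<xi>"
        by (simp add: algebra_simps)
      then show ?thesis using C(2)[of "t *\<^sub>R e" x] that by (simp add: norm_mult)
    qed
    have 1: "((\<lambda>t::real. x + t *\<^sub>R e) has_derivative (\<lambda>t. t *\<^sub>R e)) (at 0)"
      by (auto intro!: derivative_eq_intros)
    have 2: "(f has_derivative (\<lambda>v. \<Sum>j\<in>UNIV. of_real (v $ j) * partial j f x)) (at (x + 0 *\<^sub>R e))"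
      using schwartz_has_derivative[OF f, of x] by simp
    have sum: "(\<Sum>j\<in>UNIV. of_real ((t *\<^sub>R e) $ j) * partial j f x) = of_real t * partial i f x" for t
      using sum_axis[of i "\<lambda>j. of_real t * partial j f x"] by (simp add: e_def mult_ac)
    show "(?G x has_derivative (\<lambda>t. of_real t * partial i f x * fourier_kernel x \<xi>)) (at 0)"
      using has_derivative_mult_left[OF has_derivative_compose[OF 1 2], of "fourier_kernel x \<xi>"]
      unfolding sum by simp
  qed
  moreover have "(LINT x|lborel. of_real t * partial i f x * fourier_kernel x \<xi>) = of_real t * fourier (partial i f) \<xi>" for t
    by (simp add: fourier_alt mult.assoc)
  moreover have "(LINT x|lborel. ?G x t) = cis (2 * pi * t * (\<xi> $ i)) * fourier f \<xi>" for t
  proof -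
    have "(LINT x|lborel. ?G x t) = (LINT x|lborel. f ((t *\<^sub>R e) + x) * fourier_kernel ((t *\<^sub>R e) + x) \<xi> * cis (2 * pi * t * (\<xi> $ i)))"
    proof (intro Bochner_Integration.integral_cong refl)
      fix x
      have "e \<bullet> \<xi> = \<xi> $ i" by (simp add: e_def inner_axis')
      then have "fourier_kernel x \<xi> = fourier_kernel ((t *\<^sub>R e) + x) \<xi> * cis (2 * pi * t * (\<xi> $ i))"
        by (simp add: fourier_kernel_def cis_mult inner_add_left algebra_simps)
      then show "?G x t = f ((t *\<^sub>R e) + x) * fourier_kernel ((t *\<^sub>R e) + x) \<xi> * cis (2 * pi * t * (\<xi> $ i))"
        by (simp add: add.commute)
    qed
    also have "\<dots> = (LINT x|lborel. f x * fourier_kernel x \<xi> * cis (2 * pi * t * (\<xi> $ i)))"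
      by (rule integral_translate) measurable
    finally show ?thesis by (simp add: fourier_alt mult.commute)
  qed
  ultimately have "((\<lambda>t. cis (2 * pi * t * (\<xi> $ i)) * fourier f \<xi>) has_derivative
      (\<lambda>t. of_real t * fourier (partial i f) \<xi>)) (at 0)"
    by simp
  moreover have "((\<lambda>t. cis (2 * pi * t * (\<xi> $ i)) * fourier f \<xi>) has_derivative
      (\<lambda>t. \<i> * of_real (2 * pi * t * (\<xi> $ i)) * cis (2 * pi * 0 * (\<xi> $ i)) * fourier f \<xi>)) (at 0)"
    by (intro has_derivative_mult_left has_derivative_cis) (auto intro!: derivative_eq_intros)
  ultimately have "(\<lambda>t. of_real t * fourier (partial i f) \<xi>) =
      (\<lambda>t. \<i> * of_real (2 * pi * t * (\<xi> $ i)) * cis (2 * pi * 0 * (\<xi> $ i)) * fourier f \<xi>)"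
    by (rule has_derivative_unique)
  from fun_cong[OF this, of 1] show ?thesis by (simp add: mult_ac)
qed

lemma fourier_has_derivative:
  fixes f :: "real^'n::finite \<Rightarrow> complex"
  assumes f: "schwartz f"
  shows "(fourier f has_derivative
    (\<lambda>v. LINT x|lborel. \<i> * of_real (- 2 * pi * (x \<bullet> v)) * (f x * fourier_kernel x \<xi>))) (at \<xi>)"
proof -
  have [measurable]: "f \<in> borel_measurable borel" by (rule schwartz_measurable[OF f])
  show ?thesis
    unfolding fourier_alt[abs_def]
  proof (rule has_derivative_integral[where W = "\<lambda>x. 2 * pi * (weight x ^ 1 * norm (f x))"])
    show "(\<lambda>x. f x * fourier_kernel x y) \<in> borel_measurable lborel" for y by measurable
    show "integrable lborel (\<lambda>x. f x * fourier_kernel x \<xi>)"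
      by (rule fourier_integrable[OF schwartz_integrable[OF f]])
    show "integrable lborel (\<lambda>x. 2 * pi * (weight x ^ 1 * norm (f x)))"
      using integrable_rapid(1)[OF schwartz_rapid[OF f], of 1] by simp
    fix x
    have "((\<lambda>\<xi>. cis (- 2 * pi * (x \<bullet> \<xi>))) has_derivative
      (\<lambda>v. \<i> * of_real (- 2 * pi * (x \<bullet> v)) * cis (- 2 * pi * (x \<bullet> \<xi>)))) (at \<xi>)"
      by (intro has_derivative_cis) (auto intro!: derivative_eq_intros)
    from has_derivative_mult_right[OF this, of "f x"]
    show "((\<lambda>\<xi>. f x * fourier_kernel x \<xi>) has_derivative
        (\<lambda>v. \<i> * of_real (- 2 * pi * (x \<bullet> v)) * (f x * fourier_kernel x \<xi>))) (at \<xi>)"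
      by (simp add: fourier_kernel_def mult_ac)
    fix h :: "real^'n"
    have nx: "norm x * norm h \<le> weight x * norm h"
      by (intro mult_right_mono norm_le_weight) auto
    have "norm (f x * fourier_kernel x (\<xi> + h) - f x * fourier_kernel x \<xi>) =
        norm (f x) * norm (fourier_kernel x (\<xi> + h) - fourier_kernel x \<xi>)"
      by (simp add: right_diff_distrib[symmetric] norm_mult)
    also have "\<dots> \<le> norm (f x) * (2 * pi * \<bar>x \<bullet> h\<bar>)"
      using cis_diff_bound[of "- 2 * pi * (x \<bullet> (\<xi> + h))" "- 2 * pi * (x \<bullet> \<xi>)"]
      by (intro mult_left_mono) (simp_all add: fourier_kernel_def inner_add_right algebra_simps abs_mult)
    also have "\<dots> \<le> norm (f x) * (2 * pi * (weight x * norm h))"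
      using Cauchy_Schwarz_ineq2[of x h] nx by (intro mult_left_mono) auto
    finally show "norm (f x * fourier_kernel x (\<xi> + h) - f x * fourier_kernel x \<xi>) \<le>
        2 * pi * (weight x ^ 1 * norm (f x)) * norm h"
      by (simp add: mult_ac)
  qed
qed

lemma partial_fourier:
  assumes "schwartz f"
  shows "partial i (fourier f) = fourier (\<lambda>x. (- 2 * pi * \<i>) * (of_real (x $ i) * f x))"
proof
  fix \<xi>
  show "partial i (fourier f) \<xi> = fourier (\<lambda>x. (- 2 * pi * \<i>) * (of_real (x $ i) * f x)) \<xi>"
    unfolding partial_eqI[OF fourier_has_derivative[OF assms]] fourier_alt
    by (intro Bochner_Integration.integral_cong refl) (simp add: inner_axis)
qed

text \<open>The weight is, up to constants, the symbol of a second order differential operator, so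
  \<^term>\<open>weight \<xi> ^ N * fourier f \<xi>\<close> is again the Fourier transform of a Schwartz function.\<close>

lemma rapid_fourier:
  fixes f :: "real^'n::finite \<Rightarrow> complex"
  assumes "schwartz f"
  shows "rapid (fourier f)"
proof -
  \<comment> \<open>$1 - \frac{1}{4\pi^2}$ times the Laplacian, whose symbol is the weight.\<close>
  define L where "L f = (\<lambda>x. f x + (\<Sum>i\<in>UNIV. (-1 / (4 * pi\<^sup>2)) * partial i (partial i f) x))"
    for f :: "real^'n \<Rightarrow> complex"
  have L: "schwartz (L f)" if "schwartz f" for f
    unfolding L_def using that by (intro schwartz_sum schwartz_cmult schwartz_partial) auto
  have fL: "fourier (L f) \<xi> = of_real (weight \<xi>) * fourier f \<xi>" if f: "schwartz f" for f \<xi>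
  proof -
    have "fourier (L f) \<xi> = fourier f \<xi> + (\<Sum>i\<in>UNIV. (-1 / (4 * pi\<^sup>2)) * fourier (partial i (partial i f)) \<xi>)"
    proof -
      have int: "integrable lborel (\<lambda>x. f x * fourier_kernel x \<xi>)"
        "integrable lborel (\<lambda>x. (-1 / (4 * pi\<^sup>2)) * (partial i (partial i f) x * fourier_kernel x \<xi>))" for i
        using f by (intro Bochner_Integration.integrable_mult_right fourier_integrable
            schwartz_integrable schwartz_partial; assumption)+
      have "fourier (L f) \<xi> = (LINT x|lborel. f x * fourier_kernel x \<xi> +
          (\<Sum>i\<in>UNIV. (-1 / (4 * pi\<^sup>2)) * (partial i (partial i f) x * fourier_kernel x \<xi>)))"
        by (simp add: fourier_alt L_def distrib_right sum_distrib_right mult.assoc)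
      also have "\<dots> = fourier f \<xi> + (\<Sum>i\<in>UNIV. (-1 / (4 * pi\<^sup>2)) * fourier (partial i (partial i f)) \<xi>)"
        by (subst Bochner_Integration.integral_add[OF int(1) Bochner_Integration.integrable_sum[OF int(2)]],
            subst Bochner_Integration.integral_sum[OF int(2)])
          (simp add: fourier_alt)
      finally show ?thesis .
    qed
    also have "\<dots> = fourier f \<xi> + (\<Sum>i\<in>UNIV. of_real ((\<xi> $ i)\<^sup>2) * fourier f \<xi>)"
      using f by (simp add: fourier_partial schwartz_partial power2_eq_square field_simps)
    also have "\<dots> = of_real (weight \<xi>) * fourier f \<xi>"
      by (simp add: weight_def norm_vec_def L2_set_def sum_nonneg sum_distrib_right distrib_right)
    finally show ?thesis .
  qed
  have "\<exists>C. \<forall>\<xi>. weight \<xi> ^ N * norm (fourier f \<xi>) \<le> C" if "schwartz f" for N and f :: "real^'n \<Rightarrow> complex"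
    using that
  proof (induction N arbitrary: f)
    case 0
    have "norm (fourier f \<xi>) \<le> (LINT x|lborel. norm (f x))" for \<xi>
      using integral_norm_bound[of lborel "\<lambda>x. f x * fourier_kernel x \<xi>"]
      by (simp add: fourier_alt norm_mult)
    then show ?case by auto
  next
    case (Suc N)
    then obtain C where "\<And>\<xi>. weight \<xi> ^ N * norm (fourier (L f) \<xi>) \<le> C" using L by blast
    then have "weight \<xi> ^ Suc N * norm (fourier f \<xi>) \<le> C" for \<xi>
      by (simp add: fL[OF Suc.prems] norm_mult mult_ac abs_of_pos[OF weight_pos])
    then show ?case by blast
  qed
  then show ?thesis using assms by (simp add: rapid_def)
qed

lemma schwartz_fourier:
  assumes "schwartz f"
  shows "schwartz (fourier f)"
proof (rule schwartz_coinduct[of _ "{fourier f | f. schwartz f}"])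
  fix h :: "real^'a \<Rightarrow> complex" and x i
  assume "h \<in> {fourier f | f. schwartz f}"
  then obtain f where f: "schwartz f" "h = fourier f" by blast
  show "h differentiable (at x)" "rapid h"
    using f fourier_has_derivative differentiable_def rapid_fourier by blast+
  show "partial i h \<in> {fourier f | f. schwartz f}"
    unfolding f(2) partial_fourier[OF f(1)] using schwartz_cmult[OF schwartz_coord[OF f(1)]] by blast
qed (use assms in blast)

subsection \<open>Interchanging integrals\<close>

lemma Fubini_continuous:
  fixes H :: "'a::euclidean_space \<Rightarrow> 'b::euclidean_space \<Rightarrow> complex" and f :: "'a \<Rightarrow> real" and g :: "'b \<Rightarrow> real"
  assumes H: "continuous_on UNIV (\<lambda>p. H (fst p) (snd p))"
    and fg: "integrable lborel f" "integrable lborel g"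
    and bound: "\<And>x y. norm (H x y) \<le> f x * g y"
  shows "(LINT y|lborel. (LINT x|lborel. H x y)) = (LINT x|lborel. (LINT y|lborel. H x y))"
proof -
  have meas: "(\<lambda>p. H (fst p) (snd p)) \<in> borel_measurable (lborel \<Otimes>\<^sub>M lborel)"
    using H by (simp add: lborel_prod borel_measurable_continuous_onI)
  have inner: "integrable lborel (H x)" for x
  proof (rule Bochner_Integration.integrable_bound)
    show "integrable lborel (\<lambda>y. f x * g y)" using fg by simp
    have "continuous_on UNIV (\<lambda>y. H x y)"
      using continuous_on_compose2[OF H, of UNIV "\<lambda>y. (x, y)"] by (simp add: continuous_intros)
    then show "H x \<in> borel_measurable lborel" by (simp add: borel_measurable_continuous_onI)
    show "AE y in lborel. norm (H x y) \<le> norm (f x * g y)"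
      using bound order_trans[OF _ abs_ge_self] by (intro AE_I2) auto
  qed
  have "integrable (lborel \<Otimes>\<^sub>M lborel) (\<lambda>p. H (fst p) (snd p))"
  proof (rule lborel_pair.Fubini_integrable[OF meas])
    show "AE x in lborel. integrable lborel (\<lambda>y. H (fst (x, y)) (snd (x, y)))"
      using inner by simp
    show "integrable lborel (\<lambda>x. LINT y|lborel. norm (H (fst (x, y)) (snd (x, y))))"
    proof (rule Bochner_Integration.integrable_bound)
      show "integrable lborel (\<lambda>x. f x * (LINT y|lborel. g y))" using fg by simp
      show "(\<lambda>x. LINT y|lborel. norm (H (fst (x, y)) (snd (x, y)))) \<in> borel_measurable lborel"
        using meas by (intro lborel.borel_measurable_lebesgue_integral) (simp add: split_beta')
      show "AE x in lborel. norm (LINT y|lborel. norm (H (fst (x, y)) (snd (x, y)))) \<le> norm (f x * (LINT y|lborel. g y))"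
      proof (rule AE_I2)
        fix x
        have "(LINT y|lborel. norm (H x y)) \<le> (LINT y|lborel. f x * g y)"
          using inner fg bound by (intro integral_mono) auto
        then show "norm (LINT y|lborel. norm (H (fst (x, y)) (snd (x, y)))) \<le> norm (f x * (LINT y|lborel. g y))"
          by (simp add: abs_of_nonneg)
      qed
    qed
  qed
  then show ?thesis
    by (intro lborel_pair.Fubini_integral) (simp add: split_beta')
qed

lemma norm_mult_right_le: "norm b \<le> B \<Longrightarrow> norm (a * b) \<le> B * norm (a::complex)"
  using mult_left_mono[of "norm b" B "norm a"] by (simp add: norm_mult mult.commute)

subsection \<open>Approximate identities\<close>

lemma divideR_at_top: "((\<lambda>t. x /\<^sub>R t) \<longlongrightarrow> 0) at_top" for x :: "'a::real_normed_vector"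
proof -
  have "((\<lambda>t. x /\<^sub>R t) \<longlongrightarrow> 0 *\<^sub>R x) at_top"
    by (intro tendsto_scaleR tendsto_const tendsto_inverse_0_at_top filterlim_ident)
  then show ?thesis by simp
qed

text \<open>Dilating the variable moves the scale from the kernel to \<^term>\<open>F\<close>, where dominated convergence
  applies.\<close>

lemma approximate_identity:
  fixes K F :: "'a::euclidean_space \<Rightarrow> complex"
  assumes K: "integrable lborel K" and F [measurable]: "F \<in> borel_measurable borel"
    and B: "\<And>x. norm (F x) \<le> B" and cont: "isCont F 0"
  shows "((\<lambda>t. LINT x|lborel. of_real (t ^ DIM('a)) * K (t *\<^sub>R x) * F x) \<longlongrightarrow> (LINT x|lborel. K x) * F 0) at_top"
proof -
  have [measurable]: "K \<in> borel_measurable borel"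
    using borel_measurable_integrable[OF K] by simp
  have "((\<lambda>t. LINT x|lborel. K x * F (x /\<^sub>R t)) \<longlongrightarrow> (LINT x|lborel. K x * F 0)) at_top"
  proof (rule integral_dominated_convergence_at_top[where w = "\<lambda>x. B * norm (K x)"])
    show "\<forall>\<^sub>F t in at_top. AE x in lborel. norm (K x * F (x /\<^sub>R t)) \<le> B * norm (K x)"
      using B by (intro always_eventually allI AE_I2 norm_mult_right_le)
    show "AE x in lborel. ((\<lambda>t. K x * F (x /\<^sub>R t)) \<longlongrightarrow> K x * F 0) at_top"
    proof (rule AE_I2)
      fix x :: 'a
      from isCont_tendsto_compose[OF cont divideR_at_top]
      show "((\<lambda>t. K x * F (x /\<^sub>R t)) \<longlongrightarrow> K x * F 0) at_top"
        by (intro tendsto_mult tendsto_const)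
    qed
  qed (use K in simp_all)
  moreover have "\<forall>\<^sub>F t in at_top. (LINT x|lborel. K x * F (x /\<^sub>R t)) =
      (LINT x|lborel. of_real (t ^ DIM('a)) * K (t *\<^sub>R x) * F x)"
    using eventually_gt_at_top[of "0::real"]
  proof eventually_elim
    case (elim t)
    show ?case
      using integral_dilate[of "\<lambda>x. K x * F (x /\<^sub>R t)" t] elim by (simp add: mult.assoc)
  qed
  ultimately show ?thesis
    by (simp add: tendsto_cong)
qed

lemma fourier_dilate:
  fixes f :: "real^'n::finite \<Rightarrow> complex"
  assumes [measurable]: "f \<in> borel_measurable borel" and t: "t > 0"
  shows "fourier (\<lambda>x. f (x /\<^sub>R t)) \<xi> = of_real (t ^ DIM(real^'n)) * fourier f (t *\<^sub>R \<xi>)"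
proof -
  have "fourier (\<lambda>x. f (x /\<^sub>R t)) \<xi> = (LINT x|lborel. of_real (t ^ DIM(real^'n)) *
      (f (t *\<^sub>R x /\<^sub>R t) * fourier_kernel (t *\<^sub>R x) \<xi>))"
    unfolding fourier_alt
    by (rule integral_dilate[symmetric, of "\<lambda>x. f (x /\<^sub>R t) * fourier_kernel x \<xi>"]) (use t in measurable)
  also have "\<dots> = of_real (t ^ DIM(real^'n)) * fourier f (t *\<^sub>R \<xi>)"
    using t by (simp add: fourier_alt fourier_kernel_def)
  finally show ?thesis .
qed

text \<open>The characteristic function of the standard normal distribution, rescaled by $\sqrt{2\pi}$.\<close>

lemma gaussian_fourier_1d:
  "(LINT t|lborel. of_real (exp (- pi * t\<^sup>2)) * cis (- 2 * pi * (t * s))) = of_real (exp (- pi * s\<^sup>2))"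
proof -
  define r where "r = sqrt (2 * pi)"
  have r: "r > 0" "r\<^sup>2 = 2 * pi" by (simp_all add: r_def)
  let ?f = "\<lambda>x. of_real (std_normal_density x) * iexp (- r * s * x)"
  have "(LINT x|lborel. ?f x) = char std_normal_distribution (- r * s)"
    unfolding char_def
    by (subst integral_density) (simp_all add: scaleR_conv_of_real)
  also have "\<dots> = of_real (exp (- pi * s\<^sup>2))"
    by (simp add: char_std_normal_distribution power_mult_distrib r)
  also have "(LINT x|lborel. ?f x) = (LINT x|lborel. of_real (r ^ DIM(real)) * ?f (r *\<^sub>R x))"
    using r by (intro integral_dilate[symmetric]) simp_all
  also have "\<dots> = (LINT t|lborel. of_real (exp (- pi * t\<^sup>2)) * cis (- 2 * pi * (t * s)))"
  proof (intro Bochner_Integration.integral_cong refl)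
    fix x :: real
    have "r * std_normal_density (r * x) = exp (- pi * x\<^sup>2)"
      using r by (simp add: std_normal_density_def r_def[symmetric] power_mult_distrib)
    then have "complex_of_real r * of_real (std_normal_density (r * x)) = of_real (exp (- pi * x\<^sup>2))"
      by (metis of_real_mult)
    moreover have "iexp (- r * s * (r * x)) = cis (- 2 * pi * (x * s))"
    proof -
      have "- r * s * (r * x) = - (r\<^sup>2) * (x * s)" by (simp add: power2_eq_square)
      then have "- r * s * (r * x) = - 2 * pi * (x * s)" unfolding r(2) by simp
      then show ?thesis unfolding cis_conv_exp by (simp only:)
    qed
    ultimately show "of_real (r ^ DIM(real)) * ?f (r *\<^sub>R x) = of_real (exp (- pi * x\<^sup>2)) * cis (- 2 * pi * (x * s))"
      by (simp add: mult.assoc[symmetric])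
  qed
  finally show ?thesis .
qed

definition gaussian :: "'a::euclidean_space \<Rightarrow> real" where
  "gaussian x = exp (- pi * (norm x)\<^sup>2)"

lemma gaussian_prod: "gaussian x = (\<Prod>b\<in>Basis. exp (- pi * (x \<bullet> b)\<^sup>2))"
  unfolding gaussian_def power2_norm_eq_inner euclidean_inner[of x x]
  by (simp add: exp_sum[symmetric] sum_distrib_left sum_negf power2_eq_square)

lemma gaussian_integrable: "integrable lborel (gaussian :: 'a::euclidean_space \<Rightarrow> real)"
proof -
  have "integrable lborel (\<lambda>t::real. exp (- pi * t\<^sup>2))"
  proof -
    have "integrable lborel (\<lambda>x. sqrt (2 * pi) * std_normal_density (sqrt (2 * pi) *\<^sub>R x))"
      by (intro Bochner_Integration.integrable_mult_right integrable_dilate integrable_normal_density) simp_all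
    moreover have eq: "sqrt (2 * pi) * std_normal_density (sqrt (2 * pi) *\<^sub>R x) = exp (- pi * x\<^sup>2)" for x
      by (simp add: std_normal_density_def power_mult_distrib)
    ultimately show ?thesis unfolding eq by simp
  qed
  then show ?thesis
    unfolding gaussian_prod[abs_def] by (intro lborel_prod_Basis)
qed

lemma gaussian_fourier:
  fixes x :: "'a::euclidean_space"
  shows "(LINT \<xi>|lborel. of_real (gaussian \<xi>) * fourier_kernel x \<xi>) = of_real (gaussian x)"
proof -
  have int: "integrable lborel (\<lambda>t. of_real (exp (- pi * t\<^sup>2)) * cis (- 2 * pi * (t * s)))" for s
  proof (rule integrable_mult_bounded[of _ _ _ 1])
    have "integrable lborel (\<lambda>t::real. exp (- pi * t\<^sup>2))"
      using gaussian_integrable[where 'a = real] by (simp add: gaussian_def[abs_def])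
    then show "integrable lborel (\<lambda>t::real. complex_of_real (exp (- pi * t\<^sup>2)))"
      by (rule integrable_of_real)
    show "(\<lambda>t. cis (- 2 * pi * (t * s))) \<in> borel_measurable lborel"
      by (simp, intro borel_measurable_continuous_onI continuous_intros)
  qed simp
  have prod_cis: "(\<Prod>b\<in>B. cis (h b)) = cis (\<Sum>b\<in>B. h b)" if "finite B" for B :: "'a set" and h
    using that by induction (simp_all add: cis_mult)
  have "of_real (gaussian \<xi>) * fourier_kernel x \<xi> =
      (\<Prod>b\<in>Basis. of_real (exp (- pi * (\<xi> \<bullet> b)\<^sup>2)) * cis (- 2 * pi * ((\<xi> \<bullet> b) * (x \<bullet> b))))" for \<xi>
    unfolding prod.distrib prod_cis[OF finite_Basis]
    by (simp add: gaussian_prod fourier_kernel_def euclidean_inner[of x \<xi>] sum_distrib_left mult_ac sum_negf)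
  then show ?thesis
    using lborel_prod_Basis(2)[of "\<lambda>b t. of_real (exp (- pi * t\<^sup>2)) * cis (- 2 * pi * (t * (x \<bullet> b)))", OF int]
    by (simp only: gaussian_fourier_1d) (simp add: gaussian_prod)
qed

lemma gaussian_integral: "(LINT x::'a::euclidean_space|lborel. complex_of_real (gaussian x)) = 1"
  using gaussian_fourier[of "0::'a"] by (simp add: fourier_kernel_def gaussian_def)

text \<open>Fourier inversion at the origin. Testing \<^term>\<open>fourier f\<close> against the self-dual Gaussian moves
  the Fourier transform to the Gaussian; dilating \<^term>\<open>f\<close> then compares the two values.\<close>

lemma integral_fourier:
  fixes f :: "real^'n::finite \<Rightarrow> complex"
  assumes f: "schwartz f"
  shows "(LINT \<xi>|lborel. fourier f \<xi>) = f 0"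
proof -
  note [measurable] = schwartz_measurable[OF f] schwartz_measurable[OF schwartz_fourier[OF f]]
  have gm [measurable]: "(gaussian :: real^'n \<Rightarrow> real) \<in> borel_measurable borel"
    using borel_measurable_integrable[OF gaussian_integrable] by simp
  have gc: "isCont (\<lambda>x. complex_of_real (gaussian x)) x" for x :: "real^'n"
    unfolding gaussian_def by (intro continuous_intros)
  have gb: "norm (complex_of_real (gaussian x)) \<le> 1" for x :: "real^'n"
    by (simp add: gaussian_def)
  have dual: "(LINT \<xi>|lborel. fourier h \<xi> * of_real (gaussian \<xi>)) = (LINT x|lborel. h x * of_real (gaussian x))"
    if h: "schwartz h" for h :: "real^'n \<Rightarrow> complex"
  proof -
    let ?H = "\<lambda>x \<xi>. h x * (of_real (gaussian \<xi>) * fourier_kernel x \<xi>)"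
    have "(LINT \<xi>|lborel. fourier h \<xi> * of_real (gaussian \<xi>)) = (LINT \<xi>|lborel. (LINT x|lborel. ?H x \<xi>))"
    proof (intro Bochner_Integration.integral_cong refl)
      fix \<xi>
      have "fourier h \<xi> * of_real (gaussian \<xi>) = (LINT x|lborel. h x * fourier_kernel x \<xi> * of_real (gaussian \<xi>))"
        by (simp add: fourier_alt)
      then show "fourier h \<xi> * of_real (gaussian \<xi>) = (LINT x|lborel. ?H x \<xi>)"
        by (simp only: mult_ac)
    qed
    also have "\<dots> = (LINT x|lborel. (LINT \<xi>|lborel. ?H x \<xi>))"
    proof (rule Fubini_continuous[where f = "\<lambda>x. norm (h x)" and g = gaussian])
      have "continuous_on UNIV (\<lambda>p::(real^'n) \<times> (real^'n). h (fst p))"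
        by (rule continuous_on_compose2[OF schwartz_continuous[OF h, of UNIV]]) (auto intro: continuous_intros)
      then show "continuous_on UNIV (\<lambda>p. ?H (fst p) (snd p))"
        unfolding fourier_kernel_def gaussian_def by (intro continuous_intros)
      show "norm (?H x y) \<le> norm (h x) * gaussian y" for x y
        by (simp add: norm_mult gaussian_def)
    qed (use h gaussian_integrable in \<open>simp_all add: schwartz_integrable\<close>)
    also have "\<dots> = (LINT x|lborel. h x * of_real (gaussian x))"
      by (simp add: gaussian_fourier)
    finally show ?thesis .
  qed
  have "((\<lambda>t. LINT \<xi>|lborel. of_real (t ^ DIM(real^'n)) * fourier f (t *\<^sub>R \<xi>) * of_real (gaussian \<xi>)) \<longlongrightarrow>
      (LINT \<xi>|lborel. fourier f \<xi>) * of_real (gaussian (0::real^'n))) at_top"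
    by (rule approximate_identity[OF _ _ gb gc])
      (use schwartz_integrable[OF schwartz_fourier[OF f]] in simp_all)
  moreover have "\<forall>\<^sub>F t in at_top. (LINT \<xi>|lborel. of_real (t ^ DIM(real^'n)) * fourier f (t *\<^sub>R \<xi>) * of_real (gaussian \<xi>)) =
      (LINT x|lborel. f (x /\<^sub>R t) * of_real (gaussian x))"
    using eventually_gt_at_top[of "0::real"]
  proof eventually_elim
    case (elim t)
    have "schwartz (\<lambda>x. f (x /\<^sub>R t))"
      using schwartz_affine[OF f, of "inverse t" 0] elim by simp
    from dual[OF this] show ?case
      using elim by (simp add: fourier_dilate)
  qed
  ultimately have "((\<lambda>t. LINT x|lborel. f (x /\<^sub>R t) * of_real (gaussian x)) \<longlongrightarrow> (LINT \<xi>|lborel. fourier f \<xi>)) at_top"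
    by (simp add: gaussian_def Lim_transform_eventually)
  moreover have "((\<lambda>t. LINT x|lborel. f (x /\<^sub>R t) * of_real (gaussian x)) \<longlongrightarrow>
      (LINT x|lborel. f 0 * of_real (gaussian (x::real^'n)))) at_top"
  proof -
    obtain B where B: "\<And>x. norm (f x) \<le> B" using rapid_bounded[OF schwartz_rapid[OF f]] by metis
    show ?thesis
    proof (rule integral_dominated_convergence_at_top[where w = "\<lambda>x::real^'n. B * gaussian x"])
      show "\<forall>\<^sub>F t in at_top. AE x in lborel. norm (f (x /\<^sub>R t) * of_real (gaussian x)) \<le> B * gaussian x"
        using B by (intro always_eventually allI AE_I2) (simp add: norm_mult gaussian_def mult_right_mono)
      show "AE x in lborel. ((\<lambda>t. f (x /\<^sub>R t) * of_real (gaussian x)) \<longlongrightarrow> f 0 * of_real (gaussian x)) at_top"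
      proof (rule AE_I2)
        fix x :: "real^'n"
        have "isCont f 0"
          using schwartz_continuous[OF f, of UNIV] by (simp add: continuous_on_eq_continuous_at)
        then show "((\<lambda>t. f (x /\<^sub>R t) * of_real (gaussian x)) \<longlongrightarrow> f 0 * of_real (gaussian x)) at_top"
          by (intro tendsto_mult tendsto_const isCont_tendsto_compose[OF _ divideR_at_top])
      qed
    qed (use gaussian_integrable[where 'a = "real^'n"] in simp_all)
  qed
  ultimately have "(LINT \<xi>|lborel. fourier f \<xi>) = (LINT x|lborel. f 0 * of_real (gaussian (x::real^'n)))"
    using tendsto_unique trivial_limit_at_top_linorder by blast
  then show ?thesis using gaussian_integral[where 'a = "real^'n"] by simp
qed

text \<open>Dilates of \<^term>\<open>K\<close> centred at \<^term>\<open>y\<close> are Schwartz functions and recover \<^term>\<open>F y\<close> in the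
  limit.\<close>

lemma schwartz_separates:
  fixes F K :: "real^'n::finite \<Rightarrow> complex"
  assumes K: "schwartz K" "(LINT x|lborel. K x) = 1"
    and F: "continuous_on UNIV F" "\<And>x. norm (F x) \<le> B"
    and zero: "\<And>f. schwartz f \<Longrightarrow> (LINT x|lborel. f x * F x) = 0"
  shows "F y = 0"
proof -
  have Fm [measurable]: "F \<in> borel_measurable borel"
    by (rule borel_measurable_continuous_onI[OF F(1)])
  note Km [measurable] = schwartz_measurable[OF K(1)]
  have "((\<lambda>t. LINT x|lborel. of_real (t ^ DIM(real^'n)) * K (t *\<^sub>R x) * F (y + x)) \<longlongrightarrow>
      (LINT x|lborel. K x) * F (y + 0)) at_top"
  proof (rule approximate_identity[OF schwartz_integrable[OF K(1)]])
    show "isCont (\<lambda>x. F (y + x)) 0"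
    proof (rule isCont_o2[where g = F])
      show "isCont F (y + 0)" using F(1) by (simp add: continuous_on_eq_continuous_at)
    qed (intro continuous_intros)
  qed (use F(2) in simp_all)
  moreover have "\<forall>\<^sub>F t in at_top. (LINT x|lborel. of_real (t ^ DIM(real^'n)) * K (t *\<^sub>R x) * F (y + x)) = 0"
    using eventually_gt_at_top[of "0::real"]
  proof eventually_elim
    case (elim t)
    have "schwartz (\<lambda>x. of_real (t ^ DIM(real^'n)) * K (t *\<^sub>R x + - t *\<^sub>R y))"
      using elim by - (rule schwartz_cmult[OF schwartz_affine[OF K(1)]], simp)
    from zero[OF this]
    have "(LINT x|lborel. of_real (t ^ DIM(real^'n)) * K (t *\<^sub>R (y + x) + - t *\<^sub>R y) * F (y + x)) = 0"
      using integral_translate[of "\<lambda>x. of_real (t ^ DIM(real^'n)) * K (t *\<^sub>R x + - t *\<^sub>R y) * F x" y] by simp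
    moreover have "t *\<^sub>R (y + x) + - t *\<^sub>R y = t *\<^sub>R x" for x
      by (simp add: scaleR_add_right)
    ultimately show ?case by (simp only:)
  qed
  ultimately have "((\<lambda>t::real. 0::complex) \<longlongrightarrow> F y) at_top"
    by (simp add: K(2) Lim_transform_eventually)
  then show ?thesis
    by (simp add: tendsto_const_iff)
qed

text \<open>Averages over large scales are asymptotically translation invariant: moving the translation
  to the kernel costs at most its Lipschitz constant times the length \<^term>\<open>t * norm y\<close> of the
  rescaled shift.\<close>

lemma average_translate:
  fixes K F :: "real^'n::finite \<Rightarrow> complex"
  assumes K: "schwartz K" and F [measurable]: "F \<in> borel_measurable borel"
    and B: "\<And>x. norm (F x) \<le> B"
  shows "((\<lambda>t. (LINT x|lborel. of_real (t ^ DIM(real^'n)) * K (t *\<^sub>R x) * F (x + y)) -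
      (LINT x|lborel. of_real (t ^ DIM(real^'n)) * K (t *\<^sub>R x) * F x)) \<longlongrightarrow> 0) (at_right 0)"
    (is "((\<lambda>t. ?av t) \<longlongrightarrow> 0) _")
proof -
  let ?w = "\<lambda>x::real^'n. inverse (weight x ^ DIM(real^'n))"
  note Ki = schwartz_integrable[OF K] and [measurable] = schwartz_measurable[OF K]
  obtain C where C: "\<And>x h. norm h \<le> 1 \<Longrightarrow> norm (K (x + h) - K x) \<le> C * ?w x * norm h"
    using schwartz_lipschitz_weight[OF K] by metis
  have B0: "0 \<le> B" using B[of 0] norm_ge_zero order_trans by blast
  have "\<forall>\<^sub>F t in at_right 0. t < inverse (1 + norm y)"
    by (rule eventually_at_right_real[THEN eventually_mono]) (auto simp: add_pos_nonneg)
  then have "\<forall>\<^sub>F t in at_right 0. norm (?av t) \<le> (LINT x|lborel. B * C * norm y * ?w x) * t"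
    using eventually_at_right_less[of "0::real"]
  proof eventually_elim
    case (elim t)
    have "norm y < 1 + norm y" by simp
    also have "1 + norm y < inverse t"
      using elim by (simp add: field_simps add_pos_nonneg)
    finally have h: "norm (- t *\<^sub>R y) \<le> 1" using elim by (simp add: field_simps)
    have "(LINT x|lborel. of_real (t ^ DIM(real^'n)) * K (t *\<^sub>R x) * F (x + y)) =
        (LINT x|lborel. K x * F (x /\<^sub>R t + y))"
      using integral_dilate[of "\<lambda>x. K x * F (x /\<^sub>R t + y)" t] elim by (simp add: mult.assoc)
    also have "\<dots> = (LINT x|lborel. K (x - t *\<^sub>R y) * F (x /\<^sub>R t))"
      using integral_translate[of "\<lambda>x. K (x - t *\<^sub>R y) * F (x /\<^sub>R t)" "t *\<^sub>R y"] elim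
      by (simp add: scaleR_add_right add.commute)
    finally have 1: "(LINT x|lborel. of_real (t ^ DIM(real^'n)) * K (t *\<^sub>R x) * F (x + y)) =
        (LINT x|lborel. K (x - t *\<^sub>R y) * F (x /\<^sub>R t))" .
    have 2: "(LINT x|lborel. of_real (t ^ DIM(real^'n)) * K (t *\<^sub>R x) * F x) = (LINT x|lborel. K x * F (x /\<^sub>R t))"
      using integral_dilate[of "\<lambda>x. K x * F (x /\<^sub>R t)" t] elim by (simp add: mult.assoc)
    have Ks: "integrable lborel (\<lambda>x. K (x - t *\<^sub>R y))"
      using integrable_translate[OF Ki, of "- t *\<^sub>R y"] by (simp add: add.commute)
    have i1: "integrable lborel (\<lambda>x. K (x - t *\<^sub>R y) * F (x /\<^sub>R t))"
      by (rule integrable_mult_bounded[OF Ks _ B]) measurable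
    have i2: "integrable lborel (\<lambda>x. K x * F (x /\<^sub>R t))"
      by (rule integrable_mult_bounded[OF Ki _ B]) measurable
    have "norm (LINT x|lborel. (K (x - t *\<^sub>R y) - K x) * F (x /\<^sub>R t)) \<le>
        (LINT x|lborel. B * C * norm y * ?w x * t)"
    proof (rule Bochner_Integration.integral_norm_bound_integral)
      show "integrable lborel (\<lambda>x. (K (x - t *\<^sub>R y) - K x) * F (x /\<^sub>R t))"
        using i1 i2 by (simp add: left_diff_distrib)
      show "integrable lborel (\<lambda>x. B * C * norm y * ?w x * t)"
        using integrable_inverse_weight[where 'a = "real^'n"] by simp
      fix x
      have "norm (K (x - t *\<^sub>R y) - K x) \<le> C * ?w x * (t * norm y)"
        using C[OF h, of x] elim by simp
      then have "B * norm (K (x - t *\<^sub>R y) - K x) \<le> B * (C * ?w x * (t * norm y))"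
        using B0 by (rule mult_left_mono)
      with norm_mult_right_le[OF B]
      show "norm ((K (x - t *\<^sub>R y) - K x) * F (x /\<^sub>R t)) \<le> B * C * norm y * ?w x * t"
        by (rule order_trans[THEN order_trans]) (simp_all add: mult_ac)
    qed
    then show ?case
      unfolding 1 2 using i1 i2 by (simp add: left_diff_distrib)
  qed
  moreover have "((\<lambda>t. (LINT x|lborel. B * C * norm y * ?w x) * t) \<longlongrightarrow> 0) (at_right 0)"
    by (intro tendsto_mult_right_zero tendsto_ident_at)
  ultimately show ?thesis by (rule Lim_null_comparison)
qed

section \<open>Twisted convolution\<close>

text \<open>The function \<^term>\<open>twisted_conv b (\<lambda>\<eta>. cnj (f \<eta>)) g\<close> is the symbol of
  $\lambda_\Theta(f)^* \lambda_\Theta(g)$, where \<^term>\<open>b\<close> is the phase in the multiplication rule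
  of the Weyl operators.\<close>

definition twisted_conv ::
  "('a::euclidean_space \<Rightarrow> 'a \<Rightarrow> real) \<Rightarrow> ('a \<Rightarrow> complex) \<Rightarrow> ('a \<Rightarrow> complex) \<Rightarrow> 'a \<Rightarrow> complex" where
  "twisted_conv b g k \<xi> = (LINT \<eta>|lborel. g \<eta> * k (\<eta> + \<xi>) * cis (- b \<eta> \<xi>))"

context
  fixes b :: "real^'n::finite \<Rightarrow> real^'n \<Rightarrow> real"
  assumes b: "bounded_bilinear b"
begin

interpretation b: bounded_bilinear b by (rule b)

lemma twisted_conv_integrand:
  assumes "schwartz g" "schwartz k"
  shows "integrable lborel (\<lambda>\<eta>. g \<eta> * k (\<eta> + \<xi>) * cis (- b \<eta> \<xi>))"
proof -
  have [measurable]: "g \<in> borel_measurable borel" "k \<in> borel_measurable borel"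
    using assms by (auto intro: schwartz_measurable)
  have [measurable]: "(\<lambda>\<eta>. cis (- b \<eta> \<xi>)) \<in> borel_measurable borel"
    by (intro borel_measurable_continuous_onI continuous_intros b.continuous_on)
  obtain C where C: "\<And>x. norm (k x) \<le> C" using rapid_bounded[OF schwartz_rapid[OF assms(2)]] by metis
  have "integrable lborel (\<lambda>\<eta>. g \<eta> * (k (\<eta> + \<xi>) * cis (- b \<eta> \<xi>)))"
    by (rule integrable_mult_bounded[where C = C])
      (use assms C in \<open>simp_all add: schwartz_integrable norm_mult\<close>)
  then show ?thesis by (simp add: mult.assoc)
qed

lemma twisted_conv_has_derivative:
  assumes g: "schwartz g" and k: "schwartz k"
  shows "(twisted_conv b g k has_derivative (\<lambda>v. LINT \<eta>|lborel.
    g \<eta> * ((\<Sum>j\<in>UNIV. of_real (v $ j) * partial j k (\<eta> + \<xi>)) * cis (- b \<eta> \<xi>) +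
      k (\<eta> + \<xi>) * (\<i> * of_real (- b \<eta> v) * cis (- b \<eta> \<xi>))))) (at \<xi>)"
proof -
  have [measurable]: "g \<in> borel_measurable borel" "k \<in> borel_measurable borel"
    using assms by (auto intro: schwartz_measurable)
  have [measurable]: "(\<lambda>\<eta>. cis (- b \<eta> y)) \<in> borel_measurable borel" for y
    by (intro borel_measurable_continuous_onI continuous_intros b.continuous_on)
  obtain C where C: "C \<ge> 0" "\<And>x. norm (k x) \<le> C" using rapid_bounded[OF schwartz_rapid[OF k]] by metis
  obtain D where D: "D \<ge> 0" "\<And>x h. norm h \<le> 1 \<Longrightarrow> norm (k (x + h) - k x) \<le> D * inverse (weight x ^ 0) * norm h"
    using schwartz_lipschitz_weight[OF k, where N = 0] by metis
  obtain M where M: "M \<ge> 0" "\<And>x y. norm (b x y) \<le> norm x * norm y * M"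
    using b.nonneg_bounded by blast
  define W where "W \<eta> = D * (weight \<eta> ^ 0 * norm (g \<eta>)) + C * M * (weight \<eta> ^ 1 * norm (g \<eta>))" for \<eta>
  show ?thesis
    unfolding twisted_conv_def[abs_def] mult.assoc
  proof (rule has_derivative_integral[where W = W])
    show "(\<lambda>\<eta>. g \<eta> * (k (\<eta> + y) * cis (- b \<eta> y))) \<in> borel_measurable lborel" for y by measurable
    show "integrable lborel (\<lambda>\<eta>. g \<eta> * (k (\<eta> + \<xi>) * cis (- b \<eta> \<xi>)))"
      using twisted_conv_integrand[OF g k, of \<xi>] by (simp add: mult.assoc)
    show "integrable lborel W"
      unfolding W_def
      by (intro Bochner_Integration.integrable_add Bochner_Integration.integrable_mult_right
          integrable_rapid(1) schwartz_rapid g schwartz_measurable)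
    fix \<eta>
    have 1: "((\<lambda>\<xi>. cis (- b \<eta> \<xi>)) has_derivative (\<lambda>v. \<i> * of_real (- b \<eta> v) * cis (- b \<eta> \<xi>))) (at \<xi>)"
      by (intro has_derivative_cis has_derivative_minus bounded_linear_imp_has_derivative b.bounded_linear_right)
    have "((\<lambda>\<xi>. \<eta> + \<xi>) has_derivative (\<lambda>v. v)) (at \<xi>)"
      by (auto intro!: derivative_eq_intros)
    from has_derivative_compose[OF this schwartz_has_derivative[OF k]]
    have 2: "((\<lambda>\<xi>. k (\<eta> + \<xi>)) has_derivative (\<lambda>v. \<Sum>j\<in>UNIV. of_real (v $ j) * partial j k (\<eta> + \<xi>))) (at \<xi>)" .
    show "((\<lambda>\<xi>. g \<eta> * (k (\<eta> + \<xi>) * cis (- b \<eta> \<xi>))) has_derivative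
      (\<lambda>v. g \<eta> * ((\<Sum>j\<in>UNIV. of_real (v $ j) * partial j k (\<eta> + \<xi>)) * cis (- b \<eta> \<xi>) +
          k (\<eta> + \<xi>) * (\<i> * (of_real (- b \<eta> v) * cis (- b \<eta> \<xi>)))))) (at \<xi>)"
      using has_derivative_mult_right[OF has_derivative_mult[OF 2 1], of "g \<eta>"]
      by (simp add: algebra_simps)
    fix h :: "real^'n" assume h: "norm h \<le> 1"
    have phase: "norm (cis (- b \<eta> (\<xi> + h)) - cis (- b \<eta> \<xi>)) \<le> M * weight \<eta> * norm h"
    proof -
      have "norm (cis (- b \<eta> (\<xi> + h)) - cis (- b \<eta> \<xi>)) \<le> \<bar>b \<eta> h\<bar>"
        using cis_diff_bound[of "- b \<eta> (\<xi> + h)" "- b \<eta> \<xi>"] by (simp add: b.add_right)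
      also have "\<dots> \<le> norm \<eta> * norm h * M" using M(2)[of \<eta> h] by simp
      also have "\<dots> \<le> weight \<eta> * norm h * M"
        using M(1) by (intro mult_right_mono norm_le_weight) auto
      finally show ?thesis by (simp add: mult_ac)
    qed
    have "k (\<eta> + (\<xi> + h)) * cis (- b \<eta> (\<xi> + h)) - k (\<eta> + \<xi>) * cis (- b \<eta> \<xi>) =
        (k (\<eta> + \<xi> + h) - k (\<eta> + \<xi>)) * cis (- b \<eta> (\<xi> + h)) + k (\<eta> + \<xi>) * (cis (- b \<eta> (\<xi> + h)) - cis (- b \<eta> \<xi>))"
      by (simp add: algebra_simps)
    then have "norm (k (\<eta> + (\<xi> + h)) * cis (- b \<eta> (\<xi> + h)) - k (\<eta> + \<xi>) * cis (- b \<eta> \<xi>)) \<le>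
        norm (k (\<eta> + \<xi> + h) - k (\<eta> + \<xi>)) + norm (k (\<eta> + \<xi>)) * norm (cis (- b \<eta> (\<xi> + h)) - cis (- b \<eta> \<xi>))"
      using norm_triangle_ineq by (metis norm_mult norm_cis mult.right_neutral)
    also have "\<dots> \<le> D * norm h + C * (M * weight \<eta> * norm h)"
      using D(2)[OF h, of "\<eta> + \<xi>"] by (intro add_mono mult_mono C phase) simp_all
    finally have "norm (g \<eta>) * norm (k (\<eta> + (\<xi> + h)) * cis (- b \<eta> (\<xi> + h)) - k (\<eta> + \<xi>) * cis (- b \<eta> \<xi>)) \<le>
        norm (g \<eta>) * (D * norm h + C * (M * weight \<eta> * norm h))"
      by (rule mult_left_mono) simp
    then show "norm (g \<eta> * (k (\<eta> + (\<xi> + h)) * cis (- b \<eta> (\<xi> + h))) - g \<eta> * (k (\<eta> + \<xi>) * cis (- b \<eta> \<xi>))) \<le> W \<eta> * norm h"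
      by (simp add: W_def right_diff_distrib[symmetric] norm_mult) (simp add: algebra_simps)
  qed
qed

text \<open>Peetre's inequality distributes the weight at \<^term>\<open>\<xi>\<close> over the two factors.\<close>

lemma twisted_conv_rapid:
  assumes g: "schwartz g" and k: "schwartz k"
  shows "rapid (twisted_conv b g k)"
  unfolding rapid_def
proof
  fix N
  obtain C where C: "\<And>x. weight x ^ N * norm (k x) \<le> C"
    using schwartz_rapid[OF k] rapid_def by metis
  have "weight \<xi> ^ N * norm (twisted_conv b g k \<xi>) \<le> (LINT \<eta>|lborel. 2 ^ N * C * (weight \<eta> ^ N * norm (g \<eta>)))" for \<xi>
  proof -
    have "norm (LINT \<eta>|lborel. weight \<xi> ^ N *\<^sub>R (g \<eta> * k (\<eta> + \<xi>) * cis (- b \<eta> \<xi>))) \<le>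
        (LINT \<eta>|lborel. 2 ^ N * C * (weight \<eta> ^ N * norm (g \<eta>)))"
    proof (rule Bochner_Integration.integral_norm_bound_integral)
      show "integrable lborel (\<lambda>\<eta>. weight \<xi> ^ N *\<^sub>R (g \<eta> * k (\<eta> + \<xi>) * cis (- b \<eta> \<xi>)))"
        using twisted_conv_integrand[OF g k] by simp
      show "integrable lborel (\<lambda>\<eta>. 2 ^ N * C * (weight \<eta> ^ N * norm (g \<eta>)))"
        using integrable_rapid(1)[OF schwartz_rapid[OF g] schwartz_measurable[OF g]] by simp
      fix \<eta>
      have "weight \<xi> ^ N * norm (k (\<eta> + \<xi>)) \<le> (2 ^ N * weight (\<xi> + \<eta>) ^ N * weight \<eta> ^ N) * norm (k (\<eta> + \<xi>))"
        by (intro mult_right_mono weight_peetre_power) simp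
      also have "\<dots> = (2 ^ N * weight \<eta> ^ N) * (weight (\<eta> + \<xi>) ^ N * norm (k (\<eta> + \<xi>)))"
        by (simp add: add.commute)
      also have "\<dots> \<le> (2 ^ N * weight \<eta> ^ N) * C"
        using weight_pos[of \<eta>] C by (intro mult_left_mono) auto
      finally have "norm (g \<eta>) * (weight \<xi> ^ N * norm (k (\<eta> + \<xi>))) \<le> norm (g \<eta>) * ((2 ^ N * weight \<eta> ^ N) * C)"
        by (rule mult_left_mono) simp
      then show "norm (weight \<xi> ^ N *\<^sub>R (g \<eta> * k (\<eta> + \<xi>) * cis (- b \<eta> \<xi>))) \<le> 2 ^ N * C * (weight \<eta> ^ N * norm (g \<eta>))"
        using weight_pos[of \<xi>] by (simp add: norm_mult mult_ac)
    qed
    then show ?thesis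
      using weight_pos[of \<xi>] by (simp add: twisted_conv_def norm_mult)
  qed
  then show "\<exists>C. \<forall>\<xi>. weight \<xi> ^ N * norm (twisted_conv b g k \<xi>) \<le> C" by blast
qed

text \<open>Differentiating the phase brings down a factor that is linear in \<^term>\<open>\<eta>\<close>; it is absorbed into
  \<^term>\<open>g\<close>.\<close>

lemma partial_twisted_conv:
  assumes g: "schwartz g" and k: "schwartz k"
  obtains g' where "schwartz g'"
    "partial i (twisted_conv b g k) = (\<lambda>\<xi>. twisted_conv b g (partial i k) \<xi> + twisted_conv b g' k \<xi>)"
proof
  define g' where "g' \<eta> = 0 * g \<eta> + (\<Sum>j\<in>UNIV. (- \<i> * b (axis j 1) (axis i 1)) * (of_real (\<eta> $ j) * g \<eta>))" for \<eta>
  show g': "schwartz g'"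
    unfolding g'_def
    by (rule schwartz_sum[OF _ schwartz_cmult[OF schwartz_coord[OF g]] schwartz_cmult[OF g]]) simp
  have bsum: "b \<eta> (axis i 1) = (\<Sum>j\<in>UNIV. \<eta> $ j * b (axis j 1) (axis i 1))" for \<eta>
  proof -
    have "b (\<Sum>j\<in>UNIV. \<eta> $ j *\<^sub>R axis j 1) (axis i 1) = (\<Sum>j\<in>UNIV. \<eta> $ j * b (axis j 1) (axis i 1))"
      by (simp add: b.sum_left b.scaleR_left)
    then show ?thesis unfolding axis_expansion .
  qed
  have g'_eq: "g' \<eta> = g \<eta> * (\<i> * of_real (- b \<eta> (axis i 1)))" for \<eta>
    by (subst bsum) (simp add: g'_def sum_distrib_left sum_negf mult_ac)

  show "partial i (twisted_conv b g k) = (\<lambda>\<xi>. twisted_conv b g (partial i k) \<xi> + twisted_conv b g' k \<xi>)"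
  proof
    fix \<xi>
    have "partial i (twisted_conv b g k) \<xi> = (LINT \<eta>|lborel. g \<eta> * (partial i k (\<eta> + \<xi>) * cis (- b \<eta> \<xi>) +
      k (\<eta> + \<xi>) * (\<i> * of_real (- b \<eta> (axis i 1)) * cis (- b \<eta> \<xi>))))"
      unfolding partial_eqI[OF twisted_conv_has_derivative[OF g k]] sum_axis ..
    also have "\<dots> = (LINT \<eta>|lborel. g \<eta> * partial i k (\<eta> + \<xi>) * cis (- b \<eta> \<xi>) + g' \<eta> * k (\<eta> + \<xi>) * cis (- b \<eta> \<xi>))"
      by (intro Bochner_Integration.integral_cong refl) (simp add: g'_eq algebra_simps)
    also have "\<dots> = twisted_conv b g (partial i k) \<xi> + twisted_conv b g' k \<xi>"
      unfolding twisted_conv_def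
      by (intro Bochner_Integration.integral_add twisted_conv_integrand g k g' schwartz_partial)
    finally show "partial i (twisted_conv b g k) \<xi> = twisted_conv b g (partial i k) \<xi> + twisted_conv b g' k \<xi>" .
  qed
qed

text \<open>A partial derivative of a twisted convolution is a sum of two twisted convolutions, so a class
  stable under partial derivatives has to contain sums.\<close>

inductive_set twisted_convs :: "(real^'n \<Rightarrow> complex) set" where
  base: "schwartz g \<Longrightarrow> schwartz k \<Longrightarrow> twisted_conv b g k \<in> twisted_convs"
| add: "f \<in> twisted_convs \<Longrightarrow> h \<in> twisted_convs \<Longrightarrow> (\<lambda>x. f x + h x) \<in> twisted_convs"

lemma schwartz_twisted_conv:
  assumes "schwartz g" "schwartz k"
  shows "schwartz (twisted_conv b g k)"
proof (rule schwartz_coinduct[of _ twisted_convs])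
  have *: "(\<forall>x. f differentiable (at x)) \<and> rapid f \<and> (\<forall>i. partial i f \<in> twisted_convs)"
    if "f \<in> twisted_convs" for f
    using that
  proof induction
    case (base g k)
    have "partial i (twisted_conv b g k) \<in> twisted_convs" for i
    proof -
      obtain g' where "schwartz g'" "partial i (twisted_conv b g k) = (\<lambda>\<xi>. twisted_conv b g (partial i k) \<xi> + twisted_conv b g' k \<xi>)"
        using partial_twisted_conv[OF base] .
      then show ?thesis
        using base by (simp add: twisted_convs.add twisted_convs.base schwartz_partial)
    qed
    then show ?case
      using twisted_conv_rapid[OF base] twisted_conv_has_derivative[OF base] differentiable_def by blast
  next
    case (add f g)
    then show ?case by (simp add: partial_add rapid_add twisted_convs.add)
  qed
  fix f x i
  assume "f \<in> twisted_convs"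
  then show "f differentiable (at x)" "rapid f" "partial i f \<in> twisted_convs"
    using * by auto
qed (rule twisted_convs.base[OF assms])

end

section \<open>Weyl operators\<close>

lemma bounded_bilinear_add:
  assumes "bounded_bilinear f" "bounded_bilinear g"
  shows "bounded_bilinear (\<lambda>x y. f x y + g x y)"
proof -
  interpret f: bounded_bilinear f by fact
  interpret g: bounded_bilinear g by fact
  show ?thesis
  proof
    obtain K L where "\<And>x y. norm (f x y) \<le> norm x * norm y * K" "\<And>x y. norm (g x y) \<le> norm x * norm y * L"
      using f.bounded g.bounded by blast
    then have "norm (f x y + g x y) \<le> norm x * norm y * (K + L)" for x y
      by (metis norm_triangle_le add_mono distrib_left)
    then show "\<exists>K. \<forall>x y. norm (f x y + g x y) \<le> norm x * norm y * K" by blast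
  qed (simp_all add: f.add_left f.add_right g.add_left g.add_right f.scaleR_left f.scaleR_right
      g.scaleR_left g.scaleR_right scaleR_add_right)
qed

text \<open>Moving the factors past each other produces a phase that is bilinear in the two parameters.\<close>

lemma weyl_op_mult:
  assumes "weyl_system \<Theta> u"
  obtains b where "bounded_bilinear b"
    "\<And>\<xi> \<eta> h. weyl_op u \<xi> (weyl_op u \<eta> h) = cis (b \<xi> \<eta>) *\<^sub>C weyl_op u (\<xi> + \<eta>) h"
proof -
  note w = assms[unfolded weyl_system_def]
  have ub: "u j s \<in> bops" for j s using w unitaryD(1) by blast
  let ?W = "\<lambda>js \<xi>. foldr (\<lambda>j A. u j (\<xi> $ j) o\<^sub>L A) js id_blinfun"
  have sc: "A (c *\<^sub>C x) = c *\<^sub>C A x" if "A \<in> bops" for A :: "'b op" and c x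
    using that by (rule bopsD)
  have past: "\<exists>\<beta>. bounded_linear \<beta> \<and> (\<forall>\<xi> t h. ?W js \<xi> (u j t h) = cis (t * \<beta> \<xi>) *\<^sub>C u j t (?W js \<xi> h))" for js j
  proof (induction js)
    case Nil
    show ?case by (auto intro!: exI[of _ "\<lambda>_. 0"])
  next
    case (Cons k js)
    then obtain \<beta> where \<beta>: "bounded_linear \<beta>" "\<And>\<xi> t h. ?W js \<xi> (u j t h) = cis (t * \<beta> \<xi>) *\<^sub>C u j t (?W js \<xi> h)"
      by blast
    have comm: "u k s (u j t h) = cis (2 * pi * \<Theta> $ k $ j * s * t) *\<^sub>C u j t (u k s h)" for s t h
      using w by blast
    show ?case
    proof (intro exI conjI allI)
      show "bounded_linear (\<lambda>\<xi>. \<beta> \<xi> + 2 * pi * \<Theta> $ k $ j * \<xi> $ k)"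
        by (intro bounded_linear_add \<beta>(1) bounded_linear_compose[OF bounded_linear_mult_right bounded_linear_vec_nth])
      fix \<xi> t h
      show "?W (k # js) \<xi> (u j t h) = cis (t * (\<beta> \<xi> + 2 * pi * \<Theta> $ k $ j * \<xi> $ k)) *\<^sub>C u j t (?W (k # js) \<xi> h)"
        by (simp add: \<beta>(2) sc[OF ub] comm scaleC_scaleC cis_mult algebra_simps)
    qed
  qed
  have "\<exists>b. bounded_bilinear b \<and> (\<forall>\<xi> \<eta> h. ?W js \<xi> (?W js \<eta> h) = cis (b \<xi> \<eta>) *\<^sub>C ?W js (\<xi> + \<eta>) h)" for js
  proof (induction js)
    case Nil
    show ?case
      using bounded_bilinear.comp[OF bounded_bilinear_mult bounded_linear_zero bounded_linear_zero]
      by (auto intro!: exI[of _ "\<lambda>_ _. 0"])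
  next
    case (Cons j js)
    then obtain b where b: "bounded_bilinear b" "\<And>\<xi> \<eta> h. ?W js \<xi> (?W js \<eta> h) = cis (b \<xi> \<eta>) *\<^sub>C ?W js (\<xi> + \<eta>) h"
      by blast
    obtain \<beta> where \<beta>: "bounded_linear \<beta>" "\<And>\<xi> t h. ?W js \<xi> (u j t h) = cis (t * \<beta> \<xi>) *\<^sub>C u j t (?W js \<xi> h)"
      using past by blast
    have group: "u j s (u j t h) = u j (s + t) h" for s t h
      using w by (metis blinfun_apply_blinfun_compose)
    have bil: "bounded_bilinear (\<lambda>\<xi> \<eta>. b \<xi> \<eta> + \<beta> \<xi> * \<eta> $ j)"
      by (intro bounded_bilinear_add b(1) bounded_bilinear.comp[OF bounded_bilinear_mult \<beta>(1) bounded_linear_vec_nth])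
    show ?case
    proof (intro exI conjI allI)
      show "bounded_bilinear (\<lambda>\<xi> \<eta>. b \<xi> \<eta> + \<beta> \<xi> * \<eta> $ j)" by (rule bil)
      fix \<xi> \<eta> h
      show "?W (j # js) \<xi> (?W (j # js) \<eta> h) = cis (b \<xi> \<eta> + \<beta> \<xi> * \<eta> $ j) *\<^sub>C ?W (j # js) (\<xi> + \<eta>) h"
        by (simp add: \<beta>(2) sc[OF ub] b(2) group scaleC_scaleC cis_mult algebra_simps)
    qed
  qed
  then obtain b where "bounded_bilinear b"
    "\<And>\<xi> \<eta> h. weyl_op u \<xi> (weyl_op u \<eta> h) = cis (b \<xi> \<eta>) *\<^sub>C weyl_op u (\<xi> + \<eta>) h"
    unfolding weyl_op_def by blast
  then show thesis by (rule that)
qed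

lemma unitary_id: "unitary id_blinfun"
  by (rule unitaryI(1)[of _ id_blinfun]) (simp_all add: bops_id)

lemma unitary_compose:
  fixes U V :: "'h::complex_hilbert op"
  assumes "unitary U" "unitary V"
  shows "unitary (U o\<^sub>L V)"
  by (rule unitaryI(1)[of _ "adj V o\<^sub>L adj U"])
    (simp_all add: bops_compose adj_bops unitaryD[OF assms(1)] unitaryD[OF assms(2)])

lemma weyl_op_unitary:
  assumes "weyl_system \<Theta> u"
  shows "unitary (weyl_op u \<xi>)"
proof -
  have "unitary (foldr (\<lambda>j A. u j (\<xi> $ j) o\<^sub>L A) js id_blinfun)" for js
    by (induction js) (use assms in \<open>simp_all add: unitary_id unitary_compose weyl_system_def\<close>)
  then show ?thesis by (simp add: weyl_op_def)
qed

text \<open>Strong continuity survives products of contractions: each new factor is applied to a vector that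
  itself varies, and the error of this is controlled by isometry.\<close>

lemma weyl_op_continuous:
  fixes u :: "'n::{finite,linorder} \<Rightarrow> real \<Rightarrow> 'h::complex_hilbert op"
  assumes w: "weyl_system \<Theta> u"
  shows "continuous_on UNIV (\<lambda>\<xi>. weyl_op u \<xi> h)"
proof -
  have "continuous_on UNIV (\<lambda>\<xi>. foldr (\<lambda>j A. u j (\<xi> $ j) o\<^sub>L A) js id_blinfun h)" for js
  proof (induction js)
    case (Cons j js)
    let ?v = "\<lambda>\<xi>. foldr (\<lambda>j A. u j (\<xi> $ j) o\<^sub>L A) js id_blinfun h"
    have un: "unitary (u j s)" for s using w by (simp add: weyl_system_def)
    have "isCont (\<lambda>\<xi>. u j (\<xi> $ j) (?v \<xi>)) \<xi>" for \<xi>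
    proof -
      have v: "(?v \<longlongrightarrow> ?v \<xi>) (at \<xi>)"
        using Cons by (simp add: continuous_on_eq_continuous_at isCont_def)
      have "continuous_on UNIV (\<lambda>s. u j s (?v \<xi>))" using w by (simp add: weyl_system_def)
      then have "isCont (\<lambda>s. u j s (?v \<xi>)) (\<xi> $ j)" by (simp add: continuous_on_eq_continuous_at)
      moreover have "((\<lambda>\<eta>. \<eta> $ j) \<longlongrightarrow> \<xi> $ j) (at \<xi>)" by (intro tendsto_intros)
      ultimately have c: "((\<lambda>\<eta>. u j (\<eta> $ j) (?v \<xi>)) \<longlongrightarrow> u j (\<xi> $ j) (?v \<xi>)) (at \<xi>)"
        by (rule isCont_tendsto_compose)
      have "((\<lambda>\<eta>. u j (\<eta> $ j) (?v \<eta> - ?v \<xi>)) \<longlongrightarrow> 0) (at \<xi>)"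
      proof (rule tendsto_norm_zero_cancel)
        have "((\<lambda>\<eta>. norm (?v \<eta> - ?v \<xi>)) \<longlongrightarrow> 0) (at \<xi>)"
          using v by (simp add: LIM_zero tendsto_norm_zero)
        then show "((\<lambda>\<eta>. norm (u j (\<eta> $ j) (?v \<eta> - ?v \<xi>))) \<longlongrightarrow> 0) (at \<xi>)"
          by (simp add: unitaryD(5)[OF un])
      qed
      from tendsto_add[OF this c] show ?thesis
        by (simp add: isCont_def blinfun.diff_right)
    qed
    then show ?case by (simp add: continuous_on_eq_continuous_at)
  qed simp
  then show ?thesis by (simp add: weyl_op_def)
qed

lemma weak_integral_exists:
  fixes A :: "'a::euclidean_space \<Rightarrow> 'h::complex_hilbert op"
  assumes m: "integrable lborel m"
    and A: "\<And>\<xi>. A \<xi> \<in> bops" "\<And>h k. continuous_on UNIV (\<lambda>\<xi>. cinner h (A \<xi> k))"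
    and C: "\<And>\<xi>. norm (A \<xi>) \<le> C"
  obtains X :: "'h op" where "X \<in> bops" "\<And>h k. cinner h (X k) = (LINT \<xi>|lborel. m \<xi> * cinner h (A \<xi> k))"
proof -
  have bnd: "norm (cinner h (A \<xi> k)) \<le> C * norm h * norm k" for \<xi> h k
    by (rule order_trans[OF norm_cinner_op_le]) (intro mult_right_mono C norm_ge_zero)
  have int: "integrable lborel (\<lambda>\<xi>. m \<xi> * cinner h (A \<xi> k))" for h k
    by (rule integrable_mult_bounded[OF m _ bnd])
      (simp add: borel_measurable_continuous_onI A(2))
  show thesis
  proof (rule form_operator_exists[where B = "\<lambda>h k. LINT \<xi>|lborel. m \<xi> * cinner h (A \<xi> k)"
        and C = "(LINT \<xi>|lborel. norm (m \<xi>)) * C"])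
    fix h h' k k' :: 'h and c :: complex
    show "(LINT \<xi>|lborel. m \<xi> * cinner (h + h') (A \<xi> k)) =
        (LINT \<xi>|lborel. m \<xi> * cinner h (A \<xi> k)) + (LINT \<xi>|lborel. m \<xi> * cinner h' (A \<xi> k))"
      using int by (simp add: cinner_add_left distrib_left)
    show "(LINT \<xi>|lborel. m \<xi> * cinner h (A \<xi> (k + k'))) =
        (LINT \<xi>|lborel. m \<xi> * cinner h (A \<xi> k)) + (LINT \<xi>|lborel. m \<xi> * cinner h (A \<xi> k'))"
      using int by (simp add: blinfun.add_right cinner_add_right distrib_left)
    show "(LINT \<xi>|lborel. m \<xi> * cinner (c *\<^sub>C h) (A \<xi> k)) = cnj c * (LINT \<xi>|lborel. m \<xi> * cinner h (A \<xi> k))"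
      by (simp add: cinner_scaleC_left mult.left_commute)
    show "(LINT \<xi>|lborel. m \<xi> * cinner h (A \<xi> (c *\<^sub>C k))) = c * (LINT \<xi>|lborel. m \<xi> * cinner h (A \<xi> k))"
      by (simp add: bopsD[OF A(1)] cinner_scaleC_right mult.left_commute)
    have "norm (LINT \<xi>|lborel. m \<xi> * cinner h (A \<xi> k)) \<le> (LINT \<xi>|lborel. norm (m \<xi>) * (C * norm h * norm k))"
    proof (rule Bochner_Integration.integral_norm_bound_integral[OF int])
      show "integrable lborel (\<lambda>\<xi>. norm (m \<xi>) * (C * norm h * norm k))" using m by simp
      show "norm (m \<xi> * cinner h (A \<xi> k)) \<le> norm (m \<xi>) * (C * norm h * norm k)" for \<xi>
        unfolding norm_mult by (intro mult_left_mono bnd) simp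
    qed
    then show "norm (LINT \<xi>|lborel. m \<xi> * cinner h (A \<xi> k)) \<le> (LINT \<xi>|lborel. norm (m \<xi>)) * C * norm h * norm k"
      by (simp add: mult.assoc)
  qed (use that in blast)
qed

text \<open>The Weyl operators form a strongly continuous projective unitary representation whose phase is
  bilinear. The Schwartz function \<^term>\<open>K\<close> of integral one serves to build approximate identities.\<close>

locale weyl_representation =
  fixes u :: "'n::{finite,linorder} \<Rightarrow> real \<Rightarrow> 'h::complex_hilbert op"
    and b :: "(real,'n) vec \<Rightarrow> (real,'n) vec \<Rightarrow> real" and K :: "(real,'n) vec \<Rightarrow> complex"
  assumes weyl_unitary: "unitary (weyl_op u \<xi>)"
    and weyl_continuous: "continuous_on UNIV (\<lambda>\<xi>. weyl_op u \<xi> h)"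
    and bilinear_phase: "bounded_bilinear b"
    and weyl_mult: "weyl_op u \<xi> (weyl_op u \<eta> h) = cis (b \<xi> \<eta>) *\<^sub>C weyl_op u (\<xi> + \<eta>) h"
    and K: "schwartz K" "(LINT x|lborel. K x) = 1"
begin

sublocale b: bounded_bilinear b by (rule bilinear_phase)

abbreviation W :: "(real,'n) vec \<Rightarrow> 'h op" where "W \<equiv> weyl_op u"

lemmas W_bops = unitaryD(1)[OF weyl_unitary]
lemmas W_simps [simp] = unitaryD(2-6)[OF weyl_unitary]

lemma weyl_zero [simp]: "W 0 h = h"
proof -
  have "W 0 (W 0 h) = W 0 h" using weyl_mult[of 0 0 h] by (simp add: b.zero_left)
  then have "adj (W 0) (W 0 (W 0 h)) = adj (W 0) (W 0 h)" by simp
  then show ?thesis by simp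
qed

lemma adj_weyl: "adj (W \<xi>) h = cis (b \<xi> \<xi>) *\<^sub>C W (- \<xi>) h"
proof -
  have "W \<xi> (cis (b \<xi> \<xi>) *\<^sub>C W (- \<xi>) h) = h"
    by (simp add: bopsD[OF W_bops] weyl_mult scaleC_scaleC cis_mult b.minus_right)
  then have "adj (W \<xi>) (W \<xi> (cis (b \<xi> \<xi>) *\<^sub>C W (- \<xi>) h)) = adj (W \<xi>) h" by simp
  then show ?thesis by simp
qed

lemma adj_weyl_continuous: "continuous_on UNIV (\<lambda>\<xi>. adj (W \<xi>) h)"
proof -
  have "continuous_on UNIV (\<lambda>\<xi>. W (- \<xi>) h)"
    by (rule continuous_on_compose2[OF weyl_continuous]) (auto intro: continuous_intros)
  then show ?thesis
    unfolding adj_weyl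
    by (rule scaleC.continuous_on[rotated]) (intro continuous_intros b.continuous_on)
qed

lemma norm_weyl_le: "norm (W \<xi>) \<le> 1"
  by (rule norm_blinfun_bound) simp_all

lemma cinner_weyl_continuous: "continuous_on UNIV (\<lambda>\<xi>. cinner h (W \<xi> k))"
  by (intro cinner.continuous_on continuous_intros weyl_continuous)

lemma cinner_weyl_le: "norm (cinner h (W \<xi> k)) \<le> norm h * norm k"
  using norm_cinner_le[of h "W \<xi> k"] by simp

lemma weyl_int:
  assumes "integrable lborel f"
  shows "weyl_int u f \<in> bops"
    and "cinner h (weyl_int u f k) = (LINT \<xi>|lborel. f \<xi> * cinner h (W \<xi> k))"
proof -
  obtain A where A: "A \<in> bops" "\<And>h k. cinner h (A k) = (LINT \<xi>|lborel. f \<xi> * cinner h (W \<xi> k))"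
    using weak_integral_exists[OF assms W_bops cinner_weyl_continuous norm_weyl_le] by blast
  have "weyl_int u f = A"
    unfolding weyl_int_def
  proof (rule the_equality)
    fix B :: "'h op"
    assume "B \<in> bops \<and> (\<forall>h k. cinner h (B k) = (LINT \<xi>|lborel. f \<xi> * cinner h (W \<xi> k)))"
    then show "B = A" by (intro op_ext_cinner) (simp add: A)
  qed (use A in blast)
  then show "weyl_int u f \<in> bops" "cinner h (weyl_int u f k) = (LINT \<xi>|lborel. f \<xi> * cinner h (W \<xi> k))"
    using A by simp_all
qed

lemmas weyl_int_schwartz = weyl_int[OF schwartz_integrable]

text \<open>An identity that is linear in $\lambda_\Theta(f)$ and holds for all Schwartz \<^term>\<open>f\<close> passes
  to the Weyl operators themselves.\<close>

lemma weyl_separates: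
  assumes F: "continuous_on UNIV F" "\<And>\<xi>. norm (F \<xi>) \<le> B"
    and "\<And>f. schwartz f \<Longrightarrow> (LINT \<xi>|lborel. f \<xi> * F \<xi>) = 0"
  shows "F (\<xi>::(real,'n) vec) = 0"
  using schwartz_separates[OF K F assms(3)] .

lemma weyl_int_separates:
  assumes "\<And>f. schwartz f \<Longrightarrow> cinner h (weyl_int u f k) = 0"
  shows "cinner h (W \<xi> k) = 0"
  by (rule weyl_separates[OF cinner_weyl_continuous cinner_weyl_le])
    (simp add: weyl_int_schwartz(2)[symmetric] assms)

subsection \<open>The von Neumann algebra\<close>

text \<open>Each $\lambda_\Theta(f)$ is a weak integral of Weyl operators. Conversely the Weyl operators are
  recovered from the $\lambda_\Theta(f)$ by testing against Schwartz functions.\<close>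

lemma commutant_E_alg: "commutant (E_alg u) = commutant (range W)"
proof
  show "commutant (E_alg u) \<subseteq> commutant (range W)"
  proof
    fix A assume A: "A \<in> commutant (E_alg u)"
    then have Ab: "A \<in> bops" by (rule commutant_bops)
    show "A \<in> commutant (range W)"
    proof (rule commutantI[OF Ab], elim rangeE, hypsubst)
      fix \<xi> k
      show "A (W \<xi> k) = W \<xi> (A k)"
      proof (rule cinner_ext)
        fix h
        let ?F = "\<lambda>\<xi>. cinner h (A (W \<xi> k)) - cinner h (W \<xi> (A k))"
        have adjA: "cinner h (A x) = cinner (adj A h) x" for x
          by (simp add: cinner_adj_left[OF Ab])
        have "?F \<xi> = 0"
        proof (rule weyl_separates[where F = ?F])
          show "continuous_on UNIV ?F"
            unfolding adjA by (intro continuous_on_diff cinner_weyl_continuous)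
          show "norm (?F \<xi>) \<le> norm (adj A h) * norm k + norm h * norm (A k)" for \<xi>
            unfolding adjA by (rule order_trans[OF norm_triangle_ineq4 add_mono[OF cinner_weyl_le cinner_weyl_le]])
          fix f :: "(real,'n) vec \<Rightarrow> complex" assume f: "schwartz f"
          have "weyl_int u f \<in> E_alg u"
            unfolding E_alg_def using schwartz_integrable[OF f] closure_subset by fast
          then have "A (weyl_int u f k) = weyl_int u f (A k)" by (rule commutantD[OF A])
          then have "cinner (adj A h) (weyl_int u f k) - cinner h (weyl_int u f (A k)) = 0"
            by (simp add: adjA[symmetric])
          moreover have "integrable lborel (\<lambda>\<xi>. f \<xi> * cinner h (W \<xi> k))" for h k
            by (rule integrable_mult_bounded[OF schwartz_integrable[OF f] _ cinner_weyl_le])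
              (simp add: borel_measurable_continuous_onI cinner_weyl_continuous)
          ultimately show "(LINT \<xi>|lborel. f \<xi> * ?F \<xi>) = 0"
            by (simp add: adjA weyl_int_schwartz[OF f] right_diff_distrib)
        qed
        then show "cinner h (A (W \<xi> k)) = cinner h (W \<xi> (A k))" by simp
      qed
    qed
  qed
  show "commutant (range W) \<subseteq> commutant (E_alg u)"
  proof
    fix A assume A: "A \<in> commutant (range W)"
    then have Ab: "A \<in> bops" by (rule commutant_bops)
    have "A o\<^sub>L B = B o\<^sub>L A" if "B \<in> E_alg u" for B
    proof -
      have "weyl_int u ` {f. integrable lborel f} \<subseteq> {B. A o\<^sub>L B = B o\<^sub>L A}"
      proof (clarify, rule op_ext_cinner)
        fix f :: "(real,'n) vec \<Rightarrow> complex" and h k assume f: "integrable lborel f"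
        have "cinner h ((A o\<^sub>L weyl_int u f) k) = cinner (adj A h) (weyl_int u f k)"
          by (simp add: cinner_adj_left[OF Ab])
        also have "\<dots> = cinner h ((weyl_int u f o\<^sub>L A) k)"
          by (simp add: weyl_int[OF f] cinner_adj_left[OF Ab] commutantD[OF A])
        finally show "cinner h ((A o\<^sub>L weyl_int u f) k) = cinner h ((weyl_int u f o\<^sub>L A) k)" .
      qed
      moreover have "closed {B. A o\<^sub>L B = B o\<^sub>L A}"
        by (intro closed_Collect_eq bounded_bilinear.continuous_on[OF bounded_bilinear_blinfun_compose]
            continuous_intros)
      ultimately show ?thesis
        using that closure_minimal unfolding E_alg_def by blast
    qed
    then show "A \<in> commutant (E_alg u)" using Ab by (simp add: commutant_def)
  qed
qed

abbreviation M :: "'h op set" where "M \<equiv> R_alg u"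

lemma M_eq: "M = commutant (commutant (range W))"
  by (simp add: R_alg_def commutant_E_alg)

lemma commutant_M: "commutant M = commutant (range W)"
  unfolding M_eq by (rule commutant_triple) (auto simp: W_bops)

lemma M_bops: "x \<in> M \<Longrightarrow> x \<in> bops"
  unfolding M_eq by (rule commutant_bops)

lemma M_algebra:
  assumes "x \<in> M" "y \<in> M"
  shows "x o\<^sub>L y \<in> M" "x + y \<in> M" "x - y \<in> M"
  using assms unfolding M_eq by (simp_all add: commutant_algebra)

lemma M_scaleR: "x \<in> M \<Longrightarrow> r *\<^sub>R x \<in> M"
  unfolding M_eq by (rule commutant_scaleR)

lemma weyl_in_M: "W \<xi> \<in> M"
  unfolding M_eq using subset_double_commutant[of "range W"] W_bops by blast

lemma weyl_int_in_M:
  assumes "integrable lborel f"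
  shows "weyl_int u f \<in> M"
  unfolding R_alg_def
proof (rule commutantI[OF weyl_int(1)[OF assms]])
  fix B h assume "B \<in> commutant (E_alg u)"
  moreover have "weyl_int u f \<in> E_alg u"
    unfolding E_alg_def using assms closure_subset by fast
  ultimately show "weyl_int u f (B h) = B (weyl_int u f h)"
    by (rule commutantD[symmetric])
qed

lemma commutant_range_adj: "A \<in> commutant (range W) \<Longrightarrow> A (adj (W \<xi>) h) = adj (W \<xi>) (A h)"
proof -
  assume A: "A \<in> commutant (range W)"
  have "W \<xi> (A (adj (W \<xi>) h)) = A (W \<xi> (adj (W \<xi>) h))"
    using commutantD[OF A, of "W \<xi>" "adj (W \<xi>) h"] by simp
  then have "adj (W \<xi>) (W \<xi> (A (adj (W \<xi>) h))) = adj (W \<xi>) (A h)" by simp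
  then show ?thesis by simp
qed

text \<open>The commutant of a set of unitaries is closed under adjoints, although the set itself need
  not be.\<close>

lemma M_adj: "x \<in> M \<Longrightarrow> adj x \<in> M"
  unfolding M_eq
proof (rule commutant_adj, rule conjI)
  fix A assume A: "A \<in> commutant (range W)"
  then show Ab: "A \<in> bops" by (rule commutant_bops)
  show "adj A \<in> commutant (range W)"
  proof (rule commutantI[OF adj_bops[OF Ab]], elim rangeE, hypsubst)
    fix \<xi> k
    show "adj A (W \<xi> k) = W \<xi> (adj A k)"
    proof (rule cinner_ext)
      fix h
      have "cinner h (adj A (W \<xi> k)) = cinner (adj (W \<xi>) (A h)) k"
        by (simp add: cinner_adj_right[OF Ab] cinner_adj_left[OF W_bops])
      also have "\<dots> = cinner h (W \<xi> (adj A k))"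
        by (simp add: commutant_range_adj[OF A, symmetric] cinner_adj_right[OF Ab, symmetric]
            cinner_adj_left[OF W_bops])
      finally show "cinner h (adj A (W \<xi> k)) = cinner h (W \<xi> (adj A k))" .
    qed
  qed
qed

lemma scalar_in_M:
  obtains A where "A \<in> M" "\<And>k. A k = c *\<^sub>C k"
proof -
  obtain A :: "'h op" where A: "A \<in> bops" "\<And>k. A k = c *\<^sub>C k"
    using scalar_operator_exists[of c] by blast
  have "A \<in> M"
    unfolding M_eq by (rule commutantI[OF A(1)]) (simp add: A(2) bopsD[OF commutant_bops])
  then show thesis using A(2) that by blast
qed

text \<open>After the translation $\zeta = \eta + \xi$ the phase factors out of the inner product, and
  Fubini's theorem gives the symbol of the product.\<close>

lemma adj_weyl_int_mult:
  assumes f: "schwartz f" and g: "schwartz g"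
  shows "adj (weyl_int u f) o\<^sub>L weyl_int u g = weyl_int u (twisted_conv b (\<lambda>\<eta>. cnj (f \<eta>)) g)"
proof (rule op_ext_cinner)
  fix h k
  let ?A = "weyl_int u f" and ?B = "weyl_int u g"
  let ?d = "DIM((real,'n) vec)"
  obtain C where C: "C \<ge> 0" "\<And>x. norm (g x) \<le> C * inverse (weight x ^ ?d)"
    using rapidE[OF schwartz_rapid[OF g]] by metis
  let ?H = "\<lambda>\<eta> \<xi>. (cnj (f \<eta>) * g (\<eta> + \<xi>) * cis (- b \<eta> \<xi>)) * cinner h (W \<xi> k)"
  note fi = schwartz_integrable[OF f] and gi = schwartz_integrable[OF g]
  have cf: "schwartz (\<lambda>\<eta>. cnj (f \<eta>))" by (rule schwartz_cnj[OF f])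
  have [measurable]: "(\<lambda>\<xi>. cinner h (W \<xi> k)) \<in> borel_measurable borel" for h k
    by (rule borel_measurable_continuous_onI[OF cinner_weyl_continuous])
  note [measurable] = schwartz_measurable[OF g]
  have "cinner h ((adj ?A o\<^sub>L ?B) k) = cnj (cinner (?B k) (?A h))"
    by (simp add: cinner_adj_right[OF weyl_int(1)[OF fi], symmetric] cinner_commute[symmetric])
  also have "\<dots> = (LINT \<eta>|lborel. cnj (f \<eta>) * cinner (W \<eta> h) (?B k))"
    unfolding weyl_int(2)[OF fi] Bochner_Integration.integral_cnj[symmetric] complex_cnj_mult cinner_commute[symmetric] ..
  also have "\<dots> = (LINT \<eta>|lborel. (LINT \<xi>|lborel. ?H \<eta> \<xi>))"
  proof (intro Bochner_Integration.integral_cong refl)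
    fix \<eta>
    have "cinner (W \<eta> h) (?B k) = (LINT \<zeta>|lborel. g \<zeta> * cinner (W \<eta> h) (W \<zeta> k))"
      by (rule weyl_int(2)[OF gi])
    also have "\<dots> = (LINT \<xi>|lborel. g (\<eta> + \<xi>) * cinner (W \<eta> h) (W (\<eta> + \<xi>) k))"
      by (rule integral_translate[symmetric]) measurable
    also have "\<dots> = (LINT \<xi>|lborel. g (\<eta> + \<xi>) * cis (- b \<eta> \<xi>) * cinner h (W \<xi> k))"
    proof (intro Bochner_Integration.integral_cong refl)
      fix \<xi>
      have "W (\<eta> + \<xi>) k = cis (- b \<eta> \<xi>) *\<^sub>C W \<eta> (W \<xi> k)"
        by (simp add: weyl_mult scaleC_scaleC cis_mult)
      then show "g (\<eta> + \<xi>) * cinner (W \<eta> h) (W (\<eta> + \<xi>) k) = g (\<eta> + \<xi>) * cis (- b \<eta> \<xi>) * cinner h (W \<xi> k)"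
        by (simp add: cinner_scaleC_right)
    qed
    finally have "cnj (f \<eta>) * cinner (W \<eta> h) (?B k) =
        (LINT \<xi>|lborel. cnj (f \<eta>) * (g (\<eta> + \<xi>) * cis (- b \<eta> \<xi>) * cinner h (W \<xi> k)))"
      by simp
    then show "cnj (f \<eta>) * cinner (W \<eta> h) (?B k) = (LINT \<xi>|lborel. ?H \<eta> \<xi>)"
      by (simp only: mult.assoc)
  qed
  also have "\<dots> = (LINT \<xi>|lborel. (LINT \<eta>|lborel. ?H \<eta> \<xi>))"
  proof (rule Fubini_continuous[symmetric])
    show "integrable lborel (\<lambda>\<eta>. weight \<eta> ^ ?d * norm (f \<eta>))"
      by (rule integrable_rapid(1)[OF schwartz_rapid[OF f] schwartz_measurable[OF f]])
    show "integrable lborel (\<lambda>\<xi>::(real,'n) vec. C * 2 ^ ?d * norm h * norm k * inverse (weight \<xi> ^ ?d))"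
      using integrable_inverse_weight[where 'a = "(real,'n) vec"] by simp
    show "continuous_on UNIV (\<lambda>p. ?H (fst p) (snd p))"
    proof (intro continuous_on_mult)
      show "continuous_on UNIV (\<lambda>p::((real,'n) vec) \<times> ((real,'n) vec). cnj (f (fst p)))"
        by (intro continuous_on_cnj continuous_on_compose2[OF schwartz_continuous[OF f, of UNIV]] continuous_intros) auto
      show "continuous_on UNIV (\<lambda>p::((real,'n) vec) \<times> ((real,'n) vec). g (fst p + snd p))"
        by (intro continuous_on_compose2[OF schwartz_continuous[OF g, of UNIV]] continuous_intros) auto
      show "continuous_on UNIV (\<lambda>p::((real,'n) vec) \<times> ((real,'n) vec). cis (- b (fst p) (snd p)))"
        by (intro continuous_intros b.continuous_on)
      show "continuous_on UNIV (\<lambda>p::((real,'n) vec) \<times> ((real,'n) vec). cinner h (W (snd p) k))"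
        by (intro continuous_on_compose2[OF cinner_weyl_continuous] continuous_intros) auto
    qed
    fix \<eta> \<xi> :: "(real,'n) vec"
    \<comment> \<open>Peetre's inequality separates the variables in the decay of \<open>g (\<eta> + \<xi>)\<close>.\<close>
    have "weight \<xi> ^ ?d \<le> 2 ^ ?d * weight (\<xi> + \<eta>) ^ ?d * weight \<eta> ^ ?d"
      by (rule weight_peetre_power)
    then have "inverse (weight (\<eta> + \<xi>) ^ ?d) \<le> 2 ^ ?d * weight \<eta> ^ ?d * inverse (weight \<xi> ^ ?d)"
      using weight_pos[of \<xi>] weight_pos[of "\<eta> + \<xi>"] by (simp add: field_simps add.commute)
    then have "C * inverse (weight (\<eta> + \<xi>) ^ ?d) \<le> C * (2 ^ ?d * weight \<eta> ^ ?d * inverse (weight \<xi> ^ ?d))"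
      using C(1) by (rule mult_left_mono)
    then have "norm (g (\<eta> + \<xi>)) \<le> C * (2 ^ ?d * weight \<eta> ^ ?d * inverse (weight \<xi> ^ ?d))"
      using C(2) order_trans by blast
    then have "norm (f \<eta>) * norm (g (\<eta> + \<xi>)) * norm (cinner h (W \<xi> k)) \<le>
        norm (f \<eta>) * (C * (2 ^ ?d * weight \<eta> ^ ?d * inverse (weight \<xi> ^ ?d))) * (norm h * norm k)"
      using C(1) weight_pos[of \<eta>] weight_pos[of \<xi>]
      by (intro mult_mono cinner_weyl_le mult_nonneg_nonneg) auto
    then show "norm (?H \<eta> \<xi>) \<le> (weight \<eta> ^ ?d * norm (f \<eta>)) * (C * 2 ^ ?d * norm h * norm k * inverse (weight \<xi> ^ ?d))"
      by (simp add: norm_mult mult_ac)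
  qed
  also have "\<dots> = (LINT \<xi>|lborel. twisted_conv b (\<lambda>\<eta>. cnj (f \<eta>)) g \<xi> * cinner h (W \<xi> k))"
    by (simp add: twisted_conv_def)
  also have "\<dots> = cinner h (weyl_int u (twisted_conv b (\<lambda>\<eta>. cnj (f \<eta>)) g) k)"
    by (simp add: weyl_int_schwartz(2) schwartz_twisted_conv[OF bilinear_phase cf g])
  finally show "cinner h ((adj ?A o\<^sub>L ?B) k) = cinner h (weyl_int u (twisted_conv b (\<lambda>\<eta>. cnj (f \<eta>)) g) k)" .
qed

end

section \<open>Tracial von Neumann algebras in standard form\<close>

text \<open>The correspondence is isometric, so it is well defined on vectors and extends to the closure;
  linearity and the norm identity are closed conditions. It is indexed by \<^term>\<open>S\<close> because the
  conjugation is given on elements of the algebra rather than on vectors.\<close>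

lemma isometry_extension:
  fixes a c :: "'i \<Rightarrow> 'h::{real_normed_vector,banach}"
  assumes dense: "closure (a ` S) = UNIV"
    and add: "\<And>i j. i \<in> S \<Longrightarrow> j \<in> S \<Longrightarrow> \<exists>k\<in>S. a k = a i + a j \<and> c k = c i + c j"
    and scale: "\<And>r i. i \<in> S \<Longrightarrow> \<exists>k\<in>S. a k = r *\<^sub>R a i \<and> c k = r *\<^sub>R c i"
    and norm: "\<And>i. i \<in> S \<Longrightarrow> norm (c i) = norm (a i)"
  obtains R :: "'h \<Rightarrow>\<^sub>L 'h" where "\<And>i. i \<in> S \<Longrightarrow> R (a i) = c i" "\<And>x. norm (R x) = norm x"
proof -
  have diff: "norm (c i - c j) = norm (a i - a j)" if ij: "i \<in> S" "j \<in> S" for i j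
  proof -
    obtain m where m: "m \<in> S" "a m = (-1) *\<^sub>R a j" "c m = (-1) *\<^sub>R c j" using scale[OF ij(2)] by blast
    obtain k where "k \<in> S" "a k = a i + a m" "c k = c i + c m" using add[OF ij(1) m(1)] by blast
    with m norm[of k] show ?thesis by simp
  qed
  define V where "V = a ` S"
  define f where "f v = c (inv_into S a v)" for v
  have f: "f (a i) = c i" if "i \<in> S" for i
  proof -
    have "inv_into S a (a i) \<in> S" "a (inv_into S a (a i)) = a i"
      using that by (simp_all add: inv_into_into f_inv_into_f)
    with diff[OF this(1) that] show ?thesis by (simp add: f_def)
  qed
  have iso: "norm (f v - f w) = norm (v - w)" if "v \<in> V" "w \<in> V" for v w
    using that f diff by (auto simp: V_def)
  have "uniformly_continuous_on V f"
    unfolding uniformly_continuous_on_def dist_norm using iso by metis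
  then obtain g where g: "uniformly_continuous_on (closure V) g" "\<And>v. v \<in> V \<Longrightarrow> f v = g v"
    using uniformly_continuous_on_extension_on_closure by metis
  have V: "closure V = UNIV" using dense by (simp add: V_def)
  have gc: "continuous_on UNIV g"
    using uniformly_continuous_imp_continuous[OF g(1)] V by simp
  have gS: "g (a i) = c i" if "i \<in> S" for i
    using g(2)[of "a i"] f that by (simp add: V_def)
  have gadd: "g (x + y) = g x + g y" for x y
  proof -
    have "closed {p. g (fst p + snd p) = g (fst p) + g (snd p)}"
      by (intro closed_Collect_eq continuous_on_add continuous_on_compose2[OF gc] continuous_intros) auto
    moreover have "V \<times> V \<subseteq> {p. g (fst p + snd p) = g (fst p) + g (snd p)}"
    proof (clarsimp simp: V_def)
      fix i j assume ij: "i \<in> S" "j \<in> S"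
      then obtain k where "k \<in> S" "a k = a i + a j" "c k = c i + c j" using add by blast
      then show "g (a i + a j) = g (a i) + g (a j)" using gS ij by metis
    qed
    ultimately have "closure (V \<times> V) \<subseteq> {p. g (fst p + snd p) = g (fst p) + g (snd p)}"
      by (rule closure_minimal[rotated])
    then have "(x, y) \<in> {p. g (fst p + snd p) = g (fst p) + g (snd p)}"
      unfolding closure_Times V by blast
    then show ?thesis by simp
  qed
  have gscale: "g (r *\<^sub>R x) = r *\<^sub>R g x" for r x
  proof -
    have "closed {x. g (r *\<^sub>R x) = r *\<^sub>R g x}"
      by (intro closed_Collect_eq continuous_on_scaleR continuous_on_compose2[OF gc] continuous_intros gc) auto
    moreover have "V \<subseteq> {x. g (r *\<^sub>R x) = r *\<^sub>R g x}"
    proof (clarsimp simp: V_def)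
      fix i assume i: "i \<in> S"
      then obtain k where "k \<in> S" "a k = r *\<^sub>R a i" "c k = r *\<^sub>R c i" using scale by blast
      then show "g (r *\<^sub>R a i) = r *\<^sub>R g (a i)" using gS i by metis
    qed
    ultimately have "closure V \<subseteq> {x. g (r *\<^sub>R x) = r *\<^sub>R g x}" by (rule closure_minimal[rotated])
    then show ?thesis unfolding V by blast
  qed
  have gnorm: "norm (g x) = norm x" for x
  proof -
    have "closed {x. norm (g x) = norm x}"
      by (intro closed_Collect_eq continuous_on_norm gc continuous_intros)
    moreover have "V \<subseteq> {x. norm (g x) = norm x}"
      using gS norm by (auto simp: V_def)
    ultimately have "closure V \<subseteq> {x. norm (g x) = norm x}" by (rule closure_minimal[rotated])
    then show ?thesis unfolding V by blast
  qed
  have "bounded_linear g"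
    by (rule bounded_linear_intro[where K = 1]) (simp_all add: gadd gscale gnorm)
  then have "blinfun_apply (Blinfun g) = g" by (rule bounded_linear_Blinfun_apply)
  with gS gnorm show thesis using that[of "Blinfun g"] by simp
qed

lemma positive_adj_compose:
  assumes "x \<in> bops"
  shows "positive_op (adj x o\<^sub>L x)"
  using assms
  by (simp add: positive_op_def bops_compose adj_bops cinner_adj_right cinner_self)

locale standard_form = weyl_representation u b K
  for u :: "'n::{finite,linorder} \<Rightarrow> real \<Rightarrow> 'h::complex_hilbert op"
    and b :: "(real,'n) vec \<Rightarrow> (real,'n) vec \<Rightarrow> real" and K :: "(real,'n) vec \<Rightarrow> complex" +
  fixes \<tau> :: "'h op \<Rightarrow> ennreal" and \<Lambda> :: "'h op \<Rightarrow> 'h"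
  assumes trace: "trace_on (R_alg u) \<tau>"
    and faithful: "faithful_trace (R_alg u) \<tau>"
    and trace_schwartz: "\<And>f. schwartz f \<Longrightarrow> positive_op (weyl_int u f) \<Longrightarrow> \<tau> (weyl_int u f) < \<infinity>"
    and standard: "standard_L2 (R_alg u) \<tau> \<Lambda>"
begin

abbreviation N :: "'h op set" where "N \<equiv> nsq M \<tau>"

subsection \<open>The ideal of square integrable elements\<close>

lemma pos_adj: "x \<in> M \<Longrightarrow> adj x o\<^sub>L x \<in> pos_part M"
  by (simp add: pos_part_def M_algebra M_adj positive_adj_compose M_bops)

lemma trace_add: "x \<in> pos_part M \<Longrightarrow> y \<in> pos_part M \<Longrightarrow> \<tau> (x + y) = \<tau> x + \<tau> y"
  using trace by (simp add: trace_on_def)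

lemma trace_scale: "x \<in> pos_part M \<Longrightarrow> r \<ge> 0 \<Longrightarrow> \<tau> (r *\<^sub>R x) = ennreal r * \<tau> x"
  using trace by (simp add: trace_on_def)

lemma trace_adj: "x \<in> M \<Longrightarrow> \<tau> (x o\<^sub>L adj x) = \<tau> (adj x o\<^sub>L x)"
  using trace by (simp add: trace_on_def)

lemma trace_finite_mono:
  assumes "x \<in> pos_part M" "y \<in> M" "positive_op (y - x)" "\<tau> y < \<infinity>"
  shows "\<tau> x < \<infinity>"
proof -
  have "y - x \<in> pos_part M" using assms by (simp add: pos_part_def M_algebra)
  then have "\<tau> y = \<tau> x + \<tau> (y - x)" using trace_add[OF assms(1)] by force
  then show ?thesis using assms(4) by (simp add: less_top[symmetric])
qed

lemma nsqD: "x \<in> N \<Longrightarrow> x \<in> M" "x \<in> N \<Longrightarrow> \<tau> (adj x o\<^sub>L x) < \<infinity>"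
  by (simp_all add: nsq_def)

lemma nsq_bops: "x \<in> N \<Longrightarrow> x \<in> bops"
  by (rule M_bops[OF nsqD(1)])

lemma nsq_adj: "x \<in> N \<Longrightarrow> adj x \<in> N"
  using trace_adj[of x] by (simp add: nsq_def M_adj adj_adj M_bops)

text \<open>This is the inequality $y^* x^* x y \le \|x\|^2\, y^* y$.\<close>

lemma nsq_left:
  assumes x: "x \<in> M" and y: "y \<in> N"
  shows "x o\<^sub>L y \<in> N"
proof -
  note xb = M_bops[OF x] and yb = nsq_bops[OF y] and yM = nsqD(1)[OF y]
  let ?y = "adj y o\<^sub>L y" and ?xy = "adj (x o\<^sub>L y) o\<^sub>L (x o\<^sub>L y)"
  define r where "r = (norm x)\<^sup>2"
  have xy: "x o\<^sub>L y \<in> M" by (rule M_algebra[OF x yM])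
  have "positive_op (r *\<^sub>R ?y - ?xy)"
    unfolding positive_op_def
  proof (intro conjI allI)
    show "r *\<^sub>R ?y - ?xy \<in> bops"
      using xb yb by (simp add: bops_diff bops_scaleR bops_compose adj_bops)
    fix h
    have eq: "cinner h ((r *\<^sub>R ?y - ?xy) h) = of_real (r * (norm (y h))\<^sup>2 - (norm (x (y h)))\<^sup>2)"
      using cinner_adj_right[OF yb, of h "y h"] cinner_adj_right[OF bops_compose[OF xb yb], of h "x (y h)"]
      by (simp add: blinfun.diff_left blinfun.scaleR_left cinner.diff_right cinner.scaleR_right cinner_self
          scaleR_conv_of_real)
    have "(norm (x (y h)))\<^sup>2 \<le> r * (norm (y h))\<^sup>2"
      unfolding r_def power_mult_distrib[symmetric] by (intro power_mono norm_blinfun) simp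
    then show "Im (cinner h ((r *\<^sub>R ?y - ?xy) h)) = 0" "0 \<le> Re (cinner h ((r *\<^sub>R ?y - ?xy) h))"
      by (simp_all add: eq)
  qed
  moreover have "\<tau> (r *\<^sub>R ?y) < \<infinity>"
    using trace_scale[OF pos_adj[OF yM], of r] nsqD(2)[OF y] by (simp add: r_def ennreal_mult_less_top)
  ultimately have "\<tau> ?xy < \<infinity>"
    using pos_adj[OF xy] M_algebra M_scaleR M_adj yM by (intro trace_finite_mono[of ?xy "r *\<^sub>R ?y"]) auto
  then show ?thesis using xy by (simp add: nsq_def)
qed

lemma nsq_right: "x \<in> N \<Longrightarrow> y \<in> M \<Longrightarrow> x o\<^sub>L y \<in> N"
  using nsq_adj[OF nsq_left[OF M_adj nsq_adj]]
  by (simp add: adj_compose adj_bops adj_adj M_bops nsq_bops)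

text \<open>By the parallelogram law $(x+y)^*(x+y)$ lies below $2x^*x + 2y^*y$.\<close>

lemma nsq_add:
  assumes x: "x \<in> N" and y: "y \<in> N"
  shows "x + y \<in> N"
proof -
  note xb = nsq_bops[OF x] and yb = nsq_bops[OF y] and xM = nsqD(1)[OF x] and yM = nsqD(1)[OF y]
  let ?s = "2 *\<^sub>R (adj x o\<^sub>L x) + 2 *\<^sub>R (adj y o\<^sub>L y)"
  have id: "?s - (adj (x + y) o\<^sub>L (x + y)) = adj (x - y) o\<^sub>L (x - y)"
    by (rule blinfun_eqI)
      (simp add: adj_add adj_diff xb yb blinfun.add_left blinfun.diff_left blinfun.scaleR_left
        blinfun.add_right blinfun.diff_right scaleR_2)
  have sc: "2 *\<^sub>R (adj z o\<^sub>L z) \<in> pos_part M" "\<tau> (2 *\<^sub>R (adj z o\<^sub>L z)) < \<infinity>" if "z \<in> N" for z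
  proof -
    have "2 *\<^sub>R (adj z o\<^sub>L z) = (adj z o\<^sub>L z) + (adj z o\<^sub>L z)" by (simp add: scaleR_2)
    moreover have "(adj z o\<^sub>L z) + (adj z o\<^sub>L z) \<in> pos_part M"
      using pos_adj[OF nsqD(1)[OF that]]
      by (simp add: pos_part_def M_algebra positive_op_def bops_add blinfun.add_left cinner_add_right)
    ultimately show "2 *\<^sub>R (adj z o\<^sub>L z) \<in> pos_part M" by simp
    show "\<tau> (2 *\<^sub>R (adj z o\<^sub>L z)) < \<infinity>"
      using trace_scale[OF pos_adj[OF nsqD(1)[OF that]], of 2] nsqD(2)[OF that]
      by (simp add: ennreal_mult_less_top)
  qed
  have "\<tau> (adj (x + y) o\<^sub>L (x + y)) < \<infinity>"
  proof (rule trace_finite_mono)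
    show "adj (x + y) o\<^sub>L (x + y) \<in> pos_part M" by (rule pos_adj[OF M_algebra(2)[OF xM yM]])
    show "?s \<in> M" by (intro M_algebra(2) M_scaleR M_algebra(1) M_adj xM yM)
    show "positive_op (?s - (adj (x + y) o\<^sub>L (x + y)))"
      unfolding id by (intro positive_adj_compose bops_diff xb yb)
    show "\<tau> ?s < \<infinity>"
      using sc[OF x] sc[OF y] trace_add by simp
  qed
  then show ?thesis using M_algebra(2)[OF xM yM] by (simp add: nsq_def)
qed

text \<open>Finiteness of the trace comes from the product formula: the symbol of
  $\lambda_\Theta(f)^* \lambda_\Theta(f)$ is again a Schwartz function.\<close>

lemma weyl_int_nsq:
  assumes "schwartz f"
  shows "weyl_int u f \<in> N"
proof -
  have M: "weyl_int u f \<in> M" by (rule weyl_int_in_M[OF schwartz_integrable[OF assms]])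
  have "\<tau> (adj (weyl_int u f) o\<^sub>L weyl_int u f) < \<infinity>"
    using positive_adj_compose[OF M_bops[OF M]] unfolding adj_weyl_int_mult[OF assms assms]
    by (intro trace_schwartz schwartz_twisted_conv bilinear_phase schwartz_cnj assms)
  then show ?thesis using M by (simp add: nsq_def)
qed

subsection \<open>The embedding and the modular conjugation\<close>

lemma Lambda_add: "x \<in> N \<Longrightarrow> y \<in> N \<Longrightarrow> \<Lambda> (x + y) = \<Lambda> x + \<Lambda> y"
  using standard by (simp add: standard_L2_def)

lemma Lambda_left: "x \<in> M \<Longrightarrow> y \<in> N \<Longrightarrow> \<Lambda> (x o\<^sub>L y) = x (\<Lambda> y)"
  using standard by (simp add: standard_L2_def)

lemma Lambda_norm: "x \<in> N \<Longrightarrow> ennreal ((norm (\<Lambda> x))\<^sup>2) = \<tau> (adj x o\<^sub>L x)"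
  using standard by (simp add: standard_L2_def)

lemma Lambda_dense: "closure (\<Lambda> ` N) = UNIV"
  using standard by (simp add: standard_L2_def)

lemma Lambda_eq_0:
  assumes "x \<in> N" "\<Lambda> x = 0"
  shows "x = 0"
proof -
  have "\<tau> (adj x o\<^sub>L x) = 0" using Lambda_norm[OF assms(1)] assms(2) by simp
  then have "adj x o\<^sub>L x = 0"
    using faithful pos_adj[OF nsqD(1)[OF assms(1)]] by (simp add: faithful_trace_def)
  then have "cinner h ((adj x o\<^sub>L x) h) = 0" for h by simp
  then have "x h = 0" for h
    using cinner_adj_right[OF nsq_bops[OF assms(1)], of h "x h"] by (simp add: cinner_self)
  then show ?thesis by (intro blinfun_eqI) simp
qed

lemma Lambda_adj_norm: "x \<in> N \<Longrightarrow> norm (\<Lambda> (adj x)) = norm (\<Lambda> x)"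
proof -
  assume x: "x \<in> N"
  have "ennreal ((norm (\<Lambda> (adj x)))\<^sup>2) = ennreal ((norm (\<Lambda> x))\<^sup>2)"
    using Lambda_norm[OF x] Lambda_norm[OF nsq_adj[OF x]] trace_adj[OF nsqD(1)[OF x]]
    by (simp add: adj_adj nsq_bops[OF x])
  then show ?thesis by simp
qed

lemma scalar_multiple:
  assumes "x \<in> N"
  obtains y where "y \<in> N" "\<Lambda> y = c *\<^sub>C \<Lambda> x" "\<Lambda> (adj y) = cnj c *\<^sub>C \<Lambda> (adj x)"
proof -
  obtain A where A: "A \<in> M" "\<And>k. A k = c *\<^sub>C k" using scalar_in_M[of c] by blast
  obtain B where B: "B \<in> M" "\<And>k. B k = cnj c *\<^sub>C k" using scalar_in_M[of "cnj c"] by blast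
  have y: "A o\<^sub>L x \<in> N" by (rule nsq_left[OF A(1) assms])
  have "adj (A o\<^sub>L x) = B o\<^sub>L adj x"
  proof (rule adj_eqI[OF nsq_bops[OF y]])
    show "cinner ((A o\<^sub>L x) h) k = cinner h ((B o\<^sub>L adj x) k)" for h k
      by (simp add: A B cinner_scaleC_left cinner_scaleC_right cinner_adj_right[OF nsq_bops[OF assms]])
  qed
  then show thesis
    using that[OF y] Lambda_left[OF A(1) assms] Lambda_left[OF B(1) nsq_adj[OF assms]] by (simp add: A B)
qed

lemma conjugation_exists:
  "\<exists>J :: 'h op. (\<forall>x\<in>N. J (\<Lambda> x) = \<Lambda> (adj x)) \<and> (\<forall>h. norm (J h) = norm h)"
proof -
  obtain J :: "'h op" where "\<And>x. x \<in> N \<Longrightarrow> J (\<Lambda> x) = \<Lambda> (adj x)" "\<And>h. norm (J h) = norm h"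
  proof (rule isometry_extension[where S = N and a = \<Lambda> and c = "\<lambda>x. \<Lambda> (adj x)"])
    show "\<exists>k\<in>N. \<Lambda> k = \<Lambda> x + \<Lambda> y \<and> \<Lambda> (adj k) = \<Lambda> (adj x) + \<Lambda> (adj y)" if "x \<in> N" "y \<in> N" for x y
      using that by (intro bexI[of _ "x + y"]) (simp_all add: Lambda_add adj_add nsq_bops nsq_adj nsq_add)
    show "\<exists>k\<in>N. \<Lambda> k = r *\<^sub>R \<Lambda> x \<and> \<Lambda> (adj k) = r *\<^sub>R \<Lambda> (adj x)" if "x \<in> N" for r x
      using scalar_multiple[OF that, of "of_real r"] by (metis complex_cnj_complex_of_real scaleR_scaleC)
  qed (use Lambda_dense Lambda_adj_norm in auto)
  then show ?thesis by blast
qed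

text \<open>The modular conjugation of the trace. It is antilinear, hence treated as a bounded real-linear
  operator.\<close>

definition J :: "'h op" where
  "J = (SOME J :: 'h op. (\<forall>x\<in>N. J (\<Lambda> x) = \<Lambda> (adj x)) \<and> (\<forall>h. norm (J h) = norm h))"

lemma J_Lambda: "x \<in> N \<Longrightarrow> J (\<Lambda> x) = \<Lambda> (adj x)" and norm_J: "norm (J h) = norm h"
  using someI_ex[OF conjugation_exists] by (auto simp: J_def)

lemma dense_eqI:
  fixes A B :: "'h op"
  assumes "\<And>x. x \<in> N \<Longrightarrow> A (\<Lambda> x) = B (\<Lambda> x)"
  shows "A = B"
proof (rule blinfun_eqI)
  fix h
  have "closed {h. A h = B h}"
    by (intro closed_Collect_eq linear_continuous_on blinfun.bounded_linear_right)
  moreover have "\<Lambda> ` N \<subseteq> {h. A h = B h}" using assms by auto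
  ultimately have "closure (\<Lambda> ` N) \<subseteq> {h. A h = B h}" by (rule closure_minimal[rotated])
  then show "A h = B h" using Lambda_dense by auto
qed

lemma J_J [simp]: "J (J h) = h"
proof -
  have "J o\<^sub>L J = id_blinfun"
    by (rule dense_eqI) (simp add: J_Lambda nsq_adj adj_adj nsq_bops)
  then have "(J o\<^sub>L J) h = id_blinfun h" by simp
  then show ?thesis by simp
qed

lemma J_scaleC: "J (c *\<^sub>C h) = cnj c *\<^sub>C J h"
proof -
  have bl: "bounded_linear (\<lambda>h. c *\<^sub>C (h::'h))" "bounded_linear (\<lambda>h. cnj c *\<^sub>C (h::'h))"
    by (rule scaleC.bounded_linear_right)+
  note ap = bl[THEN bounded_linear_Blinfun_apply]
  have "J o\<^sub>L Blinfun (\<lambda>h. c *\<^sub>C h) = Blinfun (\<lambda>h. cnj c *\<^sub>C h) o\<^sub>L J"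
  proof (rule dense_eqI)
    fix x assume x: "x \<in> N"
    obtain y where y: "y \<in> N" "\<Lambda> y = c *\<^sub>C \<Lambda> x" "\<Lambda> (adj y) = cnj c *\<^sub>C \<Lambda> (adj x)"
      by (rule scalar_multiple[OF x])
    then have "J (c *\<^sub>C \<Lambda> x) = cnj c *\<^sub>C J (\<Lambda> x)"
      using J_Lambda[OF y(1)] J_Lambda[OF x] by simp
    then show "(J o\<^sub>L Blinfun (\<lambda>h. c *\<^sub>C h)) (\<Lambda> x) = (Blinfun (\<lambda>h. cnj c *\<^sub>C h) o\<^sub>L J) (\<Lambda> x)"
      by (simp add: ap)
  qed
  then have "(J o\<^sub>L Blinfun (\<lambda>h. c *\<^sub>C h)) h = (Blinfun (\<lambda>h. cnj c *\<^sub>C h) o\<^sub>L J) h" by simp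
  then show ?thesis by (simp add: ap)
qed

text \<open>Polarisation of the norm identity; antilinearity of \<open>J\<close> accounts for the exchange of the
  arguments.\<close>

lemma J_cinner: "cinner (J x) (J y) = cinner y x"
proof -
  have re: "Re (cinner (J x) (J y)) = Re (cinner y x)" for x y
  proof -
    have "(norm (J x + J y))\<^sup>2 = (norm (x + y))\<^sup>2"
      unfolding blinfun.add_right[symmetric] norm_J ..
    then have "inner (J x) (J y) = inner x y"
      by (simp add: dot_norm norm_J)
    then show ?thesis by (simp add: Re_cinner inner_commute)
  qed
  have "Im (cinner (J x) (J y)) = Im (cinner y x)"
    using re[of x "\<i> *\<^sub>C y"] by (simp add: J_scaleC cinner_scaleC_left cinner_scaleC_right)
  then show ?thesis using re by (simp add: complex_eq_iff)
qed

lemma J_swap: "cinner (J x) y = cinner (J y) x"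
  using J_cinner[of x "J y"] by simp

lemma J_swap_right: "cinner x (J y) = cinner y (J x)"
  using J_cinner[of "J x" y] by simp

definition conj_op :: "'h op \<Rightarrow> 'h op" where
  "conj_op A = J o\<^sub>L A o\<^sub>L J"

lemma conj_op_apply [simp]: "conj_op A h = J (A (J h))"
  by (simp add: conj_op_def)

lemma conj_op_bops: "A \<in> bops \<Longrightarrow> conj_op A \<in> bops"
  by (simp add: bops_def J_scaleC)

lemma conj_conj_op [simp]: "conj_op (conj_op A) = A"
  by (rule blinfun_eqI) simp

text \<open>Conjugating the left multiplication by $z^*$ gives the right multiplication by \<^term>\<open>z\<close>, because
  $(z^* x^*)^* = xz$.\<close>

lemma conj_op_right:
  assumes x: "x \<in> N" and z: "z \<in> M"
  shows "conj_op (adj z) (\<Lambda> x) = \<Lambda> (x o\<^sub>L z)"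
proof -
  have "conj_op (adj z) (\<Lambda> x) = J (\<Lambda> (adj z o\<^sub>L adj x))"
    using x z by (simp add: J_Lambda Lambda_left nsq_adj M_adj)
  also have "\<dots> = \<Lambda> (adj (adj z o\<^sub>L adj x))"
    by (intro J_Lambda nsq_left M_adj nsq_adj x z)
  also have "adj (adj z o\<^sub>L adj x) = x o\<^sub>L z"
    using x z by (simp add: adj_compose adj_bops adj_adj M_bops nsq_bops)
  finally show ?thesis .
qed

lemma right_mult_conj_op:
  assumes z: "z \<in> M"
  shows "right_mult M \<tau> \<Lambda> z = conj_op (adj z)"
  unfolding right_mult_def
proof (rule the_equality)
  show "\<forall>x\<in>N. conj_op (adj z) (\<Lambda> x) = \<Lambda> (x o\<^sub>L z)" using conj_op_right z by blast
  fix R :: "'h op" assume "\<forall>x\<in>N. R (\<Lambda> x) = \<Lambda> (x o\<^sub>L z)"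
  then show "R = conj_op (adj z)"
    using conj_op_right[OF _ z] by (intro dense_eqI) simp
qed

subsection \<open>The commutation theorem\<close>

text \<open>Products of square integrable elements are dense, since $\lambda_\Theta(f)$ is square
  integrable for Schwartz \<^term>\<open>f\<close> and the Weyl operators include the identity.\<close>

lemma products_dense:
  assumes C: "C \<in> bops" and zero: "\<And>x y. x \<in> N \<Longrightarrow> y \<in> N \<Longrightarrow> C (\<Lambda> (y o\<^sub>L x)) = 0"
  shows "C = 0"
proof (rule dense_eqI)
  fix x assume x: "x \<in> N"
  show "C (\<Lambda> x) = (0 :: 'h op) (\<Lambda> x)"
  proof (rule cinner_ext)
    fix h
    have "cinner (adj C h) (W 0 (\<Lambda> x)) = 0"
    proof (rule weyl_int_separates)
      fix f :: "(real,'n) vec \<Rightarrow> complex" assume f: "schwartz f"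
      have "cinner (adj C h) (weyl_int u f (\<Lambda> x)) = cinner h (C (\<Lambda> (weyl_int u f o\<^sub>L x)))"
        using Lambda_left[OF nsqD(1)[OF weyl_int_nsq[OF f]] x] by (simp add: cinner_adj_left[OF C])
      then show "cinner (adj C h) (weyl_int u f (\<Lambda> x)) = 0"
        using zero[OF x weyl_int_nsq[OF f]] by simp
    qed
    then show "cinner h (C (\<Lambda> x)) = cinner h ((0 :: 'h op) (\<Lambda> x))"
      by (simp add: cinner_adj_left[OF C])
  qed
qed

lemma dense_cinner_eqI:
  assumes "\<And>w. w \<in> N \<Longrightarrow> cinner (\<Lambda> w) x = cinner (\<Lambda> w) y"
  shows "x = y"
proof (rule cinner_ext)
  fix h
  have "closed {h. cinner h x = cinner h y}"
    by (intro closed_Collect_eq cinner.continuous_on continuous_intros)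
  moreover have "\<Lambda> ` N \<subseteq> {h. cinner h x = cinner h y}" using assms by auto
  ultimately have "closure (\<Lambda> ` N) \<subseteq> {h. cinner h x = cinner h y}" by (rule closure_minimal[rotated])
  then show "cinner h x = cinner h y" using Lambda_dense by auto
qed

text \<open>For \<^term>\<open>A\<close> in the commutant the vector \<^term>\<open>A (\<Lambda> x)\<close> is right bounded, and for \<^term>\<open>B\<close>
  commuting with all right multiplications the vector \<^term>\<open>B (\<Lambda> y)\<close> is left bounded. The
  conjugation turns the associated operators into their adjoints (the facts \<open>left\<close> and \<open>right\<close>),
  and so a left bounded vector multiplied by a right bounded one gives the same result whichever of
  the two acts as the operator (the fact \<open>key\<close>). On products this says that \<^term>\<open>A\<close> and
  \<^term>\<open>B\<close> commute.\<close>

lemma commutation: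
  assumes A: "A \<in> commutant M" and B: "B \<in> bops"
    and BR: "\<And>z h. z \<in> M \<Longrightarrow> B (conj_op z h) = conj_op z (B h)"
  shows "A o\<^sub>L B = B o\<^sub>L A"
proof -
  note Ab = commutant_bops[OF A]
  have Az: "A (z h) = z (A h)" if "z \<in> M" for z h using commutantD[OF A that] .
  have BL: "B (\<Lambda> (y o\<^sub>L x)) = J (adj x (J (B (\<Lambda> y))))" if x: "x \<in> N" and y: "y \<in> N" for x y
    using BR[OF M_adj[OF nsqD(1)[OF x]], of "\<Lambda> y"] conj_op_right[OF y nsqD(1)[OF x]] by simp
  note swap = J_swap_right
  have left: "adj y (adj B (\<Lambda> z)) = J (adj z (B (\<Lambda> y)))" if y: "y \<in> N" and z: "z \<in> N" for y z
  proof (rule dense_cinner_eqI)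
    fix w assume w: "w \<in> N"
    note yb = nsq_bops[OF y] and zb = nsq_bops[OF z] and wb = nsq_bops[OF w]
    have "cinner (\<Lambda> w) (adj y (adj B (\<Lambda> z))) = cinner (B (\<Lambda> (y o\<^sub>L w))) (\<Lambda> z)"
      by (simp add: cinner_adj_right yb B Lambda_left[OF nsqD(1)[OF y] w])
    also have "\<dots> = cinner (J (\<Lambda> z)) (adj w (J (B (\<Lambda> y))))"
      unfolding BL[OF w y] by (rule J_swap)
    also have "\<dots> = cinner (\<Lambda> (w o\<^sub>L adj z)) (J (B (\<Lambda> y)))"
      by (simp add: cinner_adj_right wb J_Lambda z Lambda_left nsqD(1)[OF w] nsq_adj)
    also have "\<dots> = cinner (B (\<Lambda> y)) (\<Lambda> (z o\<^sub>L adj w))"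
      unfolding swap[of "\<Lambda> (w o\<^sub>L adj z)"]
      by (simp add: J_Lambda nsq_right w z M_adj nsqD(1) adj_compose adj_bops adj_adj wb zb)
    also have "\<dots> = cinner (adj z (B (\<Lambda> y))) (J (\<Lambda> w))"
      by (simp add: cinner_adj_left zb J_Lambda w Lambda_left nsqD(1)[OF z] nsq_adj)
    also have "\<dots> = cinner (\<Lambda> w) (J (adj z (B (\<Lambda> y))))"
      by (rule swap)
    finally show "cinner (\<Lambda> w) (adj y (adj B (\<Lambda> z))) = cinner (\<Lambda> w) (J (adj z (B (\<Lambda> y))))" .
  qed
  define R where "R x = A o\<^sub>L conj_op (adj x)" for x
  have Rb: "R x \<in> bops" if "x \<in> N" for x
    unfolding R_def by (intro bops_compose Ab conj_op_bops adj_bops nsq_bops that)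
  have right: "adj (R x) (\<Lambda> z) = z (J (A (\<Lambda> x)))" if x: "x \<in> N" and z: "z \<in> N" for x z
  proof (rule dense_cinner_eqI)
    fix w assume w: "w \<in> N"
    note xb = nsq_bops[OF x] and zb = nsq_bops[OF z] and wb = nsq_bops[OF w]
    have "cinner (\<Lambda> w) (adj (R x) (\<Lambda> z)) = cinner (A (\<Lambda> (w o\<^sub>L x))) (\<Lambda> z)"
      using conj_op_right[OF w nsqD(1)[OF x]] by (simp add: cinner_adj_right Rb[OF x]) (simp add: R_def)
    also have "\<dots> = cinner (w (A (\<Lambda> x))) (\<Lambda> z)"
      by (simp add: Lambda_left[OF nsqD(1)[OF w] x] Az nsqD(1)[OF w])
    also have "\<dots> = cinner (A (\<Lambda> x)) (\<Lambda> (adj w o\<^sub>L z))"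
      by (simp add: cinner_adj_right[OF wb, symmetric] Lambda_left M_adj nsqD(1)[OF w] z)
    also have "\<dots> = cinner (\<Lambda> (adj z o\<^sub>L w)) (J (A (\<Lambda> x)))"
      unfolding swap[of "\<Lambda> (adj z o\<^sub>L w)"]
      by (simp add: J_Lambda nsq_left M_adj nsqD(1)[OF z] w adj_compose adj_bops adj_adj wb zb)
    also have "\<dots> = cinner (\<Lambda> w) (z (J (A (\<Lambda> x))))"
      by (simp add: Lambda_left M_adj nsqD(1)[OF z] w cinner_adj_left[OF zb])
    finally show "cinner (\<Lambda> w) (adj (R x) (\<Lambda> z)) = cinner (\<Lambda> w) (z (J (A (\<Lambda> x))))" .
  qed
  have key: "B (y (A (\<Lambda> x))) = R x (B (\<Lambda> y))" if x: "x \<in> N" and y: "y \<in> N" for x y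
  proof (rule dense_cinner_eqI)
    fix z assume z: "z \<in> N"
    note yb = nsq_bops[OF y] and zb = nsq_bops[OF z]
    have "cinner (\<Lambda> z) (B (y (A (\<Lambda> x)))) = cinner (adj y (adj B (\<Lambda> z))) (A (\<Lambda> x))"
      by (simp add: cinner_adj_left yb B)
    also have "\<dots> = cinner (J (A (\<Lambda> x))) (adj z (B (\<Lambda> y)))"
      unfolding left[OF y z] by (rule J_swap)
    also have "\<dots> = cinner (adj (R x) (\<Lambda> z)) (B (\<Lambda> y))"
      by (simp add: right[OF x z] cinner_adj_right[OF zb])
    also have "\<dots> = cinner (\<Lambda> z) (R x (B (\<Lambda> y)))"
      by (rule cinner_adj_left[OF Rb[OF x]])
    finally show "cinner (\<Lambda> z) (B (y (A (\<Lambda> x)))) = cinner (\<Lambda> z) (R x (B (\<Lambda> y)))" .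
  qed
  have "(A o\<^sub>L B) - (B o\<^sub>L A) = 0"
  proof (rule products_dense)
    show "(A o\<^sub>L B) - (B o\<^sub>L A) \<in> bops" using Ab B by (intro bops_diff bops_compose)
    fix x y assume x: "x \<in> N" and y: "y \<in> N"
    have "A (B (\<Lambda> (y o\<^sub>L x))) = R x (B (\<Lambda> y))"
      unfolding BL[OF x y] R_def by simp
    also have "\<dots> = B (A (\<Lambda> (y o\<^sub>L x)))"
      by (simp add: key[OF x y, symmetric] Lambda_left[OF nsqD(1)[OF y] x] Az nsqD(1)[OF y])
    finally show "((A o\<^sub>L B) - (B o\<^sub>L A)) (\<Lambda> (y o\<^sub>L x)) = 0" by (simp add: blinfun.diff_left)
  qed
  then show ?thesis by simp
qed

text \<open>For \<^term>\<open>C\<close> in the commutant, \<^term>\<open>conj_op C\<close> commutes with all right multiplications, so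
  \<^term>\<open>A\<close> commutes with \<^term>\<open>conj_op C\<close> and \<^term>\<open>conj_op A\<close> with \<^term>\<open>C\<close>. The bicommutant
  property of the algebra does the rest.\<close>

theorem conj_op_commutant:
  assumes A: "A \<in> commutant M"
  shows "conj_op A \<in> M"
  unfolding M_eq
proof (rule commutantI[OF conj_op_bops[OF commutant_bops[OF A]]])
  fix C h assume "C \<in> commutant (range W)"
  then have C: "C \<in> commutant M" by (simp add: commutant_M)
  have "A o\<^sub>L conj_op C = conj_op C o\<^sub>L A"
  proof (rule commutation[OF A conj_op_bops[OF commutant_bops[OF C]]])
    show "conj_op C (conj_op z h) = conj_op z (conj_op C h)" if "z \<in> M" for z h
      using commutantD[OF C that] by simp
  qed
  then have "(A o\<^sub>L conj_op C) (J h) = (conj_op C o\<^sub>L A) (J h)" by simp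
  then show "conj_op A (C h) = C (conj_op A h)" by simp
qed

corollary commutant_right_mult:
  assumes "A \<in> commutant M"
  shows "\<exists>z\<in>M. A = right_mult M \<tau> \<Lambda> z"
proof
  show z: "adj (conj_op A) \<in> M" by (intro M_adj conj_op_commutant assms)
  show "A = right_mult M \<tau> \<Lambda> (adj (conj_op A))"
    using conj_op_bops[OF commutant_bops[OF assms]] by (simp add: right_mult_conj_op[OF z] adj_adj)
qed

subsection \<open>Density of the Schwartz elements\<close>

text \<open>The orthogonal complement of the Schwartz elements is invariant under the Weyl operators and
  under the conjugation, so its projection is a central element of the algebra. It annihilates all
  $\lambda_\Theta(f)$ and therefore vanishes.\<close>

lemma schwartz_dense:
  assumes k: "\<And>f. schwartz f \<Longrightarrow> cinner k (\<Lambda> (weyl_int u f)) = 0"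
  shows "k = 0"
proof -
  define L where "L = {k. \<forall>f. schwartz f \<longrightarrow> cinner k (\<Lambda> (weyl_int u f)) = 0}"
  have L0: "cinner l (\<Lambda> (weyl_int u f)) = 0" if "l \<in> L" "schwartz f" for l f
    using that by (simp add: L_def)
  have zero_commute: "cinner x y = 0 \<longleftrightarrow> cinner y x = 0" for x y :: 'h
    by (metis cinner_commute complex_cnj_zero)
  have add: "x + y \<in> L" if "x \<in> L" "y \<in> L" for x y
    using that by (simp add: L_def cinner_add_left)
  have scale: "c *\<^sub>C x \<in> L" if "x \<in> L" for c x
    using that by (simp add: L_def cinner_scaleC_left)
  have "L = (\<Inter>f\<in>{f. schwartz f}. {k. cinner k (\<Lambda> (weyl_int u f)) = 0})"
    by (auto simp: L_def)
  also have "closed \<dots>"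
    by (intro closed_INT ballI closed_Collect_eq cinner.continuous_on continuous_intros)
  finally have "closed L" .
  moreover have "k \<in> L" using k by (simp add: L_def)
  ultimately obtain P :: "'h op" where P: "P \<in> bops" "\<And>x. P x \<in> L" "\<And>x. x \<in> L \<Longrightarrow> P x = x"
      "\<And>x l. l \<in> L \<Longrightarrow> cinner l (x - P x) = 0"
    using orthogonal_projection_exists[of L] add scale by blast
  have P0: "P x = 0" if "\<And>l. l \<in> L \<Longrightarrow> cinner l x = 0" for x
    using P(4)[OF P(2), of x x] that[OF P(2)] by (simp add: cinner.diff_right cinner_self)
  have Sadj: "adj (weyl_int u f) o\<^sub>L weyl_int u g = weyl_int u (twisted_conv b (\<lambda>\<eta>. cnj (f \<eta>)) g)"
    "schwartz (twisted_conv b (\<lambda>\<eta>. cnj (f \<eta>)) g)" if "schwartz f" "schwartz g" for f g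
    using that by (simp_all add: adj_weyl_int_mult schwartz_twisted_conv bilinear_phase schwartz_cnj)
  note SM = nsqD(1)[OF weyl_int_nsq] and Sb = nsq_bops[OF weyl_int_nsq]
  have W_test: "cinner (W \<xi> l) (\<Lambda> (weyl_int u g)) = 0"
    if l: "\<And>f. schwartz f \<Longrightarrow> cinner l (\<Lambda> (adj (weyl_int u f) o\<^sub>L weyl_int u g)) = 0" and g: "schwartz g" for \<xi> l g
  proof -
    have "cinner (\<Lambda> (weyl_int u g)) (W \<xi> l) = 0"
    proof (rule weyl_int_separates)
      fix f :: "(real,'n) vec \<Rightarrow> complex" assume f: "schwartz f"
      have "cinner (weyl_int u f l) (\<Lambda> (weyl_int u g)) = 0"
        using l[OF f] by (simp add: Lambda_left M_adj SM f weyl_int_nsq g cinner_adj_right[OF Sb[OF f]])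
      then show "cinner (\<Lambda> (weyl_int u g)) (weyl_int u f l) = 0" using zero_commute by blast
    qed
    then show ?thesis using zero_commute by blast
  qed
  have WL: "W \<xi> l \<in> L" if "l \<in> L" for \<xi> l
    unfolding L_def using W_test[of l] L0[OF that] Sadj by simp
  have adjWL: "adj (W \<xi>) l \<in> L" if "l \<in> L" for \<xi> l
    unfolding adj_weyl by (intro scale WL that)
  have JL: "J l \<in> L" if l: "l \<in> L" for l
  proof -
    have "cinner (W 0 (J l)) (\<Lambda> (weyl_int u g)) = 0" if g: "schwartz g" for g
    proof (rule W_test[OF _ g])
      fix f :: "(real,'n) vec \<Rightarrow> complex" assume f: "schwartz f"
      have "adj (weyl_int u f) o\<^sub>L weyl_int u g \<in> N"
        by (intro nsq_left M_adj SM f weyl_int_nsq g)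
      from J_Lambda[OF this]
      have "J (\<Lambda> (adj (weyl_int u f) o\<^sub>L weyl_int u g)) = \<Lambda> (adj (weyl_int u g) o\<^sub>L weyl_int u f)"
        using f g by (simp add: adj_compose adj_bops adj_adj Sb)
      moreover have "cinner (\<Lambda> (adj (weyl_int u g) o\<^sub>L weyl_int u f)) l = 0"
        using L0[OF l] Sadj[OF g f] zero_commute by simp
      ultimately show "cinner (J l) (\<Lambda> (adj (weyl_int u f) o\<^sub>L weyl_int u g)) = 0"
        by (subst J_swap) simp
    qed
    then show ?thesis by (simp add: L_def)
  qed
  have "P \<in> commutant (range W)"
  proof (rule commutantI[OF P(1)], elim rangeE, hypsubst)
    fix \<xi> h
    have "P (W \<xi> (h - P h)) = 0"
    proof (rule P0)
      fix l assume "l \<in> L"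
      from P(4)[OF adjWL[OF this], of \<xi> h] show "cinner l (W \<xi> (h - P h)) = 0"
        by (simp add: cinner_adj_left[OF W_bops])
    qed
    then show "P (W \<xi> h) = W \<xi> (P h)"
      using P(3)[OF WL[OF P(2)]] by (simp add: blinfun.diff_right)
  qed
  then have "conj_op P \<in> M" by (intro conj_op_commutant) (simp add: commutant_M)
  moreover have "conj_op P = P"
  proof (rule blinfun_eqI)
    fix h
    have "P (J (J h - P (J h))) = 0"
    proof (rule P0)
      fix l assume "l \<in> L"
      from P(4)[OF JL[OF this], of "J h"] have "cinner (J l) (J (J (J h - P (J h)))) = 0" by simp
      then show "cinner l (J (J h - P (J h))) = 0"
        unfolding J_cinner using zero_commute by blast
    qed
    then show "conj_op P h = P h"
      using P(3)[OF JL[OF P(2)]] by (simp add: blinfun.diff_right)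
  qed
  ultimately have PM: "P \<in> M" by simp
  have "P = 0"
  proof (rule op_ext_cinner)
    fix h k
    have "cinner (adj P h) (W 0 k) = 0"
    proof (rule weyl_int_separates)
      fix f :: "(real,'n) vec \<Rightarrow> complex" assume f: "schwartz f"
      have "\<Lambda> (P o\<^sub>L weyl_int u f) = P (\<Lambda> (weyl_int u f))"
        by (rule Lambda_left[OF PM weyl_int_nsq[OF f]])
      also have "\<dots> = 0" by (rule P0) (rule L0[OF _ f])
      finally have "P o\<^sub>L weyl_int u f = 0"
        by (intro Lambda_eq_0 nsq_left PM weyl_int_nsq f)
      then have "(P o\<^sub>L weyl_int u f) k = 0" by simp
      then show "cinner (adj P h) (weyl_int u f k) = 0"
        by (simp add: cinner_adj_left[OF P(1)])
    qed
    then show "cinner h (P k) = cinner h ((0 :: 'h op) k)"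
      by (simp add: cinner_adj_left[OF P(1)])
  qed
  then show ?thesis using P(3)[OF \<open>k \<in> L\<close>] by simp
qed

end

section \<open>Limits of kernel truncations\<close>

lemma fourier_cutoff:
  fixes \<psi> :: "real^'n::finite \<Rightarrow> complex"
  assumes \<psi>: "schwartz \<psi>" and pos: "\<Delta> > 0" "\<delta> > 0"
  shows "fourier (cutoff \<psi> \<Delta> \<delta>) \<xi> = of_real (\<Delta> ^ DIM(real^'n)) * fourier \<psi> (\<Delta> *\<^sub>R \<xi>)
    - of_real (\<delta> ^ DIM(real^'n)) * fourier \<psi> (\<delta> *\<^sub>R \<xi>)"
proof -
  have int: "integrable lborel (\<lambda>x. \<psi> (x /\<^sub>R t))" if "t > 0" for t
    using integrable_dilate[OF schwartz_integrable[OF \<psi>], of "inverse t"] that by simp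
  have "fourier (cutoff \<psi> \<Delta> \<delta>) \<xi> = fourier (\<lambda>x. \<psi> (x /\<^sub>R \<Delta>)) \<xi> - fourier (\<lambda>x. \<psi> (x /\<^sub>R \<delta>)) \<xi>"
    using int pos by (simp add: fourier_alt cutoff_def left_diff_distrib fourier_integrable)
  then show ?thesis
    using pos by (simp add: fourier_dilate schwartz_measurable[OF \<psi>])
qed

lemma integrable_fourier_cutoff:
  fixes \<psi> :: "real^'n::finite \<Rightarrow> complex"
  assumes \<psi>: "schwartz \<psi>" and pos: "\<Delta> > 0" "\<delta> > 0"
  shows "integrable lborel (fourier (cutoff \<psi> \<Delta> \<delta>))"
proof -
  have "fourier (cutoff \<psi> \<Delta> \<delta>) = (\<lambda>\<xi>. of_real (\<Delta> ^ DIM(real^'n)) * fourier \<psi> (\<Delta> *\<^sub>R \<xi>)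
      - of_real (\<delta> ^ DIM(real^'n)) * fourier \<psi> (\<delta> *\<^sub>R \<xi>))"
    by (rule ext) (rule fourier_cutoff[OF assms])
  moreover have "integrable lborel (\<lambda>\<xi>. fourier \<psi> (t *\<^sub>R \<xi>))" if "t > 0" for t
    using integrable_dilate[OF schwartz_integrable[OF schwartz_fourier[OF \<psi>]] that] .
  ultimately show ?thesis using pos by simp
qed

text \<open>A rank one functional corresponds to sequences supported at the index 0.\<close>

lemma weak_star_limit_cinner:
  fixes A :: "'i \<Rightarrow> 'h::complex_hilbert op"
  assumes "weak_star_limit A S F"
  shows "((\<lambda>i. cinner h (A i k)) \<longlongrightarrow> cinner h (S k)) F"
proof -
  let ?h = "\<lambda>n::nat. if n = 0 then h else 0" and ?k = "\<lambda>n::nat. if n = 0 then k else 0"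
  have sm: "summable (\<lambda>n. (norm (if n = 0 then x else 0))\<^sup>2)" for x :: 'h
    by (rule summable_finite[of "{0}"]) auto
  have single: "(\<Sum>n. cinner (?h n) (B (?k n))) = cinner h (B k)" for B :: "'h op"
    by (subst suminf_finite[of "{0}"]) auto
  have "((\<lambda>i. \<Sum>n. cinner (?h n) (A i (?k n))) \<longlongrightarrow> (\<Sum>n. cinner (?h n) (S (?k n)))) F"
    using assms[unfolded weak_star_limit_def, rule_format, OF sm sm] .
  then show ?thesis unfolding single .
qed

text \<open>The part of the truncation at scale $\Delta$ converges to \<^term>\<open>T\<close>, since its kernel is an
  approximate identity; this uses $\int\widehat\psi = \psi(0) = 1$. The part at scale $\delta$ is an
  average over ever larger regions, and so its limit \<^term>\<open>T - S\<close> is invariant under conjugation by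
  the representation \<^term>\<open>V\<close>.\<close>

lemma truncation_limit_invariant:
  fixes V :: "real^'n::finite \<Rightarrow> 'h::complex_hilbert op" and T S :: "'h op"
    and A :: "real \<Rightarrow> real \<Rightarrow> 'h op"
  assumes \<psi>: "schwartz \<psi>" "\<psi> 0 = 1"
    and V: "\<And>\<xi>. V \<xi> \<in> bops" "\<And>\<xi> h. norm (V \<xi> h) = norm h" "\<And>h. V 0 h = h"
      "\<And>h. continuous_on UNIV (\<lambda>\<xi>. V \<xi> h)"
      "\<And>\<xi> \<eta> h. V \<xi> (V \<eta> h) = cis (p \<xi> \<eta>) *\<^sub>C V (\<xi> + \<eta>) h"
    and T: "T \<in> bops"
    and F: "truncation_filter F"
    and A: "\<And>\<Delta> \<delta> h k. \<Delta> > 0 \<Longrightarrow> \<delta> > 0 \<Longrightarrow> cinner h (A \<Delta> \<delta> k) =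
      (LINT \<xi>|lborel. fourier (cutoff \<psi> \<Delta> \<delta>) \<xi> * cinner (V \<xi> h) (T (V \<xi> k)))"
    and lim: "weak_star_limit (\<lambda>(\<Delta>, \<delta>). A \<Delta> \<delta>) S F"
  shows "cinner (V \<eta> h) ((T - S) (V \<eta> k)) = cinner h ((T - S) k)"
proof -
  let ?d = "DIM(real^'n)" and ?K = "fourier \<psi>"
  let ?av = "\<lambda>t G. LINT \<xi>|lborel. of_real (t ^ ?d) * ?K (t *\<^sub>R \<xi>) * G \<xi>"
  define G where "G h k \<xi> = cinner (V \<xi> h) (T (V \<xi> k))" for h k \<xi>
  have K: "schwartz ?K" by (rule schwartz_fourier[OF \<psi>(1)])
  have Gc: "continuous_on UNIV (G h k)" for h k
    unfolding G_def by (intro cinner.continuous_on blinfun.continuous_on continuous_intros V(4))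
  have Gm [measurable]: "G h k \<in> borel_measurable borel" for h k
    by (rule borel_measurable_continuous_onI[OF Gc])
  have Gb: "norm (G h k \<xi>) \<le> norm T * norm h * norm k" for h k \<xi>
    unfolding G_def using norm_cinner_op_le[of "V \<xi> h" T "V \<xi> k"] by (simp add: V(2))
  have int: "integrable lborel (\<lambda>\<xi>. of_real (t ^ ?d) * ?K (t *\<^sub>R \<xi>) * G h k \<xi>)" if "t > 0" for t h k
  proof (rule integrable_mult_bounded[OF _ _ Gb])
    show "integrable lborel (\<lambda>\<xi>. of_real (t ^ ?d) * ?K (t *\<^sub>R \<xi>))"
      using integrable_dilate[OF schwartz_integrable[OF K] that]
      by (intro Bochner_Integration.integrable_mult_right)
  qed simp
  have F': "F \<noteq> bot" "filterlim fst at_top F" "filterlim snd (at_right 0) F"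
    using F filterlim_mono[OF filterlim_fst order_refl] filterlim_mono[OF filterlim_snd order_refl]
    unfolding truncation_filter_def by blast+
  have pos: "\<forall>\<^sub>F q in F. fst q > 0 \<and> snd q > 0"
    using F'(2,3) eventually_at_right_less[of 0]
    by (intro eventually_conj) (auto simp: filterlim_at_top_dense filterlim_iff)
  have conv: "((\<lambda>q. ?av (snd q) (G h k)) \<longlongrightarrow> cinner h ((T - S) k)) F" for h k
  proof -
    have "((\<lambda>t. ?av t (G h k)) \<longlongrightarrow> (LINT \<xi>|lborel. ?K \<xi>) * G h k 0) at_top"
      by (rule approximate_identity[OF schwartz_integrable[OF K] Gm Gb])
        (use Gc in \<open>simp add: continuous_on_eq_continuous_at\<close>)
    then have "((\<lambda>t. ?av t (G h k)) \<longlongrightarrow> cinner h (T k)) at_top"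
      by (simp add: integral_fourier[OF \<psi>(1)] \<psi>(2) G_def V(3))
    then have 1: "((\<lambda>q. ?av (fst q) (G h k)) \<longlongrightarrow> cinner h (T k)) F"
      by (rule filterlim_compose[OF _ F'(2)])
    have 2: "((\<lambda>q. cinner h ((case q of (\<Delta>, \<delta>) \<Rightarrow> A \<Delta> \<delta>) k)) \<longlongrightarrow> cinner h (S k)) F"
      by (rule weak_star_limit_cinner[OF lim])
    have "\<forall>\<^sub>F q in F. ?av (fst q) (G h k) - cinner h ((case q of (\<Delta>, \<delta>) \<Rightarrow> A \<Delta> \<delta>) k) = ?av (snd q) (G h k)"
      using pos
    proof eventually_elim
      case (elim q)
      have "cinner h ((case q of (\<Delta>, \<delta>) \<Rightarrow> A \<Delta> \<delta>) k) = (LINT \<xi>|lborel.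
          of_real (fst q ^ ?d) * ?K (fst q *\<^sub>R \<xi>) * G h k \<xi> - of_real (snd q ^ ?d) * ?K (snd q *\<^sub>R \<xi>) * G h k \<xi>)"
        using elim by (cases q) (simp add: A fourier_cutoff[OF \<psi>(1)] G_def left_diff_distrib)
      also have "\<dots> = ?av (fst q) (G h k) - ?av (snd q) (G h k)"
        using elim int by (intro Bochner_Integration.integral_diff) auto
      finally show ?case by simp
    qed
    from Lim_transform_eventually[OF tendsto_diff[OF 1 2] this]
    show ?thesis by (simp add: blinfun.diff_left cinner.diff_right)
  qed
  have shift: "G (V \<eta> h) (V \<eta> k) \<xi> = G h k (\<xi> + \<eta>)" for \<xi>
    unfolding G_def V(5) bopsD[OF T] cinner_scaleC_left cinner_scaleC_right
    by (simp add: mult.assoc[symmetric] cis_cnj cis_mult)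
  have "((\<lambda>t. ?av t (\<lambda>\<xi>. G h k (\<xi> + \<eta>)) - ?av t (G h k)) \<longlongrightarrow> 0) (at_right 0)"
    by (rule average_translate[OF K Gm Gb])
  then have "((\<lambda>q. ?av (snd q) (\<lambda>\<xi>. G h k (\<xi> + \<eta>)) - ?av (snd q) (G h k)) \<longlongrightarrow> 0) F"
    by (rule filterlim_compose[OF _ F'(3)])
  moreover have "((\<lambda>q. ?av (snd q) (\<lambda>\<xi>. G h k (\<xi> + \<eta>)) - ?av (snd q) (G h k)) \<longlongrightarrow>
      cinner (V \<eta> h) ((T - S) (V \<eta> k)) - cinner h ((T - S) k)) F"
    using tendsto_diff[OF conv[of "V \<eta> h" "V \<eta> k"] conv[of h k]] unfolding shift .
  ultimately have "cinner (V \<eta> h) ((T - S) (V \<eta> k)) - cinner h ((T - S) k) = 0"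
    using tendsto_unique[OF F'(1)] by blast
  then show ?thesis by simp
qed

context standard_form
begin

text \<open>Two bounded extensions agree in all inner products of the vectors \<^term>\<open>\<Lambda> \<phi>\<close> with the vectors
  \<^term>\<open>\<Lambda> (adj x)\<close>. The former are dense, and so are the latter, their images under \<open>J\<close>.\<close>

lemma L2_op_eqI:
  assumes X: "X \<in> bops"
    and D: "\<And>\<phi> x. \<phi> \<in> S_alg u \<Longrightarrow> x \<in> S_alg u \<Longrightarrow> D \<phi> x = cinner (\<Lambda> (adj x)) (X (\<Lambda> \<phi>))"
  shows "L2_op u \<Lambda> D = X"
  unfolding L2_op_def
proof (rule the_equality)
  show "X \<in> bops \<and> (\<forall>\<phi>\<in>S_alg u. \<forall>x\<in>S_alg u. D \<phi> x = embed_op \<Lambda> X \<phi> x)"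
    using X D by (simp add: embed_op_def L2_functional_def)
  fix Y :: "'h op"
  assume "Y \<in> bops \<and> (\<forall>\<phi>\<in>S_alg u. \<forall>x\<in>S_alg u. D \<phi> x = embed_op \<Lambda> Y \<phi> x)"
  then have Y: "Y \<in> bops" "\<And>\<phi> x. \<phi> \<in> S_alg u \<Longrightarrow> x \<in> S_alg u \<Longrightarrow> D \<phi> x = cinner (\<Lambda> (adj x)) (Y (\<Lambda> \<phi>))"
    by (simp_all add: embed_op_def L2_functional_def)
  note E = bops_diff[OF Y(1) X]
  have S: "weyl_int u f \<in> S_alg u" if "schwartz f" for f
    using that by (simp add: S_alg_def)
  have 1: "(Y - X) (\<Lambda> (weyl_int u f)) = 0" if f: "schwartz f" for f
  proof -
    let ?v = "(Y - X) (\<Lambda> (weyl_int u f))"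
    have "J ?v = 0"
    proof (rule schwartz_dense)
      fix g :: "(real,'n) vec \<Rightarrow> complex" assume g: "schwartz g"
      have "cinner (J (\<Lambda> (weyl_int u g))) ?v = 0"
        using D[OF S[OF f] S[OF g]] Y(2)[OF S[OF f] S[OF g]]
        by (simp add: J_Lambda[OF weyl_int_nsq[OF g]] blinfun.diff_left cinner.diff_right)
      then show "cinner (J ?v) (\<Lambda> (weyl_int u g)) = 0" by (subst J_swap)
    qed
    then have "J (J ?v) = 0" by (simp only: blinfun.zero_right)
    then show ?thesis by (simp only: J_J)
  qed
  have "adj (Y - X) h = 0" for h
    by (rule schwartz_dense) (simp add: cinner_adj_left[OF E] 1)
  then have "cinner h ((Y - X) k) = 0" for h k
    by (simp add: cinner_adj_left[OF E, symmetric])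
  then have "Y - X = 0" by (intro op_ext_cinner) simp
  then show "Y = X" by simp
qed

lemma S_alg_nsq: "x \<in> S_alg u \<Longrightarrow> x \<in> N"
  by (auto simp: S_alg_def weyl_int_nsq)

lemma average_operator_exists:
  fixes V :: "(real,'n) vec \<Rightarrow> 'h op"
  assumes V: "\<And>\<xi>. V \<xi> \<in> bops" "\<And>\<xi> h. norm (V \<xi> h) = norm h" "\<And>h. continuous_on UNIV (\<lambda>\<xi>. V \<xi> h)"
    and T: "T \<in> bops" and m: "integrable lborel m"
  obtains X where "X \<in> bops" "\<And>h k. cinner h (X k) = (LINT \<xi>|lborel. m \<xi> * cinner (V \<xi> h) (T (V \<xi> k)))"
proof -
  let ?A = "\<lambda>\<xi>. adj (V \<xi>) o\<^sub>L T o\<^sub>L V \<xi>"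
  have eq: "cinner h (?A \<xi> k) = cinner (V \<xi> h) (T (V \<xi> k))" for \<xi> h k
    by (simp add: cinner_adj_right[OF V(1)])
  have b: "?A \<xi> \<in> bops" for \<xi>
    by (intro bops_compose adj_bops V(1) T)
  have c: "continuous_on UNIV (\<lambda>\<xi>. cinner h (?A \<xi> k))" for h k
    unfolding eq by (intro cinner.continuous_on blinfun.continuous_on continuous_intros V(3))
  have "norm (?A \<xi>) \<le> norm T" for \<xi>
  proof (rule norm_blinfun_bound)
    fix k
    let ?v = "?A \<xi> k"
    have "norm (cinner ?v ?v) \<le> norm T * norm (V \<xi> ?v) * norm (V \<xi> k)"
      unfolding eq[of ?v] by (rule norm_cinner_op_le)
    moreover have "norm (cinner ?v ?v) = norm ?v * norm ?v"
      unfolding cinner_self norm_of_real by (simp only: power2_eq_square abs_mult abs_norm_cancel)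
    ultimately have "norm ?v * norm ?v \<le> (norm T * norm k) * norm ?v"
      by (simp only: V(2) mult_ac)
    then show "norm ?v \<le> norm T * norm k"
      by (cases "norm ?v = 0") (simp, simp add: mult_le_cancel_right)
  qed simp
  then obtain X where "X \<in> bops" "\<And>h k. cinner h (X k) = (LINT \<xi>|lborel. m \<xi> * cinner h (?A \<xi> k))"
    using weak_integral_exists[OF m b c] by blast
  then show thesis using that unfolding eq by blast
qed

text \<open>The two representations over which the truncations average: multiplication by
  $\lambda_\Theta(\xi)^*$ from the right, written as \<^term>\<open>conj_op (W \<xi>)\<close>, and from the left.\<close>

lemma conj_weyl:
  "conj_op (W \<xi>) \<in> bops" "norm (conj_op (W \<xi>) h) = norm h" "conj_op (W 0) h = h"
  "continuous_on UNIV (\<lambda>\<xi>. conj_op (W \<xi>) h)"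
  "conj_op (W \<xi>) (conj_op (W \<eta>) h) = cis (- b \<xi> \<eta>) *\<^sub>C conj_op (W (\<xi> + \<eta>)) h"
  by (simp_all add: conj_op_bops W_bops norm_J blinfun.continuous_on weyl_continuous weyl_mult
      J_scaleC cis_cnj)

lemma adj_weyl_rep:
  "adj (W \<xi>) \<in> bops" "norm (adj (W \<xi>) h) = norm h" "adj (W 0) h = h"
  "continuous_on UNIV (\<lambda>\<xi>. adj (W \<xi>) h)"
  "adj (W \<xi>) (adj (W \<eta>) h) = cis (- b \<eta> \<xi>) *\<^sub>C adj (W (\<xi> + \<eta>)) h"
proof -
  show "adj (W \<xi>) \<in> bops" "norm (adj (W \<xi>) h) = norm h" "continuous_on UNIV (\<lambda>\<xi>. adj (W \<xi>) h)"
    by (simp_all add: adj_bops W_bops adj_weyl_continuous)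
  show "adj (W 0) h = h" using adj_weyl[of 0 h] by (simp add: b.zero_left)
  show "adj (W \<xi>) (adj (W \<eta>) h) = cis (- b \<eta> \<xi>) *\<^sub>C adj (W (\<xi> + \<eta>)) h"
    by (simp add: adj_weyl bopsD[OF W_bops] weyl_mult scaleC_scaleC cis_mult b.add_left b.add_right
        b.minus_left b.minus_right algebra_simps)
qed

lemma trunc_left_form:
  assumes m: "integrable lborel (fourier (cutoff \<psi> \<Delta> \<delta>))" and T: "T \<in> bops"
  shows "cinner h (trunc_left u \<Lambda> \<psi> T \<Delta> \<delta> k) =
    (LINT \<xi>|lborel. fourier (cutoff \<psi> \<Delta> \<delta>) \<xi> * cinner (adj (W \<xi>) h) (T (adj (W \<xi>) k)))"
proof -
  obtain X where X: "X \<in> bops" "\<And>h k. cinner h (X k) =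
      (LINT \<xi>|lborel. fourier (cutoff \<psi> \<Delta> \<delta>) \<xi> * cinner (adj (W \<xi>) h) (T (adj (W \<xi>) k)))"
    using average_operator_exists[OF adj_weyl_rep(1,2,4) T m] by blast
  have "trunc_left u \<Lambda> \<psi> T \<Delta> \<delta> = X"
    unfolding trunc_left_def
  proof (rule L2_op_eqI[OF X(1)])
    fix \<phi> x assume S: "\<phi> \<in> S_alg u" "x \<in> S_alg u"
    note N = S[THEN S_alg_nsq]
    have "\<Lambda> (adj (x o\<^sub>L W \<xi>)) = adj (W \<xi>) (\<Lambda> (adj x))" "\<Lambda> (adj (W \<xi>) o\<^sub>L \<phi>) = adj (W \<xi>) (\<Lambda> \<phi>)" for \<xi>
      using N by (simp_all add: adj_compose nsq_bops W_bops Lambda_left M_adj weyl_in_M nsq_adj)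
    then show "mult_left u (cutoff \<psi> \<Delta> \<delta>) (embed_op \<Lambda> T) \<phi> x = cinner (\<Lambda> (adj x)) (X (\<Lambda> \<phi>))"
      by (simp add: mult_left_def embed_op_def L2_functional_def X(2))
  qed
  then show ?thesis using X(2) by simp
qed

lemma trunc_right_form:
  assumes m: "integrable lborel (fourier (cutoff \<psi> \<Delta> \<delta>))" and T: "T \<in> bops"
  shows "cinner h (trunc_right u \<Lambda> \<psi> T \<Delta> \<delta> k) =
    (LINT \<xi>|lborel. fourier (cutoff \<psi> \<Delta> \<delta>) \<xi> * cinner (conj_op (W \<xi>) h) (T (conj_op (W \<xi>) k)))"
proof -
  obtain X where X: "X \<in> bops" "\<And>h k. cinner h (X k) =
      (LINT \<xi>|lborel. fourier (cutoff \<psi> \<Delta> \<delta>) \<xi> * cinner (conj_op (W \<xi>) h) (T (conj_op (W \<xi>) k)))"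
    using average_operator_exists[OF conj_weyl(1,2,4) T m] by blast
  have "trunc_right u \<Lambda> \<psi> T \<Delta> \<delta> = X"
    unfolding trunc_right_def
  proof (rule L2_op_eqI[OF X(1)])
    fix \<phi> x assume S: "\<phi> \<in> S_alg u" "x \<in> S_alg u"
    note N = S[THEN S_alg_nsq]
    have r: "\<Lambda> (y o\<^sub>L adj (W \<xi>)) = conj_op (W \<xi>) (\<Lambda> y)" if "y \<in> N" for y \<xi>
      using conj_op_right[OF that M_adj[OF weyl_in_M], of \<xi>] by (simp add: adj_adj W_bops)
    then have "\<Lambda> (\<phi> o\<^sub>L adj (W \<xi>)) = conj_op (W \<xi>) (\<Lambda> \<phi>)"
      "\<Lambda> (adj (W \<xi> o\<^sub>L x)) = conj_op (W \<xi>) (\<Lambda> (adj x))" for \<xi>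
      using N by (simp_all add: adj_compose nsq_bops W_bops nsq_adj)
    then show "mult_right u (cutoff \<psi> \<Delta> \<delta>) (embed_op \<Lambda> T) \<phi> x = cinner (\<Lambda> (adj x)) (X (\<Lambda> \<phi>))"
      by (simp add: mult_right_def embed_op_def L2_functional_def X(2) del: conj_op_apply)
  qed
  then show ?thesis using X(2) by simp
qed

lemma invariant_in_commutant:
  assumes X: "X \<in> bops" and inv: "\<And>\<xi> h k. cinner (adj (W \<xi>) h) (X (adj (W \<xi>) k)) = cinner h (X k)"
  shows "X \<in> commutant M"
  unfolding commutant_M
proof (rule commutantI[OF X], elim rangeE, hypsubst)
  fix \<xi> k
  show "X (W \<xi> k) = W \<xi> (X k)"
  proof (rule cinner_ext)
    fix h
    show "cinner h (X (W \<xi> k)) = cinner h (W \<xi> (X k))"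
      using inv[of \<xi> h "W \<xi> k"] by (simp add: cinner_adj_left[OF W_bops])
  qed
qed

theorem left_truncation_defect:
  assumes \<psi>: "schwartz \<psi>" "\<psi> 0 = 1" and T: "T \<in> bops" and S: "S \<in> bops" and F: "truncation_filter F"
    and lim: "weak_star_limit (\<lambda>(\<Delta>, \<delta>). trunc_left u \<Lambda> \<psi> T \<Delta> \<delta>) S F"
  shows "\<exists>z\<in>M. T - S = right_mult M \<tau> \<Lambda> z"
proof -
  note m = integrable_fourier_cutoff[OF \<psi>(1)]
  have "cinner (adj (W \<xi>) h) ((T - S) (adj (W \<xi>) k)) = cinner h ((T - S) k)" for \<xi> h k
    by (rule truncation_limit_invariant[OF \<psi> adj_weyl_rep(1-3) adj_weyl_rep(4) adj_weyl_rep(5) T F _ lim])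
      (rule trunc_left_form[OF m T])
  then have "T - S \<in> commutant M"
    by (rule invariant_in_commutant[OF bops_diff[OF T S]])
  then show ?thesis by (rule commutant_right_mult)
qed

text \<open>The conjugation turns invariance under the right action into invariance under the left one.\<close>

theorem right_truncation_defect:
  assumes \<psi>: "schwartz \<psi>" "\<psi> 0 = 1" and T: "T \<in> bops" and S: "S \<in> bops" and F: "truncation_filter F"
    and lim: "weak_star_limit (\<lambda>(\<Delta>, \<delta>). trunc_right u \<Lambda> \<psi> T \<Delta> \<delta>) S F"
  shows "T - S \<in> M"
proof -
  note m = integrable_fourier_cutoff[OF \<psi>(1)]
  have inv: "cinner (conj_op (W \<xi>) h) ((T - S) (conj_op (W \<xi>) k)) = cinner h ((T - S) k)" for \<xi> h k
    by (rule truncation_limit_invariant[OF \<psi> conj_weyl(1-3) conj_weyl(4) conj_weyl(5) T F _ lim])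
      (rule trunc_right_form[OF m T])
  have "conj_op (T - S) \<in> commutant M"
  proof (rule invariant_in_commutant[OF conj_op_bops[OF bops_diff[OF T S]]])
    fix \<xi> h k
    have "cinner (J (adj (W \<xi>) h)) ((T - S) (J (adj (W \<xi>) k))) = cinner (J h) ((T - S) (J k))"
      using inv[of \<xi> "J (adj (W \<xi>) h)" "J (adj (W \<xi>) k)"] by simp
    then have "cinner ((T - S) (J (adj (W \<xi>) k))) (J (adj (W \<xi>) h)) = cinner ((T - S) (J k)) (J h)"
      by (metis cinner_commute)
    then show "cinner (adj (W \<xi>) h) (conj_op (T - S) (adj (W \<xi>) k)) = cinner h (conj_op (T - S) k)"
      unfolding conj_op_apply J_swap_right[of "adj (W \<xi>) h"] J_swap_right[of h] .
  qed
  from conj_op_commutant[OF this] show ?thesis by simp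
qed

end

text \<open>Schwartz functions are smooth and integrable, so the trace formula makes the trace of a positive
  $\lambda_\Theta(f)$ with Schwartz symbol finite.\<close>

lemma quantum_euclidean_standard_form:
  fixes \<Theta> :: "real^('n::{finite,linorder})^('n::{finite,linorder})"
    and u :: "'n \<Rightarrow> real \<Rightarrow> 'h::complex_hilbert op"
  assumes Q: "quantum_euclidean \<Theta> u \<tau> \<Lambda>" and K: "schwartz K" "(LINT x|lborel. K x) = 1"
  obtains b where "standard_form u b K \<tau> \<Lambda>"
proof -
  have w: "weyl_system \<Theta> u" using Q by (simp add: quantum_euclidean_def)
  obtain b where b: "bounded_bilinear b"
    "\<And>\<xi> \<eta> h. weyl_op u \<xi> (weyl_op u \<eta> h) = cis (b \<xi> \<eta>) *\<^sub>C weyl_op u (\<xi> + \<eta>) h"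
    using weyl_op_mult[OF w] by blast
  interpret weyl_representation u b K
    by (rule weyl_representation.intro) (use b K weyl_op_unitary[OF w] weyl_op_continuous[OF w] in simp_all)
  have "standard_form u b K \<tau> \<Lambda>"
  proof
    fix f :: "(real,'n) vec \<Rightarrow> complex" assume f: "schwartz f" "positive_op (weyl_int u f)"
    have "smooth f" "integrable lborel f"
      using f(1) by (simp_all add: schwartz_def schwartz_integrable)
    then have "\<tau> (weyl_int u f) = ennreal (Re (f 0))"
      using Q f(2) by (simp add: quantum_euclidean_def)
    then show "\<tau> (weyl_int u f) < \<infinity>" by simp
  qed (use Q in \<open>simp_all add: quantum_euclidean_def\<close>)
  then show thesis by (rule that)
qed

theorem theorem2p23:
  fixes \<Theta> :: "real^('n::{finite,linorder})^('n::{finite,linorder})"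
    and u :: "'n \<Rightarrow> real \<Rightarrow> 'h::complex_hilbert op"
    and \<tau> :: "'h op \<Rightarrow> ennreal"
    and \<Lambda> :: "'h op \<Rightarrow> 'h"
    and T Sl Sr :: "'h op"
    and \<psi> :: "real^('n::{finite,linorder}) \<Rightarrow> complex"
    and Fl Fr :: "(real \<times> real) filter"
  assumes "transpose \<Theta> = - \<Theta>"
    and "quantum_euclidean \<Theta> u \<tau> \<Lambda>"
    and "T \<in> bops"
    and "schwartz \<psi>"
    and "\<And>x. x \<in> ball 0 1 \<Longrightarrow> \<psi> x = 1"
    and "\<And>x. x \<notin> ball 0 2 \<Longrightarrow> \<psi> x = 0"
    and "Sl \<in> bops" and "truncation_filter Fl"
    and "weak_star_limit (\<lambda>(\<Delta>, \<delta>). trunc_left u \<Lambda> \<psi> T \<Delta> \<delta>) Sl Fl"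
    and "Sr \<in> bops" and "truncation_filter Fr"
    and "weak_star_limit (\<lambda>(\<Delta>, \<delta>). trunc_right u \<Lambda> \<psi> T \<Delta> \<delta>) Sr Fr"
  shows "\<exists>zl\<in>R_alg u. \<exists>zr\<in>R_alg u.
           (\<forall>a. (T - Sl) a = right_mult (R_alg u) \<tau> \<Lambda> zl a) \<and>
           (\<forall>a. (T - Sr) a = zr a)"
proof -
  have \<psi>0: "\<psi> 0 = 1" using assms(5)[of 0] by simp
  have "(LINT \<xi>|lborel. fourier \<psi> \<xi>) = 1"
    using integral_fourier[OF assms(4)] \<psi>0 by simp
  then obtain b where "standard_form u b (fourier \<psi>) \<tau> \<Lambda>"
    using quantum_euclidean_standard_form[OF assms(2) schwartz_fourier[OF assms(4)]] by blast
  then interpret standard_form u b "fourier \<psi>" \<tau> \<Lambda> .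
  obtain zl where "zl \<in> R_alg u" "T - Sl = right_mult (R_alg u) \<tau> \<Lambda> zl"
    using left_truncation_defect[OF assms(4) \<psi>0 assms(3,7,8,9)] by blast
  moreover have "T - Sr \<in> R_alg u"
    by (rule right_truncation_defect[OF assms(4) \<psi>0 assms(3,10,11,12)])
  ultimately show ?thesis by (intro bexI[of _ zl] bexI[of _ "T - Sr"]) simp_all
qed

end
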